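(* Let $\beta$ be an ordered partition of $N$ and suppose $\zeta\in(\mathfrak t')^*_\beta$ is $\beta$-generic with $\zeta(c)\ne0$. Then, as $\bar{\mathcal H}$-modules, $\mathcal Y_\beta(\zeta)=\bigoplus_{x\in X^\beta}\bar{\mathcal H}\cdot\varphi_x{\bf 1}_\zeta$, and for each $x\in X^\beta$ the summand $\bar{\mathcal H}\cdot\varphi_x{\bf 1}_\zeta$ is irreducible and isomorphic to $\bar{\mathcal Y}_{\beta(x)}(\overline{x(\zeta)})$ (via ${\bf 1}_{\overline{x(\zeta)}}\mapsto\varphi_x{\bf 1}_\zeta$), where $\overline{x(\zeta)}\in\bar{\mathfrak t}^*$ is the restriction of $x(\zeta)$ to $\bar{\mathfrak t}$.
   Context: Fix an integer $N\ge2$. Let $\bar{\mathfrak t}=\bigoplus_{i=1}^N\mathbb C\epsilon_i^\vee$, $\mathfrak t'=\bar{\mathfrak t}\oplus\mathbb Cc$, and let $\epsilon_1,\dots,\epsilon_N\in\bar{\mathfrak t}^*$ be the dual basis; regard $\bar{\mathfrak t}^*\subset(\mathfrak t')^*=\bar{\mathfrak t}^*\oplus\mathbb Cc^*$ with $\epsilon_i(c)=0$, $c^*(c)=1$, $c^*(\bar{\mathfrak t})=0$. Put $(\epsilon_i,\epsilon_j)=\delta_{ij}$ and, for $\zeta\in(\mathfrak t')^*$ and $\bar\alpha=\sum_ia_i\epsilon_i$, $(\zeta,\bar\alpha)=\sum_ia_i\zeta(\epsilon_i^\vee)$. Let $\bar R=\{\alpha_{ij}=\epsilon_i-\epsilon_j:i\ne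 j\}$, $\bar R_+=\{\alpha_{ij}:i<j\}$, $\alpha_i=\alpha_{i,i+1}$ ($1\le i\le N-1$), $\bar\Pi=\{\alpha_1,\dots,\alpha_{N-1}\}$. With a formal symbol $\delta$, the affine roots are $R=\{\bar\alpha+k\delta:\bar\alpha\in\bar R,k\in\mathbb Z\}$, $R_+=\{\bar\alpha+k\delta:\bar\alpha\in\bar R_+,k\ge0\}\cup\{-\bar\alpha+k\delta:\bar\alpha\in\bar R_+,k>0\}$, $R_-=R\setminus R_+$, and $\alpha_0=\delta-\alpha_{1N}$; indices $0,\dots,N-1$ are read modulo $N$. For $\alpha=\bar\alpha+k\delta\in R$ and $\zeta\in(\mathfrak t')^*$ set $(\zeta,\alpha)=(\zeta,\bar\alpha)+k\zeta(c)$; the coroot is $\alpha^\vee=\bar\alpha^\vee+kc\in\mathfrak t'$, where $(\epsilon_i-\epsilon_j)^\vee=\epsilon_i^\vee-\epsilon_j^\vee$, and $\alpha(\xi):=\bar\alpha(\xi)$ for $\xi\in\mathfrak t'$. Let $\bar P=\bigoplus_i\mathbb Z\epsilon_i$, $\bar P_-=\{\eta\in\bar P:(\eta,\alpha)\le0\ \forall\alpha\in\bar R_+\}$, $\bar W=\mathfrak S_N$ acting on indices ($w(\epsilon_i)=\epsilon_{w(i)}$, $w(\epsilon_i^\vee)=\epsilon^\vee_{w(i)}$, $w(c)=c$, $w(c^* )=c^*$), and $W=\bar W\ltimes\bar P$ with elements $wt_\eta$ and $wt_\eta w^{-1}=t_{w(\eta)}$. $W$ acts on $R$ by $w(\bar\alpha+k\delta)=w(\bar\alpha)+k\delta$,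 $t_\eta(\bar\alpha+k\delta)=\bar\alpha+(k-(\eta,\bar\alpha))\delta$; on $\mathfrak t'$ by $t_\eta(\xi)=\xi-\eta(\xi)c$; and on $(\mathfrak t')^*$ by the affine action $t_\eta(\zeta)=\zeta+\zeta(c)\eta$. For $\alpha=\bar\alpha+k\delta\in R$ let $s_\alpha=t_{-k\bar\alpha}s_{\bar\alpha}$, $s_i=s_{\alpha_i}$, $\pi=t_{\epsilon_1}s_1\cdots s_{N-1}$; $W$ is generated by $s_0,\dots,s_{N-1},\pi^{\pm1}$. $S(w)=R_+\cap w^{-1}(R_-)$, $l(w)=\#S(w)$, reduced expressions $w=\pi^ks_{j_1}\cdots s_{j_l}$ have $l=l(w)$. The degenerate double affine Hecke algebra $\mathcal H$ is the unital associative $\mathbb C$-algebra equal to $\mathbb C[W]\otimes S[\mathfrak t']$ as a vector space (via multiplication), in which $\mathbb C[W]$ and $S[\mathfrak t']$ are subalgebras and $s_i\xi-s_i(\xi)s_i=-\alpha_i(\xi)$ ($0\le i\le N-1$, $\xi\in\mathfrak t'$), $\pi\xi=\pi(\xi)\pi$. $\bar{\mathcal H}$ is the subalgebra generated by $\bar W$ and $\bar{\mathfrak t}$. Intertwiners: $\varphi_i=1+s_i\alpha_i^\vee$, $\varphi_\pi=\pi$, $\varphi_w=\varphi_\pi^k\varphi_{j_1}\cdots\varphi_{j_l}$ for a reduced expression $w=\pi^ks_{j_1}\cdots s_{j_l}$. An ordered partition $\gamma$ of $N$ gives blocks of consecutive indices of sizes $\gamma_1,\dots,\gamma_r$; $\bar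 R_\gamma=\{\alpha_{ij}:i,j\text{ in the same block}\}$, $\bar R_{\gamma,+}=\bar R_\gamma\cap\bar R_+$, $\bar\Pi_\gamma=\bar\Pi\cap\bar R_\gamma$, $\bar W_\gamma=\langle s_\alpha:\alpha\in\bar\Pi_\gamma\rangle$; $\mathcal H_\gamma$ (resp. $\bar{\mathcal H}_\gamma$) is the subalgebra generated by $S[\mathfrak t']$ (resp. $S[\bar{\mathfrak t}]$) and $\bar W_\gamma$. $(\mathfrak t')^*_\gamma=\{\zeta\in(\mathfrak t')^*:(\zeta,\alpha)=-1\ \forall\alpha\in\bar\Pi_\gamma\}$, and $\bar{\mathfrak t}^*_\gamma$ analogously in $\bar{\mathfrak t}^*$. For such $\zeta$, $\mathbb C1_\zeta$ is the one-dimensional module with $w1_\zeta=1_\zeta$ ($w\in\bar W_\gamma$), $\xi1_\zeta=\zeta(\xi)1_\zeta$; $\mathcal Y_\gamma(\zeta)=\mathcal H\otimes_{\mathcal H_\gamma}\mathbb C1_\zeta$, $\bar{\mathcal Y}_\gamma(\zeta)=\bar{\mathcal H}\otimes_{\bar{\mathcal H}_\gamma}\mathbb C1_\zeta$, with cyclic vector ${\bf 1}_\zeta=1\otimes1_\zeta$. $W^\gamma=\{w\in W:l(wu)\ge l(w)\ \forall u\in\bar W_\gamma\}$, $\bar W^\gamma=W^\gamma\cap\bar W$. A weight $\zeta\in(\mathfrak t')^*_\gamma$ is $\gamma$-generic if $(\zeta,\alpha)\notin\{1,0,-1\}$ for all $\alpha\in R_+\setminus\bar R_{\gamma,+}$.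 For $w\in W$, $\beta(w)$ is the ordered partition of $N$ with $\bar\Pi_{\beta(w)}=\bar\Pi\cap w(\bar R_{\beta,+})$. For $w\in\bar W^\beta$, $\eta_w\in\bar P_-$ is defined by $(\eta_w,\epsilon_1)=0$ and $(\eta_w,\alpha_i)=-1$ if $\alpha_i\in w(\bar R_+\setminus\bar R_{\beta,+})$, $0$ otherwise; $\bar P_-(w)=\{\eta+\eta_w:\eta\in\bar P_-\}$; $X^\beta=\{t_\eta w:w\in\bar W^\beta,\eta\in\bar P_-(w)\}$. *)

theory Defs
  imports Complex_Main "HOL-Combinatorics.Permutations" "HOL-Combinatorics.Transposition"
begin

text \<open>An element (sigma, eta) represents t_eta sigma, sigma a permutation of {1..N}
  (identity outside), eta = sum_i eta(i) eps_i (zero outside {1..N}).\<close>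

type_synonym W = "(nat \<Rightarrow> nat) \<times> (nat \<Rightarrow> int)"

definition inW :: "nat \<Rightarrow> W \<Rightarrow> bool" where
  "inW N w \<longleftrightarrow> fst w permutes {1..N} \<and> (\<forall>i. i \<notin> {1..N} \<longrightarrow> snd w i = 0)"

definition inWbar :: "nat \<Rightarrow> W \<Rightarrow> bool" where
  "inWbar N w \<longleftrightarrow> inW N w \<and> snd w = (\<lambda>_. 0)"

definition idW :: W where "idW = (id, \<lambda>_. 0)"

definition wmul :: "W \<Rightarrow> W \<Rightarrow> W" where
  "wmul u v = (fst u \<circ> fst v, \<lambda>i. snd u i + snd v (inv (fst u) i))"

definition winv :: "W \<Rightarrow> W" where
  "winv u = (inv (fst u), \<lambda>i. - snd u (fst u i))"

definition wpowi :: "W \<Rightarrow> int \<Rightarrow> W" where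
  "wpowi w k = (if 0 \<le> k then (wmul w ^^ nat k) idW else (wmul (winv w) ^^ nat (- k)) idW)"

definition transl :: "(nat \<Rightarrow> int) \<Rightarrow> W" where "transl eta = (id, eta)"

definition eps :: "nat \<Rightarrow> nat \<Rightarrow> int" where "eps i = (\<lambda>j. if j = i then 1 else 0)"

section \<open>Affine roots: (i,j,k) stands for eps_i - eps_j + k delta\<close>

type_synonym aroot = "nat \<times> nat \<times> int"

definition is_root :: "nat \<Rightarrow> aroot \<Rightarrow> bool" where
  "is_root N a \<longleftrightarrow> (case a of (i,j,k) \<Rightarrow> i \<in> {1..N} \<and> j \<in> {1..N} \<and> i \<noteq> j)"

definition pos_root :: "nat \<Rightarrow> aroot \<Rightarrow> bool" where
  "pos_root N a \<longleftrightarrow> is_root N a \<and>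
     (case a of (i,j,k) \<Rightarrow> (i < j \<and> 0 \<le> k) \<or> (j < i \<and> 0 < k))"

definition neg_root :: "nat \<Rightarrow> aroot \<Rightarrow> bool" where
  "neg_root N a \<longleftrightarrow> is_root N a \<and> \<not> pos_root N a"

text \<open>(t_eta sigma)(eps_i - eps_j + k delta) = eps_{sigma i} - eps_{sigma j} + (k - (eta, eps_{sigma i} - eps_{sigma j})) delta\<close>
definition wroot :: "W \<Rightarrow> aroot \<Rightarrow> aroot" where
  "wroot w a = (case a of (i,j,k) \<Rightarrow>
     (fst w i, fst w j, k - (snd w (fst w i) - snd w (fst w j))))"

definition Sset :: "nat \<Rightarrow> W \<Rightarrow> aroot set" where
  "Sset N w = {a. pos_root N a \<and> neg_root N (wroot w a)}"

definition len :: "nat \<Rightarrow> W \<Rightarrow> nat" where "len N w = card (Sset N w)"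

text \<open>s_alpha = t_{-k alpha_bar} s_{alpha_bar}\<close>
definition s_alpha :: "aroot \<Rightarrow> W" where
  "s_alpha a = (case a of (i,j,k) \<Rightarrow> (transpose i j, \<lambda>l. - k * (eps i l - eps j l)))"

text \<open>alpha_0 = delta - alpha_{1N} = eps_N - eps_1 + delta; alpha_i = eps_i - eps_{i+1}\<close>
definition simple_root :: "nat \<Rightarrow> nat \<Rightarrow> aroot" where
  "simple_root N i = (if i = 0 then (N, 1, 1) else (i, Suc i, 0))"

definition sW :: "nat \<Rightarrow> nat \<Rightarrow> W" where "sW N i = s_alpha (simple_root N i)"

definition piW :: "nat \<Rightarrow> W" where
  "piW N = wmul (transl (eps 1)) (foldr wmul (map (sW N) [1..<N]) idW)"

definition word :: "nat \<Rightarrow> int \<Rightarrow> nat list \<Rightarrow> W" where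
  "word N k js = wmul (wpowi (piW N) k) (foldr wmul (map (sW N) js) idW)"

definition reduced_expr :: "nat \<Rightarrow> W \<Rightarrow> int \<times> nat list \<Rightarrow> bool" where
  "reduced_expr N w e \<longleftrightarrow> (\<forall>j \<in> set (snd e). j < N) \<and> word N (fst e) (snd e) = w
      \<and> length (snd e) = len N w"

section \<open>t' and its dual: (a, b) = sum_i a_i eps_i^vee + b c ;  zeta = (z, z(c))\<close>

type_synonym tvec = "(nat \<Rightarrow> complex) \<times> complex"

definition act_t :: "nat \<Rightarrow> W \<Rightarrow> tvec \<Rightarrow> tvec" where
  "act_t N w xi = (let a' = (\<lambda>j. fst xi (inv (fst w) j))
     in (a', snd xi - (\<Sum>j\<in>{1..N}. of_int (snd w j) * a' j)))"

definition act_dual :: "W \<Rightarrow> tvec \<Rightarrow> tvec" where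
  "act_dual w zeta = (\<lambda>j. fst zeta (inv (fst w) j) + snd zeta * of_int (snd w j), snd zeta)"

definition zeta_eval :: "nat \<Rightarrow> tvec \<Rightarrow> tvec \<Rightarrow> complex" where
  "zeta_eval N zeta xi = (\<Sum>i\<in>{1..N}. fst zeta i * fst xi i) + snd zeta * snd xi"

definition pair :: "tvec \<Rightarrow> aroot \<Rightarrow> complex" where
  "pair zeta a = (case a of (i,j,k) \<Rightarrow> fst zeta i - fst zeta j + of_int k * snd zeta)"

text \<open>alpha(xi) := alpha_bar(xi)\<close>
definition rootval :: "aroot \<Rightarrow> tvec \<Rightarrow> complex" where
  "rootval a xi = (case a of (i,j,k) \<Rightarrow> fst xi i - fst xi j)"

definition coroot :: "aroot \<Rightarrow> tvec" where
  "coroot a = (case a of (i,j,k) \<Rightarrow>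
     (\<lambda>l. (if l = i then 1 else 0) - (if l = j then 1 else 0), of_int k))"

definition is_opart :: "nat \<Rightarrow> nat list \<Rightarrow> bool" where
  "is_opart N g \<longleftrightarrow> (\<forall>x \<in> set g. 0 < x) \<and> sum_list g = N"

definition in_block :: "nat list \<Rightarrow> nat \<Rightarrow> nat \<Rightarrow> bool" where
  "in_block g k i \<longleftrightarrow> sum_list (take k g) < i \<and> i \<le> sum_list (take (Suc k) g)"

definition same_block :: "nat list \<Rightarrow> nat \<Rightarrow> nat \<Rightarrow> bool" where
  "same_block g i j \<longleftrightarrow> (\<exists>k < length g. in_block g k i \<and> in_block g k j)"

text \<open>indices i (1 <= i < N) with alpha_i in Pi_gamma\<close>
definition Pi_g :: "nat \<Rightarrow> nat list \<Rightarrow> nat set" where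
  "Pi_g N g = {i. 1 \<le> i \<and> i < N \<and> same_block g i (Suc i)}"

definition Rbar_g_pos :: "nat \<Rightarrow> nat list \<Rightarrow> aroot set" where
  "Rbar_g_pos N g = {(i, j, 0) | i j. i \<in> {1..N} \<and> j \<in> {1..N} \<and> i < j \<and> same_block g i j}"

inductive_set Wbar_g :: "nat \<Rightarrow> nat list \<Rightarrow> W set" for N g where
  "idW \<in> Wbar_g N g"
| "i \<in> Pi_g N g \<Longrightarrow> w \<in> Wbar_g N g \<Longrightarrow> wmul (sW N i) w \<in> Wbar_g N g"

definition t_dual_g :: "nat \<Rightarrow> nat list \<Rightarrow> tvec \<Rightarrow> bool" where
  "t_dual_g N g zeta \<longleftrightarrow> (\<forall>i \<in> Pi_g N g. pair zeta (i, Suc i, 0) = -1)"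

definition generic :: "nat \<Rightarrow> nat list \<Rightarrow> tvec \<Rightarrow> bool" where
  "generic N g zeta \<longleftrightarrow>
     (\<forall>a. pos_root N a \<and> a \<notin> Rbar_g_pos N g \<longrightarrow> pair zeta a \<notin> {1, 0, -1})"

definition beta_of :: "nat \<Rightarrow> nat list \<Rightarrow> W \<Rightarrow> nat list" where
  "beta_of N b w = (THE g. is_opart N g \<and>
     Pi_g N g = {i. 1 \<le> i \<and> i < N \<and> (\<exists>a \<in> Rbar_g_pos N b. wroot w a = (i, Suc i, 0))})"

definition Wmin :: "nat \<Rightarrow> nat list \<Rightarrow> W set" where
  "Wmin N g = {w. inW N w \<and> (\<forall>u \<in> Wbar_g N g. len N w \<le> len N (wmul w u))}"

definition inP :: "nat \<Rightarrow> (nat \<Rightarrow> int) \<Rightarrow> bool" where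
  "inP N eta \<longleftrightarrow> (\<forall>i. i \<notin> {1..N} \<longrightarrow> eta i = 0)"

definition Pminus :: "nat \<Rightarrow> (nat \<Rightarrow> int) \<Rightarrow> bool" where
  "Pminus N eta \<longleftrightarrow> inP N eta \<and> (\<forall>i j. 1 \<le> i \<longrightarrow> i < j \<longrightarrow> j \<le> N \<longrightarrow> eta i - eta j \<le> 0)"

definition eta_w :: "nat \<Rightarrow> nat list \<Rightarrow> W \<Rightarrow> nat \<Rightarrow> int" where
  "eta_w N b w = (THE eta. inP N eta \<and> eta 1 = 0 \<and>
     (\<forall>i. 1 \<le> i \<and> i < N \<longrightarrow> eta i - eta (Suc i) =
        (if (\<exists>a. pos_root N a \<and> (\<exists>i' j'. a = (i', j', 0)) \<and> a \<notin> Rbar_g_pos N b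
                 \<and> wroot w a = (i, Suc i, 0)) then -1 else 0)))"

definition Xbeta :: "nat \<Rightarrow> nat list \<Rightarrow> W set" where
  "Xbeta N b = {wmul (transl (\<lambda>i. eta i + eta_w N b w i)) w | w eta.
       w \<in> Wmin N b \<and> inWbar N w \<and> Pminus N eta}"

definition Xlin :: "nat \<Rightarrow> (complex \<Rightarrow> 'h::ring_1) \<Rightarrow> (nat \<Rightarrow> 'h) \<Rightarrow> 'h \<Rightarrow> tvec \<Rightarrow> 'h" where
  "Xlin N sc Xe Xc xi = (\<Sum>i\<in>{1..N}. sc (fst xi i) * Xe i) + sc (snd xi) * Xc"

definition Xmono :: "nat \<Rightarrow> (nat \<Rightarrow> 'h::ring_1) \<Rightarrow> 'h \<Rightarrow> (nat \<Rightarrow> nat) \<Rightarrow> 'h" where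
  "Xmono N Xe Xc m = prod_list (map (\<lambda>i. Xe i ^ m i) [1..<N+1]) * Xc ^ m 0"

definition Monos :: "nat \<Rightarrow> (nat \<Rightarrow> nat) set" where
  "Monos N = {m. \<forall>i. N < i \<longrightarrow> m i = 0}"

definition DDAHA :: "nat \<Rightarrow> (complex \<Rightarrow> 'h::ring_1) \<Rightarrow> (W \<Rightarrow> 'h) \<Rightarrow> (nat \<Rightarrow> 'h) \<Rightarrow> 'h \<Rightarrow> bool" where
  "DDAHA N sc T Xe Xc \<longleftrightarrow>
     (\<forall>a b. sc (a + b) = sc a + sc b) \<and> (\<forall>a b. sc (a * b) = sc a * sc b) \<and> sc 1 = 1 \<and>
     (\<forall>a h. sc a * h = h * sc a) \<and>
     T idW = 1 \<and> (\<forall>u v. inW N u \<longrightarrow> inW N v \<longrightarrow> T (wmul u v) = T u * T v) \<and>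
     (\<forall>i \<in> {1..N}. \<forall>j \<in> {1..N}. Xe i * Xe j = Xe j * Xe i) \<and>
     (\<forall>i \<in> {1..N}. Xe i * Xc = Xc * Xe i) \<and>
     (\<forall>i < N. \<forall>xi. T (sW N i) * Xlin N sc Xe Xc xi
         - Xlin N sc Xe Xc (act_t N (sW N i) xi) * T (sW N i) = - sc (rootval (simple_root N i) xi)) \<and>
     (\<forall>xi. T (piW N) * Xlin N sc Xe Xc xi = Xlin N sc Xe Xc (act_t N (piW N) xi) * T (piW N)) \<and>
     (\<forall>F a. finite F \<and> F \<subseteq> {w. inW N w} \<times> Monos N \<and>
         (\<Sum>p\<in>F. sc (a p) * (T (fst p) * Xmono N Xe Xc (snd p))) = 0 \<longrightarrow> (\<forall>p\<in>F. a p = 0)) \<and>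
     (\<forall>h. \<exists>F a. finite F \<and> F \<subseteq> {w. inW N w} \<times> Monos N \<and>
         h = (\<Sum>p\<in>F. sc (a p) * (T (fst p) * Xmono N Xe Xc (snd p))))"

inductive_set subalg :: "(complex \<Rightarrow> 'h::ring_1) \<Rightarrow> 'h set \<Rightarrow> 'h set" for sc G where
  "sc a \<in> subalg sc G"
| "g \<in> G \<Longrightarrow> g \<in> subalg sc G"
| "x \<in> subalg sc G \<Longrightarrow> y \<in> subalg sc G \<Longrightarrow> x + y \<in> subalg sc G"
| "x \<in> subalg sc G \<Longrightarrow> y \<in> subalg sc G \<Longrightarrow> x * y \<in> subalg sc G"

definition Hbar :: "nat \<Rightarrow> (complex \<Rightarrow> 'h::ring_1) \<Rightarrow> (W \<Rightarrow> 'h) \<Rightarrow> (nat \<Rightarrow> 'h) \<Rightarrow> 'h \<Rightarrow> 'h set" where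
  "Hbar N sc T Xe Xc = subalg sc ({T w | w. inWbar N w} \<union> {Xlin N sc Xe Xc (a, 0) | a. True})"

inductive_set lideal :: "'h::ring_1 set \<Rightarrow> 'h set \<Rightarrow> 'h set" for A G where
  "0 \<in> lideal A G"
| "a \<in> A \<Longrightarrow> g \<in> G \<Longrightarrow> a * g \<in> lideal A G"
| "x \<in> lideal A G \<Longrightarrow> y \<in> lideal A G \<Longrightarrow> x + y \<in> lideal A G"

definition phi_s :: "nat \<Rightarrow> (complex \<Rightarrow> 'h::ring_1) \<Rightarrow> (W \<Rightarrow> 'h) \<Rightarrow> (nat \<Rightarrow> 'h) \<Rightarrow> 'h \<Rightarrow> nat \<Rightarrow> 'h" where
  "phi_s N sc T Xe Xc i = 1 + T (sW N i) * Xlin N sc Xe Xc (coroot (simple_root N i))"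

definition phi_w :: "nat \<Rightarrow> (complex \<Rightarrow> 'h::ring_1) \<Rightarrow> (W \<Rightarrow> 'h) \<Rightarrow> (nat \<Rightarrow> 'h) \<Rightarrow> 'h \<Rightarrow> W \<Rightarrow> 'h" where
  "phi_w N sc T Xe Xc w = (let e = (SOME e. reduced_expr N w e) in
     T (wpowi (piW N) (fst e)) * prod_list (map (phi_s N sc T Xe Xc) (snd e)))"

text \<open>Y_gamma(zeta) = H (x)_{H_gamma} C1_zeta  =  H / H.ker(chi_zeta); here the left ideal
  H.ker(chi_zeta) = lideal UNIV (generators of ker chi_zeta).\<close>
definition Jideal :: "nat \<Rightarrow> (complex \<Rightarrow> 'h::ring_1) \<Rightarrow> (W \<Rightarrow> 'h) \<Rightarrow> (nat \<Rightarrow> 'h) \<Rightarrow> 'h \<Rightarrow> nat list \<Rightarrow> tvec \<Rightarrow> 'h set" where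
  "Jideal N sc T Xe Xc g zeta = lideal UNIV
     ({T w - 1 | w. w \<in> Wbar_g N g} \<union> {Xlin N sc Xe Xc xi - sc (zeta_eval N zeta xi) | xi. True})"

text \<open>Ybar_gamma(zbar) = Hbar / Hbar.ker(chi_zbar), zbar in tbar^*\<close>
definition Jbar :: "nat \<Rightarrow> (complex \<Rightarrow> 'h::ring_1) \<Rightarrow> (W \<Rightarrow> 'h) \<Rightarrow> (nat \<Rightarrow> 'h) \<Rightarrow> 'h \<Rightarrow> nat list \<Rightarrow> (nat \<Rightarrow> complex) \<Rightarrow> 'h set" where
  "Jbar N sc T Xe Xc g zb = lideal (Hbar N sc T Xe Xc)
     ({T w - 1 | w. w \<in> Wbar_g N g} \<union>
      {Xlin N sc Xe Xc (a, 0) - sc (zeta_eval N (zb, 0) (a, 0)) | a. True})"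

text \<open>V/J (with J \<subseteq> V) is an irreducible A-module: nonzero, and every A-submodule
  U/J of V/J is 0 or V/J.\<close>
definition irred_quot :: "'h::ring_1 set \<Rightarrow> 'h set \<Rightarrow> 'h set \<Rightarrow> bool" where
  "irred_quot A J V \<longleftrightarrow> \<not> V \<subseteq> J \<and>
     (\<forall>U. J \<subseteq> U \<and> U \<subseteq> V \<and> (\<forall>u\<in>U. \<forall>v\<in>U. u + v \<in> U) \<and> (\<forall>a\<in>A. \<forall>u\<in>U. a * u \<in> U)
        \<longrightarrow> U = J \<or> U = V)"

end

theory Submission
  imports Defs
begin

text \<open>
  Modulo the left ideal J defining the standard module, phi_w 1 is a weight vector of weight w(zeta).
  Genericity and zeta(c) nonzero make the weights w(zeta), w in W, pairwise distinct, make every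
  pairing of w(zeta) with a root nonzero, and make it equal to 1 or -1 only for roots of the parabolic
  subsystem. Hence phi_i phi_i acts on phi_w 1 by a nonzero scalar whenever w and s_i w both lie in
  W^beta, and phi_w 1 is nonzero for w in W^beta, because 1 is not in J by the PBW theorem. A
  triangularity argument for the length filtration shows that the phi_w 1, w in W^beta, span; having
  distinct weights they form a basis, so all weight spaces have dimension at most one. This replaces
  the independence of phi_w from the reduced expression: phi_i phi_w 1 is a multiple of
  phi_{s_i w} 1, nonzero if s_i w is in W^beta and zero otherwise. The summands are therefore the
  connected components of W^beta under left multiplication by finite simple reflections, and each
  coset of the finite Weyl group containing elements of W^beta contains exactly one element of
  X^beta. Applying the triangularity argument to the finite algebra shows that the annihilator of
  phi_x 1 is no larger than the ideal defining the induced module.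
\<close>

text \<open>The module is never constructed: its elements are classes modulo J, so vanishing of a
  vector reads as membership in J, a submodule is a set containing J, and the isomorphism is an
  equality of annihilators. Submodules over the finite algebra are stable only under t-bar, so
  weights must already be separated by their restrictions to t-bar. If u(zeta) and v(zeta) agree in
  coordinate j, then zeta pairs to zero with the affine root formed from the preimages of j under u
  and v, which genericity forbids unless the preimages coincide; zeta(c) nonzero then compares the
  translation parts. The elements of X^beta are the tops of their cosets: no finite simple
  reflection lengthens them inside W^beta. Climbing to a top is reversible, since every step inside
  W^beta uses an intertwiner whose square is an invertible scalar on the vector at hand; one
  direction gives generation of the summands, the other irreducibility. Uniqueness of the top is a
  sorting argument: a top lists the coordinates by decreasing block number, then increasing
  position, and two tops in one coset must list them in the same order.\<close>

locale affine_sym =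
  fixes N :: nat
  assumes N2: "2 \<le> N"
begin

section \<open>Group laws of the extended affine Weyl group\<close>

lemma inW_bij: "inW N w \<Longrightarrow> bij (fst w)"
  by (auto simp: inW_def intro: permutes_bij)

lemma inW_fst_in: "inW N w \<Longrightarrow> fst w i \<in> {1..N} \<longleftrightarrow> i \<in> {1..N}"
  unfolding inW_def by (metis permutes_in_image)

lemma inW_fst_eq: "inW N w \<Longrightarrow> fst w i = fst w j \<longleftrightarrow> i = j"
  by (simp add: inj_eq bij_is_inj[OF inW_bij])

lemma inW_inv_f [simp]: "inW N w \<Longrightarrow> inv (fst w) (fst w i) = i"
  by (simp add: bij_is_inj[OF inW_bij])

lemma inW_f_inv [simp]: "inW N w \<Longrightarrow> fst w (inv (fst w) i) = i"
  by (simp add: surj_f_inv_f bij_is_surj[OF inW_bij])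

lemma inW_idW [simp]: "inW N idW"
  by (auto simp: inW_def idW_def permutes_id)

lemma inW_winv [simp]: "inW N w \<Longrightarrow> inW N (winv w)"
  using inW_fst_in[of w] unfolding inW_def winv_def
  by (simp add: permutes_inv del: atLeastAtMost_iff One_nat_def)

lemma inW_inv_in: "inW N w \<Longrightarrow> inv (fst w) i \<in> {1..N} \<longleftrightarrow> i \<in> {1..N}"
  using inW_fst_in[OF inW_winv] by (simp add: winv_def)

lemma inW_wmul [simp]: assumes "inW N u" "inW N v" shows "inW N (wmul u v)"
proof -
  have "snd u i + snd v (inv (fst u) i) = 0" if "i \<notin> {1..N}" for i
    using that assms inW_inv_in[OF assms(1), of i] unfolding inW_def by auto
  then show ?thesis
    using assms unfolding inW_def wmul_def by (auto intro: permutes_compose)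
qed

lemma inv_comp: "inW N u \<Longrightarrow> inW N v \<Longrightarrow> inv (fst u \<circ> fst v) = inv (fst v) \<circ> inv (fst u)"
  using o_inv_distrib inW_bij by blast

lemma wmul_assoc: "inW N u \<Longrightarrow> inW N v \<Longrightarrow> wmul (wmul u v) w = wmul u (wmul v w)"
  by (simp add: wmul_def inv_comp comp_assoc fun_eq_iff)

lemma wmul_idW_left [simp]: "wmul idW w = w"
  by (simp add: wmul_def idW_def)

lemma wmul_idW_right [simp]: "wmul w idW = w"
  by (simp add: wmul_def idW_def)

lemma wmul_winv_right [simp]: assumes "inW N w" shows "wmul w (winv w) = idW"
proof -
  have "fst w \<circ> inv (fst w) = id" using assms by (simp add: fun_eq_iff)
  then show ?thesis using assms by (simp add: wmul_def winv_def idW_def fun_eq_iff)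
qed

lemma wmul_winv_left [simp]: assumes "inW N w" shows "wmul (winv w) w = idW"
proof -
  have "inv (fst w) \<circ> fst w = id" using assms by (simp add: fun_eq_iff)
  moreover have "inv (inv (fst w)) = fst w" using inW_bij[OF assms] inv_inv_eq by blast
  ultimately show ?thesis by (simp add: wmul_def winv_def idW_def fun_eq_iff)
qed

lemma wmul_winv_cancel [simp]:
  assumes "inW N u" "inW N w"
  shows "wmul u (wmul (winv u) w) = w" "wmul (winv u) (wmul u w) = w"
  by (simp_all add: wmul_assoc[symmetric] assms)

lemma wmul_left_cancel: "inW N u \<Longrightarrow> inW N v \<Longrightarrow> inW N w \<Longrightarrow> wmul u v = wmul u w \<longleftrightarrow> v = w"
  by (metis wmul_winv_cancel(2))

lemma wmul_right_cancel: "inW N u \<Longrightarrow> inW N v \<Longrightarrow> inW N w \<Longrightarrow> wmul v u = wmul w u \<longleftrightarrow> v = w"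
  by (metis wmul_assoc wmul_winv_right wmul_idW_right)

lemma winv_unique: "inW N u \<Longrightarrow> inW N v \<Longrightarrow> wmul u v = idW \<Longrightarrow> v = winv u"
  by (metis inW_winv wmul_left_cancel wmul_winv_right)

lemma winv_wmul: "inW N u \<Longrightarrow> inW N v \<Longrightarrow> winv (wmul u v) = wmul (winv v) (winv u)"
  by (rule winv_unique[symmetric]) (simp_all add: wmul_assoc)

lemma winv_winv: "inW N u \<Longrightarrow> winv (winv u) = u"
  by (rule winv_unique[symmetric]) simp_all

lemma inWbar_inW [simp]: "inWbar N w \<Longrightarrow> inW N w"
  by (simp add: inWbar_def)

lemma inWbar_wmul [simp]: "inWbar N u \<Longrightarrow> inWbar N v \<Longrightarrow> inWbar N (wmul u v)"
  unfolding inWbar_def using inW_wmul[of u v] by (simp add: wmul_def)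

lemma inWbar_winv [simp]: "inWbar N u \<Longrightarrow> inWbar N (winv u)"
  unfolding inWbar_def using inW_winv[of u] by (simp add: winv_def)

lemma inWbar_idW [simp]: "inWbar N idW"
  by (simp add: inWbar_def) (simp add: idW_def)

lemma finite_Wbar: "finite {w. inWbar N w}"
proof -
  have "{w. inWbar N w} \<subseteq> {p. p permutes {1..N}} \<times> {\<lambda>_. 0}"
    by (auto simp: inWbar_def inW_def)
  then show ?thesis by (rule finite_subset) (simp add: finite_permutations)
qed

subsection \<open>The action on affine roots\<close>

definition negr :: "aroot \<Rightarrow> aroot" where
  "negr a = (case a of (i,j,k) \<Rightarrow> (j,i,-k))"

lemma negr_negr [simp]: "negr (negr a) = a"
  by (cases a) (simp add: negr_def)

lemma wroot_negr: "wroot w (negr a) = negr (wroot w a)"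
  by (cases a) (simp add: negr_def wroot_def)

lemma is_root_negr [simp]: "is_root N (negr a) \<longleftrightarrow> is_root N a"
  by (cases a) (auto simp: negr_def is_root_def)

lemma is_root_wroot [simp]: "inW N w \<Longrightarrow> is_root N (wroot w a) \<longleftrightarrow> is_root N a"
  by (cases a) (simp add: wroot_def is_root_def inW_fst_in inW_fst_eq del: atLeastAtMost_iff One_nat_def)

lemma wroot_wmul: "inW N u \<Longrightarrow> wroot (wmul u v) a = wroot u (wroot v a)"
  by (cases a) (simp add: wroot_def wmul_def)

lemma wroot_idW [simp]: "wroot idW a = a"
  by (cases a) (simp add: wroot_def idW_def)

lemma wroot_winv [simp]: "inW N w \<Longrightarrow> wroot w (wroot (winv w) a) = a"
   "inW N w \<Longrightarrow> wroot (winv w) (wroot w a) = a"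
  by (simp_all add: wroot_wmul[symmetric])

text \<open>The root (i,j,k) corresponds to the pair of integers (i, j + kN) up to a common shift by
  multiples of N, and is positive exactly when this pair is increasing.\<close>

lemma pos_root_iff: "pos_root N (i,j,k) \<longleftrightarrow> is_root N (i,j,k) \<and> int i < int j + int N * k"
proof -
  consider "k \<ge> 1" | "k = 0" | "k \<le> -1" by linarith
  then show ?thesis
  proof cases
    case 1
    then have "int N \<le> int N * k" using N2 by simp
    moreover define M where "M = int N * k"
    ultimately have "int N \<le> M" by simp
    with 1 show ?thesis by (auto simp: pos_root_def is_root_def M_def[symmetric])
  next
    case 3
    then have "int N * k \<le> int N * (-1)" by (intro mult_left_mono) auto
    then have "int N * k \<le> - int N" by simp
    with 3 show ?thesis by (auto simp: pos_root_def is_root_def)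
  qed (auto simp: pos_root_def is_root_def)
qed

lemma pos_is_root: "pos_root N a \<Longrightarrow> is_root N a"
  by (simp add: pos_root_def)

lemma pos_negr [simp]: "pos_root N (negr a) \<longleftrightarrow> neg_root N a"
  by (cases a) (auto simp: pos_root_def neg_root_def negr_def is_root_def)

lemma neg_negr [simp]: "neg_root N (negr a) \<longleftrightarrow> pos_root N a"
  using pos_negr[of "negr a"] by simp

text \<open>The value at \<open>i\<close> of \<open>w\<close> regarded as an affine permutation of
  the integers commuting with translation by \<open>N\<close>. The values on 1..N form its window,
  and signs of roots become inequalities between them.\<close>

definition aff :: "W \<Rightarrow> nat \<Rightarrow> int" where
  "aff w i = int (fst w i) + int N * snd w (fst w i)"

lemma pos_wroot: "inW N w \<Longrightarrow> is_root N (i,j,k) \<Longrightarrow>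
    pos_root N (wroot w (i,j,k)) \<longleftrightarrow> aff w i < aff w j + int N * k"
proof -
  assume a: "inW N w" "is_root N (i,j,k)"
  have "is_root N (wroot w (i,j,k))" using a by simp
  then show ?thesis by (simp add: wroot_def pos_root_iff aff_def algebra_simps)
qed

lemma aff_wmul: "inW N u \<Longrightarrow> aff (wmul u w) i = aff u (fst w i) + int N * snd w (fst w i)"
  by (simp add: aff_def wmul_def algebra_simps)

text \<open>The representative of \<open>aff w i\<close> in 1..N modulo \<open>N\<close> is
  \<open>fst w i\<close>, and the remaining multiple of \<open>N\<close> recovers the translation
  part.\<close>

lemma aff_inj:
  assumes "inW N u" "inW N v" "\<And>i. i \<in> {1..N} \<Longrightarrow> aff u i = aff v i"
  shows "u = v"
proof -
  have e: "fst u i = fst v i \<and> snd u (fst u i) = snd v (fst u i)" if i: "i \<in> {1..N}" for i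
  proof -
    let ?a = "fst u i" and ?b = "fst v i"
    have r: "?a \<in> {1..N}" "?b \<in> {1..N}" using inW_fst_in assms i by auto
    have eq: "int ?a - int ?b = int N * (snd v ?b - snd u ?a)"
      using assms(3)[OF i] by (simp add: aff_def algebra_simps)
    then have "int N dvd (int ?a - int ?b)" by simp
    moreover have "\<bar>int ?a - int ?b\<bar> < int N" using r by auto
    ultimately have "int ?a - int ?b = 0" using dvd_imp_le_int[of "int ?a - int ?b" "int N"] by force
    with eq N2 show ?thesis by auto
  qed
  have "fst u i = fst v i" for i
  proof (cases "i \<in> {1..N}")
    case False
    then have "fst u i = i" "fst v i = i" using assms permutes_not_in unfolding inW_def by fast+
    then show ?thesis by simp
  qed (use e in auto)
  moreover have "snd u i = snd v i" for i
  proof (cases "i \<in> {1..N}")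
    case True
    then have "inv (fst u) i \<in> {1..N}" using inW_inv_in assms by blast
    from e[OF this] show ?thesis using assms by simp
  qed (use assms in \<open>auto simp: inW_def\<close>)
  ultimately show ?thesis by (simp add: prod_eq_iff fun_eq_iff)
qed

subsection \<open>Simple reflections and the element pi\<close>

abbreviation al :: "nat \<Rightarrow> aroot" where "al \<equiv> simple_root N"
abbreviation s :: "nat \<Rightarrow> W" where "s \<equiv> sW N"

lemma is_root_al: "i < N \<Longrightarrow> is_root N (al i)"
  using N2 by (auto simp: simple_root_def is_root_def)

lemma pos_al: "i < N \<Longrightarrow> pos_root N (al i)"
  using N2 by (auto simp: simple_root_def is_root_def pos_root_def)

lemma inW_s [simp]: "i < N \<Longrightarrow> inW N (s i)"
  using N2 by (auto simp: sW_def s_alpha_def simple_root_def inW_def eps_def intro!: permutes_swap_id)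

lemma inWbar_s [simp]: "1 \<le> i \<Longrightarrow> i < N \<Longrightarrow> inWbar N (s i)"
  using inW_s[of i] by (auto simp: inWbar_def) (auto simp: sW_def s_alpha_def simple_root_def eps_def)

lemma s_s [simp]: "i < N \<Longrightarrow> wmul (s i) (s i) = idW"
  using N2 by (auto simp: sW_def s_alpha_def simple_root_def wmul_def idW_def eps_def fun_eq_iff transpose_def)

lemma s_s_cancel [simp]: "i < N \<Longrightarrow> inW N w \<Longrightarrow> wmul (s i) (wmul (s i) w) = w"
  by (simp add: wmul_assoc[symmetric])

lemma s_s_cancel_right [simp]: "i < N \<Longrightarrow> inW N w \<Longrightarrow> wmul (wmul w (s i)) (s i) = w"
  by (simp add: wmul_assoc)

lemma winv_s [simp]: "i < N \<Longrightarrow> winv (s i) = s i"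
  by (rule winv_unique[symmetric]) simp_all

lemma s_s_root [simp]: "i < N \<Longrightarrow> wroot (s i) (wroot (s i) a) = a"
  by (simp add: wroot_wmul[symmetric])

lemma s_al: "i < N \<Longrightarrow> wroot (s i) (al i) = negr (al i)"
  using N2 by (auto simp: sW_def s_alpha_def simple_root_def wroot_def negr_def eps_def)

lemma s_pos:
  assumes "i < N" "pos_root N a" "a \<noteq> al i"
  shows "pos_root N (wroot (s i) a)"
proof -
  obtain p q k where a: "a = (p,q,k)" by (cases a)
  have r: "p \<in> {1..N}" "q \<in> {1..N}" "p \<noteq> q" and
    pk: "(p < q \<and> 0 \<le> k) \<or> (q < p \<and> 0 < k)"
    using assms(2) by (auto simp: a pos_root_def is_root_def)
  have root: "is_root N (wroot (s i) a)" using assms pos_is_root by simp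
  show ?thesis
  proof (cases "i = 0")
    case True
    then show ?thesis using root r pk assms(3) N2
      unfolding a by (auto simp: sW_def s_alpha_def simple_root_def wroot_def eps_def pos_root_def transpose_def split: if_splits)
  next
    case False
    then show ?thesis using root r pk assms(3) N2
      unfolding a by (auto simp: sW_def s_alpha_def simple_root_def wroot_def eps_def pos_root_def transpose_def split: if_splits)
  qed
qed

lemma s_neg:
  assumes "i < N" "neg_root N a" "a \<noteq> negr (al i)"
  shows "neg_root N (wroot (s i) a)"
  using s_pos[of i "negr a"] assms negr_negr[of a] by (fastforce simp: wroot_negr)

section \<open>Inversion sets and length\<close>

lemma finite_Sset: assumes "inW N w" shows "finite (Sset N w)"
proof -
  define M where "M = (\<Sum>i\<in>{1..N}. \<bar>snd w i\<bar>)"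
  have M: "\<bar>snd w i\<bar> \<le> M" if "i \<in> {1..N}" for i
    unfolding M_def using that by (intro member_le_sum) auto
  have "Sset N w \<subseteq> {1..N} \<times> {1..N} \<times> {0..2*M}"
  proof
    fix a assume a: "a \<in> Sset N w"
    obtain i j k where ak: "a = (i,j,k)" by (cases a)
    have r: "i \<in> {1..N}" "j \<in> {1..N}" "0 \<le> k" using a by (auto simp: Sset_def ak pos_root_def is_root_def)
    have "k - (snd w (fst w i) - snd w (fst w j)) \<le> 0"
      using a by (auto simp: Sset_def ak neg_root_def pos_root_def is_root_def wroot_def)
    moreover have "\<bar>snd w (fst w i)\<bar> \<le> M" "\<bar>snd w (fst w j)\<bar> \<le> M"
      using M inW_fst_in assms r by auto
    ultimately show "a \<in> {1..N} \<times> {1..N} \<times> {0..2*M}" using r by (auto simp: ak)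
  qed
  then show ?thesis by (rule finite_subset) auto
qed

text \<open>Only the roots sent by \<open>w\<close> to plus or minus \<open>al i\<close> have their
  sign changed by a further \<open>s i\<close>. Hence the inversion set gains the preimage of
  \<open>al i\<close> and nothing else.\<close>

lemma len_s_up:
  assumes w: "inW N w" and i: "i < N" and p: "pos_root N (wroot (winv w) (al i))"
  shows "len N (wmul (s i) w) = Suc (len N w)"
proof -
  let ?b = "wroot (winv w) (al i)"
  have "Sset N (wmul (s i) w) = insert ?b (Sset N w)"
  proof (intro set_eqI)
    fix a
    show "a \<in> Sset N (wmul (s i) w) \<longleftrightarrow> a \<in> insert ?b (Sset N w)"
    proof (cases "pos_root N a")
      case True
      have root: "is_root N (wroot w a)" using True w pos_is_root by simp
      have mem: "a \<in> Sset N (wmul (s i) w) \<longleftrightarrow> neg_root N (wroot (s i) (wroot w a))"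
        using True i by (simp add: Sset_def wroot_wmul)
      consider "wroot w a = al i" | "wroot w a = negr (al i)"
        | "wroot w a \<noteq> al i" "wroot w a \<noteq> negr (al i)" by blast
      then show ?thesis
      proof cases
        case 1
        then have "a = ?b" using wroot_winv(2)[OF w, of a] by simp
        then show ?thesis using 1 mem i pos_al s_al by simp
      next
        case 2
        then have "a = negr ?b" using wroot_winv(2)[OF w, of a] by (simp add: wroot_negr)
        then show ?thesis using True p by (simp add: neg_root_def)
      next
        case 3
        then have "a \<noteq> ?b" using w by auto
        moreover have "neg_root N (wroot (s i) (wroot w a)) \<longleftrightarrow> neg_root N (wroot w a)"
          using 3 s_pos[OF i, of "wroot w a"] s_neg[OF i, of "wroot w a"] root neg_root_def by blast
        ultimately show ?thesis using mem True by (simp add: Sset_def)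
      qed
    qed (use p in \<open>auto simp: Sset_def\<close>)
  qed
  moreover have "?b \<notin> Sset N w" using w i pos_al by (simp add: Sset_def neg_root_def)
  ultimately show ?thesis unfolding len_def using finite_Sset[OF w] by simp
qed

lemma len_s_down:
  assumes w: "inW N w" and i: "i < N" and p: "neg_root N (wroot (winv w) (al i))"
  shows "len N w = Suc (len N (wmul (s i) w))"
proof -
  have "pos_root N (wroot (winv (wmul (s i) w)) (al i))"
    using w i p by (simp add: winv_wmul wroot_wmul s_al wroot_negr)
  from len_s_up[OF _ i this] show ?thesis using w i by simp
qed

lemma len_s_le: "inW N w \<Longrightarrow> i < N \<Longrightarrow> len N (wmul (s i) w) \<le> Suc (len N w)"
  using len_s_up[of w i] len_s_down[of w i] is_root_al[of i]
  by (cases "pos_root N (wroot (winv w) (al i))") (simp_all add: neg_root_def)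

lemma len_winv: assumes w: "inW N w" shows "len N (winv w) = len N w"
proof -
  have "bij_betw (\<lambda>a. negr (wroot w a)) (Sset N w) (Sset N (winv w))"
  proof (rule bij_betw_byWitness[where f' = "\<lambda>a. negr (wroot (winv w) a)"])
    show "\<forall>a\<in>Sset N w. negr (wroot (winv w) (negr (wroot w a))) = a"
      "\<forall>a\<in>Sset N (winv w). negr (wroot w (negr (wroot (winv w) a))) = a"
      using w by (auto simp: wroot_negr)
  qed (use w in \<open>auto simp: Sset_def wroot_negr\<close>)
  then show ?thesis unfolding len_def by (metis bij_betw_same_card)
qed

lemma len_s_down_right:
  assumes w: "inW N w" and i: "i < N" and p: "neg_root N (wroot w (al i))"
  shows "len N w = Suc (len N (wmul w (s i)))"
proof -
  have "len N (winv w) = Suc (len N (wmul (s i) (winv w)))"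
    using len_s_down[of "winv w" i] w i p by (simp add: winv_winv)
  also have "wmul (s i) (winv w) = winv (wmul w (s i))" using w i by (simp add: winv_wmul)
  finally show ?thesis using w i by (simp add: len_winv)
qed

section \<open>Words in the simple reflections, powers of pi, and reduced expressions\<close>

definition sword :: "nat list \<Rightarrow> W" where
  "sword js = foldr wmul (map s js) idW"

lemma sword_Nil [simp]: "sword [] = idW"
  by (simp add: sword_def)

lemma sword_Cons [simp]: "sword (i # js) = wmul (s i) (sword js)"
  by (simp add: sword_def)

lemma inW_sword [simp]: "set js \<subseteq> {..<N} \<Longrightarrow> inW N (sword js)"
  by (induction js) auto

lemma sword_snoc: "set js \<subseteq> {..<N} \<Longrightarrow> i < N \<Longrightarrow> sword (js @ [i]) = wmul (sword js) (s i)"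
  by (induction js) (auto simp: wmul_assoc)

lemma len_idW [simp]: "len N idW = 0"
  unfolding len_def Sset_def by (auto simp: neg_root_def card_eq_0_iff)

lemma len_sword_le: "set js \<subseteq> {..<N} \<Longrightarrow> len N (sword js) \<le> length js"
proof (induction js)
  case (Cons i js)
  then show ?case using len_s_le[of "sword js" i] by force
qed simp

text \<open>A letter raises the length by at most one, so a word whose length is attained must gain
  one at every letter.\<close>

lemma sword_reduced_Cons:
  assumes "set (i # js) \<subseteq> {..<N}" "len N (sword (i # js)) = length (i # js)"
  shows "len N (sword js) = length js" "neg_root N (wroot (winv (sword (i # js))) (al i))"
proof -
  have i: "i < N" and js: "set js \<subseteq> {..<N}" using assms by auto
  show l: "len N (sword js) = length js"
    using len_sword_le[OF js] len_s_le[of "sword js" i] assms(2) i js by simp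
  show "neg_root N (wroot (winv (sword (i # js))) (al i))"
  proof (rule ccontr)
    assume "\<not> ?thesis"
    then have "pos_root N (wroot (winv (sword (i # js))) (al i))"
      using i js is_root_al by (simp add: neg_root_def)
    from len_s_up[OF _ i this] show False using assms l i js by simp
  qed
qed

lemma sword_upt:
  "n \<le> N \<Longrightarrow> 1 \<le> n \<Longrightarrow> sword [1..<n] = ((\<lambda>j. if j = n then 1 else if 1 \<le> j \<and> j < n then Suc j else j), \<lambda>_. 0)"
proof (induction n)
  case (Suc n)
  show ?case
  proof (cases "n = 0")
    case True
    then show ?thesis by (auto simp: idW_def fun_eq_iff)
  next
    case False
    then have "sword [1..<Suc n] = wmul (sword [1..<n]) (s n)"
      using Suc.prems sword_snoc[of "[1..<n]" n] by (auto simp: subset_iff)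
    then show ?thesis using Suc False
      by (auto simp: wmul_def sW_def simple_root_def s_alpha_def fun_eq_iff transpose_def eps_def)
  qed
qed simp

lemma piW_eq: "piW N = ((\<lambda>j. if j = N then 1 else if 1 \<le> j \<and> j < N then Suc j else j), eps 1)"
proof -
  have "piW N = wmul (transl (eps 1)) (sword [1..<N])" by (simp add: piW_def sword_def)
  then show ?thesis using sword_upt[of N] N2 by (simp add: wmul_def transl_def)
qed

lemma inW_pi [simp]: "inW N (piW N)"
proof -
  have "inW N (transl (eps 1))" using N2 by (auto simp: transl_def inW_def eps_def permutes_id)
  moreover have "inW N (sword [1..<N])" by (rule inW_sword) auto
  ultimately show ?thesis unfolding piW_def using inW_wmul by (simp add: sword_def)
qed

text \<open>On the integers pi is the shift by one; the wrap-around from N to 1 is absorbed by the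
  translation \<open>eps 1\<close>. A shift preserves all inequalities between window entries, which
  is why powers of pi preserve positivity and length.\<close>

lemma aff_pi: "j \<in> {1..N} \<Longrightarrow> aff (piW N) j = int j + 1"
  using N2 by (auto simp: aff_def piW_eq eps_def)

lemma aff_pi_wmul: "inW N w \<Longrightarrow> i \<in> {1..N} \<Longrightarrow> aff (wmul (piW N) w) i = aff w i + 1"
  using aff_pi[of "fst w i"] inW_fst_in[of w i] aff_wmul[OF inW_pi, of w i] by (simp add: aff_def[of w])

lemma aff_piinv_wmul: assumes "inW N w" "i \<in> {1..N}" shows "aff (wmul (winv (piW N)) w) i = aff w i - 1"
  using aff_pi_wmul[of "wmul (winv (piW N)) w" i] assms by simp

lemma pipow: "inW N (wpowi (piW N) k) \<and> (\<forall>i\<in>{1..N}. aff (wpowi (piW N) k) i = int i + k)"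
proof -
  have a: "inW N ((wmul (piW N) ^^ n) idW) \<and> (\<forall>i\<in>{1..N}. aff ((wmul (piW N) ^^ n) idW) i = int i + int n)" for n
    by (induction n) (auto simp: aff_pi_wmul, simp add: aff_def idW_def)
  have b: "inW N ((wmul (winv (piW N)) ^^ n) idW) \<and> (\<forall>i\<in>{1..N}. aff ((wmul (winv (piW N)) ^^ n) idW) i = int i - int n)" for n
    by (induction n) (auto simp: aff_piinv_wmul, simp add: aff_def idW_def)
  show ?thesis using a[of "nat k"] b[of "nat (-k)"] by (auto simp: wpowi_def)
qed

lemma inW_pipow [simp]: "inW N (wpowi (piW N) k)"
  using pipow by blast

lemma pipow_zero [simp]: "wpowi (piW N) 0 = idW"
  by (simp add: wpowi_def)

lemma pos_pipow: "is_root N a \<Longrightarrow> pos_root N (wroot (wpowi (piW N) k) a) \<longleftrightarrow> pos_root N a"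
proof (cases a)
  case (fields p q l)
  assume "is_root N a"
  then show ?thesis using pipow[of k] unfolding fields
    by (subst pos_wroot) (auto simp: is_root_def pos_root_iff)
qed

lemma len_pipow_wmul: "inW N w \<Longrightarrow> len N (wmul (wpowi (piW N) k) w) = len N w"
  unfolding len_def Sset_def
  by (rule arg_cong[of _ _ card]) (auto simp: wroot_wmul neg_root_def pos_pipow dest: pos_is_root)

lemma word_eq: "word N k js = wmul (wpowi (piW N) k) (sword js)"
  by (simp add: word_def sword_def)

text \<open>The finite simple roots make the window strictly increasing, and \<open>al 0\<close>
  keeps its last entry below the first plus \<open>N\<close>. This leaves room only for steps equal
  to one, that is for a shift.\<close>

lemma simple_positive_imp_pipow:
  assumes w: "inW N w" and p: "\<And>i. i < N \<Longrightarrow> pos_root N (wroot w (al i))"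
  shows "w = wpowi (piW N) (aff w 1 - 1)" "len N w = 0"
proof -
  have st: "aff w i + 1 \<le> aff w (Suc i)" if "1 \<le> i" "i < N" for i
    using p[of i] that pos_wroot[OF w, of i "Suc i" 0] is_root_al[of i] by (simp add: simple_root_def)
  have cyc: "aff w N < aff w 1 + int N"
    using p[of 0] N2 pos_wroot[OF w, of N 1 1] is_root_al[of 0] by (simp add: simple_root_def)
  have lo: "Suc i \<le> N \<Longrightarrow> aff w (Suc i) \<ge> aff w 1 + int i" for i
  proof (induction i)
    case (Suc i)
    then show ?case using st[of "Suc i"] by simp
  qed simp
  have hi: "i < N \<Longrightarrow> aff w (N - i) \<le> aff w N - int i" for i
  proof (induction i)
    case (Suc i)
    then have "Suc (N - Suc i) = N - i" "1 \<le> N - Suc i" by simp_all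
    then show ?case using st[of "N - Suc i"] Suc by simp
  qed simp
  have eq: "aff w i = int i + (aff w 1 - 1)" if "i \<in> {1..N}" for i
  proof -
    from that have "1 \<le> i" "i \<le> N" by auto
    then show ?thesis using lo[of "i - 1"] hi[of "N - i"] cyc by simp
  qed
  show 1: "w = wpowi (piW N) (aff w 1 - 1)"
  proof (rule aff_inj[OF w inW_pipow])
    fix i assume "i \<in> {1..N}"
    with eq[OF this] pipow show "aff w i = aff (wpowi (piW N) (aff w 1 - 1)) i" by metis
  qed
  have "len N (wmul (wpowi (piW N) (aff w 1 - 1)) idW) = 0"
    by (subst len_pipow_wmul) simp_all
  then show "len N w = 0" using 1 by (metis wmul_idW_right)
qed

lemma reduced_exists: "inW N w \<Longrightarrow> \<exists>e. reduced_expr N w e"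
proof (induction "len N w" arbitrary: w)
  case 0
  have "pos_root N (wroot w (al i))" if "i < N" for i
    using 0 len_s_down_right[of w i] that is_root_al[of i] by (auto simp: neg_root_def)
  from simple_positive_imp_pipow[OF 0(2) this] have "reduced_expr N w (aff w 1 - 1, [])"
    by (simp add: reduced_expr_def word_eq)
  then show ?case by blast
next
  case (Suc n)
  obtain i where i: "i < N" "neg_root N (wroot w (al i))"
    using simple_positive_imp_pipow(2)[OF Suc(3)] Suc(2,3) is_root_al by (fastforce simp: neg_root_def)
  have l: "len N w = Suc (len N (wmul w (s i)))" using len_s_down_right Suc i by blast
  have inw: "inW N (wmul w (s i))" using Suc i by simp
  obtain e where e: "reduced_expr N (wmul w (s i)) e"
    using Suc(1)[of "wmul w (s i)"] l Suc(2,3) i by auto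
  have js: "set (snd e) \<subseteq> {..<N}" using e by (auto simp: reduced_expr_def)
  have "word N (fst e) (snd e @ [i]) = wmul (word N (fst e) (snd e)) (s i)"
    using js i by (simp add: word_eq sword_snoc wmul_assoc)
  also have "\<dots> = w" using e Suc(3) i by (simp add: reduced_expr_def)
  finally have "reduced_expr N w (fst e, snd e @ [i])"
    using e l i by (auto simp: reduced_expr_def)
  then show ?case by blast
qed

text \<open>\<open>reduced_exists\<close> gives no control over the letters. Here descents are
  sought among finite simple roots only, so the word avoids \<open>s 0\<close> and pi and its
  product of intertwiners stays in the finite algebra. A finite permutation without such descents is
  increasing, hence the identity.\<close>

lemma reduced_exists_bar: "inWbar N w \<Longrightarrow> \<exists>js. set js \<subseteq> {1..<N} \<and> reduced_expr N w (0, js)"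
proof (induction "len N w" arbitrary: w rule: less_induct)
  case less
  have w: "inW N w" using less by simp
  show ?case
  proof (cases "\<exists>i. 1 \<le> i \<and> i < N \<and> neg_root N (wroot w (al i))")
    case True
    then obtain i where i: "1 \<le> i" "i < N" "neg_root N (wroot w (al i))" by blast
    have l: "len N w = Suc (len N (wmul w (s i)))" using len_s_down_right w i by blast
    obtain js where js: "set js \<subseteq> {1..<N}" "reduced_expr N (wmul w (s i)) (0, js)"
      using less(1)[of "wmul w (s i)"] l less(2) i by auto
    have js': "set js \<subseteq> {..<N}" using js by auto
    have "sword (js @ [i]) = w"
      using js js' w i by (simp add: sword_snoc reduced_expr_def word_eq)
    then have "reduced_expr N w (0, js @ [i])"
      using js l i by (auto simp: reduced_expr_def word_eq)
    moreover have "set (js @ [i]) \<subseteq> {1..<N}" using js i by auto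
    ultimately show ?thesis by blast
  next
    case False
    then have p: "pos_root N (wroot w (al i))" if "1 \<le> i" "i < N" for i
      using that w is_root_al[of i] by (auto simp: neg_root_def)
    have s0: "snd w = (\<lambda>_. 0)" using less(2) by (simp add: inWbar_def)
    have st: "fst w i < fst w (Suc i)" if "1 \<le> i" "i < N" for i
      using p[of i] that pos_wroot[OF w, of i "Suc i" 0] is_root_al[of i]
      by (simp add: simple_root_def aff_def s0)
    have lo: "Suc i \<le> N \<Longrightarrow> fst w (Suc i) \<ge> Suc i" for i
    proof (induction i)
      case 0
      then show ?case using inW_fst_in[OF w, of "Suc 0"] by auto
    next
      case (Suc i)
      then show ?case using st[of "Suc i"] by simp
    qed
    have hi: "i < N \<Longrightarrow> fst w (N - i) \<le> N - i" for i
    proof (induction i)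
      case 0
      then show ?case using inW_fst_in[OF w, of N] by auto
    next
      case (Suc i)
      then have "Suc (N - Suc i) = N - i" "1 \<le> N - Suc i" by simp_all
      then show ?case using st[of "N - Suc i"] Suc by simp
    qed
    have "aff w i = aff idW i" if "i \<in> {1..N}" for i
    proof -
      have "1 \<le> i" "i \<le> N" using that by auto
      then have "fst w i = i" using lo[of "i - 1"] hi[of "N - i"] by simp
      then show ?thesis by (simp add: aff_def s0 idW_def)
    qed
    then have "w = idW" using aff_inj w by simp
    then have "reduced_expr N w (0, [])" by (simp add: reduced_expr_def word_eq)
    then show ?thesis by force
  qed
qed

end

subsection \<open>Ordered partitions\<close>

lemma same_block_Cons:
  "same_block (a # g) i j \<longleftrightarrow>
    (1 \<le> i \<and> i \<le> a \<and> 1 \<le> j \<and> j \<le> a) \<or> (a < i \<and> a < j \<and> same_block g (i - a) (j - a))"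
proof -
  have "same_block (a # g) i j \<longleftrightarrow> (in_block (a # g) 0 i \<and> in_block (a # g) 0 j)
      \<or> (\<exists>k < length g. in_block (a # g) (Suc k) i \<and> in_block (a # g) (Suc k) j)"
    unfolding same_block_def by (auto simp: less_Suc_eq_0_disj)
  moreover have "in_block (a # g) 0 l \<longleftrightarrow> 1 \<le> l \<and> l \<le> a" for l
    by (auto simp: in_block_def)
  moreover have "in_block (a # g) (Suc k) l \<longleftrightarrow> a < l \<and> in_block g k (l - a)" for k l
    by (auto simp: in_block_def)
  ultimately show ?thesis by (auto simp: same_block_def)
qed

text \<open>The interior partial sums, that is the cuts between consecutive blocks. The total is
  left out, so a composition of \<open>N\<close> is encoded by a subset of 1..N-1.\<close>

fun psums :: "nat list \<Rightarrow> nat set" where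
  "psums [] = {}"
| "psums [a] = {}"
| "psums (a # b # g) = insert a ((+) a ` psums (b # g))"

lemma same_block_iff_psums:
  "1 \<le> i \<Longrightarrow> i < j \<Longrightarrow> j \<le> sum_list g \<Longrightarrow>
    same_block g i j \<longleftrightarrow> (\<forall>l. i \<le> l \<and> l < j \<longrightarrow> l \<notin> psums g)"
proof (induction g arbitrary: i j rule: psums.induct)
  case (3 a b g)
  consider "j \<le> a" | "i \<le> a" "a < j" | "a < i" by linarith
  then show ?case
  proof cases
    case 3
    have "same_block (a # b # g) i j \<longleftrightarrow> same_block (b # g) (i - a) (j - a)"
      using 3 "3.prems" by (subst same_block_Cons) auto
    also have "\<dots> \<longleftrightarrow> (\<forall>l. i - a \<le> l \<and> l < j - a \<longrightarrow> l \<notin> psums (b # g))"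
      using 3 "3.prems" by (intro "3.IH") auto
    also have "\<dots> \<longleftrightarrow> (\<forall>l. i \<le> l \<and> l < j \<longrightarrow> l \<notin> psums (a # b # g))"
    proof safe
      fix l assume h: "\<forall>l. i - a \<le> l \<and> l < j - a \<longrightarrow> l \<notin> psums (b # g)" "i \<le> l" "l < j" "l \<in> psums (a # b # g)"
      then obtain d where "d \<in> psums (b # g)" "l = a + d" using 3 by auto
      with h(2,3) 3 have "i - a \<le> d \<and> d < j - a" by auto
      with h(1) \<open>d \<in> _\<close> show False by blast
    next
      fix l assume h: "\<forall>l. i \<le> l \<and> l < j \<longrightarrow> l \<notin> psums (a # b # g)" "i - a \<le> l" "l < j - a" "l \<in> psums (b # g)"
      then have "a + l \<in> psums (a # b # g)" by auto
      moreover from h(2,3) 3 have "i \<le> a + l \<and> a + l < j" by auto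
      ultimately show False using h(1) by blast
    qed
    finally show ?thesis .
  qed (use "3.prems" in \<open>auto simp: same_block_Cons[of a]\<close>)
qed (auto simp: same_block_Cons)

lemma Pi_g_eq_psums: "is_opart N g \<Longrightarrow> Pi_g N g = {1..<N} - psums g"
proof -
  assume "is_opart N g"
  then have "same_block g i (Suc i) \<longleftrightarrow> i \<notin> psums g" if "1 \<le> i" "i < N" for i
    using same_block_iff_psums[of i "Suc i" g] that by (auto simp: is_opart_def less_Suc_eq_le)
  then show ?thesis by (auto simp: Pi_g_def)
qed

lemma psums_subset: "\<forall>x\<in>set g. 0 < x \<Longrightarrow> psums g \<subseteq> {1..<sum_list g}"
  by (induction g rule: psums.induct) fastforce+

text \<open>The index 1 is peeled off: if it is a cut, a part 1 is prepended to the composition of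
  the shifted set; otherwise the first part grows by one.\<close>

lemma psums_exists: "1 \<le> N \<Longrightarrow> D \<subseteq> {1..<N} \<Longrightarrow> \<exists>g. is_opart N g \<and> psums g = D"
proof (induction N arbitrary: D)
  case (Suc N)
  show ?case
  proof (cases "N = 0")
    case True
    then have "is_opart (Suc N) [1] \<and> psums [1] = D" using Suc by (auto simp: is_opart_def)
    then show ?thesis by blast
  next
    case False
    define D' where "D' = {d. 1 \<le> d \<and> Suc d \<in> D}"
    have "D' \<subseteq> {1..<N}" using Suc.prems by (auto simp: D'_def)
    then obtain g where g: "is_opart N g" "psums g = D'" using Suc.IH[of D'] False by auto
    obtain b t where bt: "g = b # t" using g(1) False by (cases g) (auto simp: is_opart_def)
    have im: "(+) 1 ` D' = D - {1}"
    proof (intro equalityI subsetI)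
      fix d assume d: "d \<in> D - {1}"
      then have "1 \<le> d" "d \<noteq> 1" using Suc.prems by auto
      then have "2 \<le> d" by linarith
      then have "d - 1 \<in> D'" "d = 1 + (d - 1)" using d by (auto simp: D'_def)
      then show "d \<in> (+) 1 ` D'" by blast
    qed (auto simp: D'_def)
    show ?thesis
    proof (cases "1 \<in> D")
      case True
      then have "psums (1 # g) = D" using g im by (simp add: bt) blast
      moreover have "is_opart (Suc N) (1 # g)" using g by (simp add: is_opart_def)
      ultimately show ?thesis by blast
    next
      case F: False
      have "psums (Suc b # t) = (+) 1 ` psums (b # t)"
        by (cases t) (auto simp: image_image)
      then have "psums (Suc b # t) = D" using g im F by (simp add: bt)
      moreover have "is_opart (Suc N) (Suc b # t)" using g by (simp add: is_opart_def bt)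
      ultimately show ?thesis by blast
    qed
  qed
qed simp

lemma psums_unique: "is_opart N g \<Longrightarrow> is_opart N g' \<Longrightarrow> psums g = psums g' \<Longrightarrow> g = g'"
proof (induction g arbitrary: N g' rule: psums.induct)
  case 1
  then show ?case by (cases g') (auto simp: is_opart_def)
next
  case (2 a)
  then show ?case by (cases g' rule: psums.cases) (auto simp: is_opart_def)
next
  case (3 a b t)
  obtain a' b' t' where g': "g' = a' # b' # t'"
    using 3(2-4) by (cases g' rule: psums.cases) (auto simp: is_opart_def)
  have sub: "psums (b # t) \<subseteq> {1..}" "psums (b' # t') \<subseteq> {1..}"
    using psums_subset[of "b # t"] psums_subset[of "b' # t'"] 3(2,3) by (auto simp: is_opart_def g')
  have eq: "insert a ((+) a ` psums (b # t)) = insert a' ((+) a' ` psums (b' # t'))"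
    using 3(4) by (simp add: g')
  \<comment> \<open>The first part is the least element of the set of cuts, so mutual membership
    forces the first parts to agree.\<close>
  have "a \<in> insert a' ((+) a' ` psums (b' # t'))" "a' \<in> insert a ((+) a ` psums (b # t))"
    using eq by auto
  then have "a \<ge> a'" "a' \<ge> a" by auto
  then have aa: "a' = a" by simp
  have "a \<notin> (+) a ` psums (b # t)" "a \<notin> (+) a ` psums (b' # t')" using sub by auto
  then have "(+) a ` psums (b # t) = (+) a ` psums (b' # t')"
    using eq unfolding aa by (simp add: insert_ident)
  then have "psums (b # t) = psums (b' # t')" by (simp add: inj_image_eq_iff)
  moreover have "is_opart (N - a) (b # t)" "is_opart (N - a) (b' # t')"
    using 3(2,3) by (auto simp: is_opart_def g' aa)
  ultimately have "b # t = b' # t'" using 3(1) by blast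
  then show ?case by (simp add: g' aa)
qed

lemma strict_chain:
  fixes f :: "nat \<Rightarrow> int"
  assumes "\<And>l. p \<le> l \<Longrightarrow> l < q \<Longrightarrow> f l < f (Suc l)" "p < q"
  shows "f p < f q"
proof -
  have "p + Suc d \<le> q \<Longrightarrow> f p < f (p + Suc d)" for d
  proof (induction d)
    case (Suc d)
    then show ?case using assms(1)[of "p + Suc d"] by fastforce
  qed (use assms in auto)
  from this[of "q - p - 1"] show ?thesis using assms(2) by simp
qed

context affine_sym
begin

section \<open>Blocks of a composition and their root subsystems\<close>

lemma beta_of_props:
  fixes b w
  defines "D \<equiv> {i. 1 \<le> i \<and> i < N \<and> (\<exists>a \<in> Rbar_g_pos N b. wroot w a = (i, Suc i, 0))}"
  shows "is_opart N (beta_of N b w)" "Pi_g N (beta_of N b w) = D"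
proof -
  \<comment> \<open>The definite description in \<open>beta_of\<close> is meaningful because
    compositions of \<open>N\<close> correspond bijectively to their sets of cuts.\<close>
  have ex: "\<exists>!g. is_opart N g \<and> Pi_g N g = D"
  proof (rule ex_ex1I)
    obtain g where g: "is_opart N g" "psums g = {1..<N} - D"
      using psums_exists[of N "{1..<N} - D"] N2 by auto
    have "D \<subseteq> {1..<N}" by (auto simp: D_def)
    then show "\<exists>g. is_opart N g \<and> Pi_g N g = D" using g Pi_g_eq_psums[OF g(1)] by blast
  next
    fix g g' assume h: "is_opart N g \<and> Pi_g N g = D" "is_opart N g' \<and> Pi_g N g' = D"
    have "psums f = {1..<N} - Pi_g N f" if "is_opart N f" for f
      using Pi_g_eq_psums[OF that] psums_subset[of f] that by (auto simp: is_opart_def)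
    then have "psums g = psums g'" using h by simp
    then show "g = g'" using h psums_unique by blast
  qed
  show "is_opart N (beta_of N b w)" "Pi_g N (beta_of N b w) = D"
    using theI'[OF ex] unfolding beta_of_def D_def by auto
qed

text \<open>The number of cuts before \<open>i\<close>, hence the block number counted from zero. A
  monotone function of the index is easier to compare and to extend periodically than the relation
  \<open>same_block\<close>.\<close>

definition blk :: "nat list \<Rightarrow> nat \<Rightarrow> nat" where
  "blk g i = card {l \<in> {1..<i}. l \<notin> Pi_g N g}"

lemma blk_mono: "i \<le> j \<Longrightarrow> blk g i \<le> blk g j"
  unfolding blk_def by (rule card_mono) auto

lemma blk_less: assumes "1 \<le> i" "i \<le> N" shows "blk g i < N"
proof -
  have "blk g i \<le> card {1..<i}" unfolding blk_def by (rule card_mono) auto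
  then show ?thesis using assms by simp
qed

lemma blk_eq_iff: assumes "1 \<le> i" "i < j"
  shows "blk g i = blk g j \<longleftrightarrow> (\<forall>l. i \<le> l \<and> l < j \<longrightarrow> l \<in> Pi_g N g)"
proof
  assume "blk g i = blk g j"
  then have "{l \<in> {1..<i}. l \<notin> Pi_g N g} = {l \<in> {1..<j}. l \<notin> Pi_g N g}"
    unfolding blk_def using assms by (intro card_subset_eq) auto
  then have sub: "l \<in> {1..<j} \<Longrightarrow> l \<notin> Pi_g N g \<Longrightarrow> l \<in> {1..<i}" for l by blast
  show "\<forall>l. i \<le> l \<and> l < j \<longrightarrow> l \<in> Pi_g N g"
  proof (intro allI impI)
    fix l assume "i \<le> l \<and> l < j"
    then show "l \<in> Pi_g N g" using sub[of l] assms by auto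
  qed
next
  assume "\<forall>l. i \<le> l \<and> l < j \<longrightarrow> l \<in> Pi_g N g"
  then have "{l \<in> {1..<i}. l \<notin> Pi_g N g} = {l \<in> {1..<j}. l \<notin> Pi_g N g}"
    using assms by (auto simp: not_less)
  then show "blk g i = blk g j" by (simp add: blk_def)
qed

lemma Rbar_iff:
  assumes "is_opart N g"
  shows "(p,q,k) \<in> Rbar_g_pos N g \<longleftrightarrow> k = 0 \<and> 1 \<le> p \<and> p < q \<and> q \<le> N \<and> blk g p = blk g q"
proof -
  have "same_block g p q \<longleftrightarrow> blk g p = blk g q" if "1 \<le> p" "p < q" "q \<le> N"
  proof -
    have "same_block g p q \<longleftrightarrow> (\<forall>l. p \<le> l \<and> l < q \<longrightarrow> l \<notin> psums g)"
      using that assms by (intro same_block_iff_psums) (auto simp: is_opart_def)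
    also have "\<dots> \<longleftrightarrow> (\<forall>l. p \<le> l \<and> l < q \<longrightarrow> l \<in> Pi_g N g)"
      using that by (auto simp: Pi_g_eq_psums[OF assms])
    also have "\<dots> \<longleftrightarrow> blk g p = blk g q" using blk_eq_iff that by simp
    finally show ?thesis .
  qed
  then show ?thesis by (auto simp: Rbar_g_pos_def)
qed

lemma Pi_g_range: "j \<in> Pi_g N g \<Longrightarrow> 1 \<le> j \<and> j < N"
  by (simp add: Pi_g_def)

lemma al_pos: "1 \<le> i \<Longrightarrow> al i = (i, Suc i, 0)"
  by (simp add: simple_root_def)

lemma Rbar_al: assumes "is_opart N g" "j \<in> Pi_g N g" shows "al j \<in> Rbar_g_pos N g"
proof -
  have "blk g j = blk g (Suc j)"
    using assms Pi_g_range[OF assms(2)] blk_eq_iff[of j "Suc j" g] by (auto simp: less_Suc_eq)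
  then show ?thesis using Pi_g_range[OF assms(2)] by (simp add: al_pos Rbar_iff[OF assms(1)])
qed

lemma Rbar_pos: "is_opart N g \<Longrightarrow> a \<in> Rbar_g_pos N g \<Longrightarrow> pos_root N a"
  by (cases a) (auto simp: Rbar_iff pos_root_def is_root_def)

section \<open>Minimal coset representatives in terms of positive roots\<close>

definition Wpos :: "nat list \<Rightarrow> W set" where
  "Wpos g = {w. inW N w \<and> (\<forall>a\<in>Rbar_g_pos N g. pos_root N (wroot w a))}"

lemma Wpos_inW [simp]: "w \<in> Wpos g \<Longrightarrow> inW N w"
  unfolding Wpos_def by blast

lemma WposI: "inW N w \<Longrightarrow> (\<And>a. a \<in> Rbar_g_pos N g \<Longrightarrow> pos_root N (wroot w a)) \<Longrightarrow> w \<in> Wpos g"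
  unfolding Wpos_def by blast

lemma WposD: "w \<in> Wpos g \<Longrightarrow> a \<in> Rbar_g_pos N g \<Longrightarrow> pos_root N (wroot w a)"
  unfolding Wpos_def by blast

text \<open>If all simple roots between \<open>p\<close> and \<open>q\<close> stayed positive, the
  window would increase strictly from \<open>p\<close> to \<open>q\<close>.\<close>

lemma not_pos_finite:
  assumes w: "inW N w" and pq: "1 \<le> p" "p < q" "q \<le> N" "\<not> pos_root N (wroot w (p,q,0))"
  shows "\<exists>l. p \<le> l \<and> l < q \<and> neg_root N (wroot w (al l))"
proof (rule ccontr)
  assume h: "\<not> ?thesis"
  have "aff w l < aff w (Suc l)" if "p \<le> l" "l < q" for l
  proof -
    have "is_root N (al l)" using that pq by (intro is_root_al) simp
    moreover from this have "pos_root N (wroot w (al l))" using h that w by (auto simp: neg_root_def)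
    ultimately show ?thesis using pos_wroot[OF w, of l "Suc l" 0] that pq by (simp add: al_pos)
  qed
  then have "aff w p < aff w q" using strict_chain pq by blast
  then show False using pq pos_wroot[OF w, of p q 0] by (simp add: is_root_def)
qed

lemma not_Wpos:
  assumes g: "is_opart N g" and w: "inW N w" "w \<notin> Wpos g"
  shows "\<exists>j\<in>Pi_g N g. neg_root N (wroot w (al j))"
proof -
  obtain b where b: "b \<in> Rbar_g_pos N g" "\<not> pos_root N (wroot w b)" using w WposI by blast
  obtain p q k where "b = (p,q,k)" by (cases b)
  with b have a: "(p,q,k) \<in> Rbar_g_pos N g" "\<not> pos_root N (wroot w (p,q,k))" by simp_all
  then have pq: "k = 0" "1 \<le> p" "p < q" "q \<le> N" "blk g p = blk g q" by (auto simp: Rbar_iff[OF g])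
  then show ?thesis using not_pos_finite[OF w(1), of p q] a blk_eq_iff[of p q g] by auto
qed

lemma s_finite_root: "1 \<le> i \<Longrightarrow> wroot (s i) (p,q,k) = (transpose i (Suc i) p, transpose i (Suc i) q, k)"
  by (simp add: wroot_def sW_def s_alpha_def simple_root_def)

text \<open>The indices \<open>i\<close> and \<open>i + 1\<close> share a block, so the
  transposition preserves block numbers and cannot bring an outside root into the parabolic
  subsystem.\<close>

lemma s_outside:
  assumes g: "is_opart N g" and i: "i \<in> Pi_g N g" and a: "pos_root N a" "a \<notin> Rbar_g_pos N g"
  shows "pos_root N (wroot (s i) a)" "wroot (s i) a \<notin> Rbar_g_pos N g"
proof -
  have iN: "1 \<le> i" "i < N" using Pi_g_range[OF i] by auto
  have "a \<noteq> al i" using a Rbar_al[OF g i] by auto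
  then show p: "pos_root N (wroot (s i) a)" using s_pos a iN by blast
  obtain p q k where apq: "a = (p,q,k)" by (cases a)
  have bb: "blk g (transpose i (Suc i) l) = blk g l" for l
    using Rbar_al[OF g i] iN by (auto simp: transpose_def al_pos Rbar_iff[OF g])
  show "wroot (s i) a \<notin> Rbar_g_pos N g"
  proof
    assume "wroot (s i) a \<in> Rbar_g_pos N g"
    then have "k = 0" "blk g p = blk g q" by (auto simp: apq s_finite_root[OF iN(1)] Rbar_iff[OF g] bb)
    moreover have "1 \<le> p" "q \<le> N" "p < q" using a(1) \<open>k = 0\<close> by (auto simp: apq pos_root_def is_root_def)
    ultimately show False using a(2) by (simp add: apq Rbar_iff[OF g])
  qed
qed

lemma Wbar_g_inWbar: "u \<in> Wbar_g N g \<Longrightarrow> inWbar N u"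
  by (induction rule: Wbar_g.induct) (auto dest: Pi_g_range)

lemma Wbar_g_outside:
  assumes g: "is_opart N g" and u: "u \<in> Wbar_g N g"
  shows "pos_root N a \<and> a \<notin> Rbar_g_pos N g \<Longrightarrow>
    pos_root N (wroot (winv u) a) \<and> wroot (winv u) a \<notin> Rbar_g_pos N g"
  using u
proof (induction arbitrary: a rule: Wbar_g.induct)
  case 1
  have "winv idW = idW" using winv_unique[of idW idW] by simp
  with 1 show ?case by simp
next
  case (2 i w)
  have "1 \<le> i" "i < N" "inW N w" using Pi_g_range[OF 2(1)] Wbar_g_inWbar[OF 2(2)] by auto
  then have "wroot (winv (wmul (s i) w)) a = wroot (winv w) (wroot (s i) a)"
    by (simp add: winv_wmul wroot_wmul)
  then show ?case using 2 s_outside[OF g 2(1)] by simp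
qed

text \<open>A simple parabolic root with negative image yields a shorter element of the coset.
  Conversely, inversions of \<open>w\<close> in \<open>Wpos g\<close> lie outside the parabolic
  subsystem, and \<open>winv u\<close> carries them injectively to inversions of
  \<open>wmul w u\<close>.\<close>

lemma Wmin_eq: assumes g: "is_opart N g" shows "Wmin N g = Wpos g"
proof (intro equalityI subsetI)
  fix w assume w: "w \<in> Wmin N g"
  then have inw: "inW N w" by (simp add: Wmin_def)
  show "w \<in> Wpos g"
  proof (rule ccontr)
    assume "w \<notin> Wpos g"
    then obtain j where j: "j \<in> Pi_g N g" "neg_root N (wroot w (al j))" using not_Wpos[OF g inw] by blast
    have "len N w = Suc (len N (wmul w (s j)))"
      using len_s_down_right[OF inw _ j(2)] Pi_g_range[OF j(1)] by simp
    moreover have "s j \<in> Wbar_g N g" using Wbar_g.intros(2)[OF j(1) Wbar_g.intros(1)] by simp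
    ultimately show False using w by (auto simp: Wmin_def)
  qed
next
  fix w assume w: "w \<in> Wpos g"
  have "len N w \<le> len N (wmul w u)" if u: "u \<in> Wbar_g N g" for u
  proof -
    have iu: "inW N u" using Wbar_g_inWbar[OF u] by simp
    have "wroot (winv u) ` Sset N w \<subseteq> Sset N (wmul w u)"
    proof
      fix b assume "b \<in> wroot (winv u) ` Sset N w"
      then obtain a where a: "a \<in> Sset N w" "b = wroot (winv u) a" by blast
      then have "pos_root N a" "neg_root N (wroot w a)" by (simp_all add: Sset_def)
      moreover from this have "a \<notin> Rbar_g_pos N g" using w unfolding Wpos_def neg_root_def by blast
      ultimately show "b \<in> Sset N (wmul w u)" using Wbar_g_outside[OF g u, of a] a w iu
        by (simp add: Sset_def wroot_wmul)
    qed
    moreover have "inj_on (wroot (winv u)) (Sset N w)"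
      by (rule inj_on_inverseI[of _ "wroot u"]) (simp add: iu)
    ultimately show ?thesis unfolding len_def
      using card_inj_on_le finite_Sset[of "wmul w u"] w iu by simp
  qed
  then show "w \<in> Wmin N g" using w by (simp add: Wmin_def)
qed

lemma eta_w_props:
  fixes b w
  defines "C \<equiv> \<lambda>i. (\<exists>a. pos_root N a \<and> (\<exists>i' j'. a = (i', j', 0)) \<and> a \<notin> Rbar_g_pos N b
                 \<and> wroot w a = (i, Suc i, 0))"
  shows "inP N (eta_w N b w)"
    "\<And>i. 1 \<le> i \<Longrightarrow> i < N \<Longrightarrow> eta_w N b w i - eta_w N b w (Suc i) = (if C i then -1 else 0)"
proof -
  let ?P = "\<lambda>eta. inP N eta \<and> eta 1 = 0 \<and> (\<forall>i. 1 \<le> i \<and> i < N \<longrightarrow> eta i - eta (Suc i) = (if C i then -1 else (0::int)))"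
  have "\<exists>!eta. ?P eta"
  proof (rule ex_ex1I)
    \<comment> \<open>Counting the indices below \<open>i\<close> that satisfy \<open>C\<close>
      gives value 0 at index 1 and the prescribed consecutive differences.\<close>
    let ?e = "\<lambda>i. if i \<in> {1..N} then (\<Sum>j\<in>{1..<i}. if C j then 1 else (0::int)) else 0"
    have "?P ?e" using N2 by (auto simp: inP_def)
    then show "\<exists>eta. ?P eta" by blast
  next
    fix e e' assume h: "?P e" "?P e'"
    have "e (Suc i) = e' (Suc i)" if "Suc i \<le> N" for i
      using that
    proof (induction i)
      case (Suc i)
      have "e (Suc i) - e (Suc (Suc i)) = e' (Suc i) - e' (Suc (Suc i))" using h Suc.prems by simp
      then show ?case using Suc by simp
    qed (use h in auto)
    then have "e i = e' i" if "i \<in> {1..N}" for i using that by (cases i) auto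
    moreover have "e i = e' i" if "i \<notin> {1..N}" for i using that h unfolding inP_def by metis
    ultimately show "e = e'" by blast
  qed
  from theI'[OF this] have "?P (eta_w N b w)" unfolding eta_w_def C_def by simp
  then show "inP N (eta_w N b w)"
    "\<And>i. 1 \<le> i \<Longrightarrow> i < N \<Longrightarrow> eta_w N b w i - eta_w N b w (Suc i) = (if C i then -1 else 0)" by auto
qed

text \<open>\<open>s i\<close> makes no positive root negative except \<open>al i\<close>, so
  leaving the set is possible only through a parabolic root sent to \<open>al i\<close>.\<close>

lemma Wpos_reflect:
  assumes "y \<in> Wpos g" "i < N" "wmul (s i) y \<notin> Wpos g"
  shows "\<exists>a\<in>Rbar_g_pos N g. wroot y a = al i"
proof -
  have "inW N (wmul (s i) y)" using assms by simp
  then obtain a where a: "a \<in> Rbar_g_pos N g" "\<not> pos_root N (wroot (wmul (s i) y) a)"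
    using assms(3) unfolding Wpos_def by blast
  have "pos_root N (wroot y a)" using a(1) assms(1) unfolding Wpos_def by blast
  then have "wroot y a = al i" using a(2) s_pos[OF assms(2), of "wroot y a"] assms(1,2) by (auto simp: wroot_wmul)
  with a show ?thesis by blast
qed

lemma Wpos_reflect_conv:
  assumes "a \<in> Rbar_g_pos N g" "wroot y a = al i" "y \<in> Wpos g" "i < N"
  shows "wmul (s i) y \<notin> Wpos g"
proof
  assume "wmul (s i) y \<in> Wpos g"
  then have "pos_root N (wroot (s i) (al i))"
    using assms unfolding Wpos_def by (metis (no_types, lifting) inW_s mem_Collect_eq wroot_wmul)
  then show False using s_al[OF assms(4)] pos_al[OF assms(4)] by (simp add: neg_root_def)
qed

text \<open>This lets a reduced word of \<open>u\<close> be followed from \<open>x\<close> to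
  \<open>wmul u x\<close> without leaving W^beta: an exit would make \<open>x\<close> send a
  positive parabolic root to the negative root \<open>wroot (winv u) (al i)\<close>.\<close>

lemma Wpos_shorten:
  assumes x: "x \<in> Wpos g" and u: "inW N u" "wmul u x \<in> Wpos g"
    and i: "i < N" "neg_root N (wroot (winv u) (al i))"
  shows "wmul (s i) (wmul u x) \<in> Wpos g"
proof (rule ccontr)
  assume "\<not> ?thesis"
  then obtain a where a: "a \<in> Rbar_g_pos N g" "wroot (wmul u x) a = al i"
    using Wpos_reflect[OF u(2) i(1)] by blast
  then have "wroot x a = wroot (winv u) (al i)" using u(1) by (metis wroot_wmul wroot_winv(2))
  moreover have "pos_root N (wroot x a)" using x a unfolding Wpos_def by blast
  ultimately show False using i(2) by (simp add: neg_root_def)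
qed

text \<open>A non-simple parabolic root splits into two parabolic roots, both with positive images.
  The window would then have a value strictly between two consecutive integers.\<close>

lemma Wpos_root_simple:
  assumes g: "is_opart N g" and x: "x \<in> Wpos g" and a: "a \<in> Rbar_g_pos N g"
    and i: "wroot x a = al i" "1 \<le> i" "i < N"
  shows "\<exists>j\<in>Pi_g N g. a = al j"
proof -
  obtain p q k where apq: "a = (p,q,k)" by (cases a)
  have pq: "k = 0" "1 \<le> p" "p < q" "q \<le> N" "blk g p = blk g q"
    using a by (auto simp: apq Rbar_iff[OF g])
  have "q = Suc p"
  proof (rule ccontr)
    assume ne: "q \<noteq> Suc p"
    have "blk g (Suc p) = blk g p"
      using blk_mono[of p "Suc p" g] blk_mono[of "Suc p" q g] pq by simp
    then have "(p, Suc p, 0) \<in> Rbar_g_pos N g" "(Suc p, q, 0) \<in> Rbar_g_pos N g"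
      using pq ne by (simp_all add: Rbar_iff[OF g])
    then have "pos_root N (wroot x (p, Suc p, 0))" "pos_root N (wroot x (Suc p, q, 0))"
      using x unfolding Wpos_def by blast+
    then have "aff x p < aff x (Suc p)" "aff x (Suc p) < aff x q"
      using pos_wroot[of x] x pq ne by (simp_all add: is_root_def)
    moreover have "aff x q = aff x p + 1"
      using i(1) by (auto simp: apq pq al_pos[OF i(2)] wroot_def aff_def)
    ultimately show False by simp
  qed
  then have "a = al p" "p \<in> Pi_g N g" using pq blk_eq_iff[of p q g] by (auto simp: apq al_pos)
  then show ?thesis by blast
qed

subsection \<open>The set of double coset representatives\<close>

text \<open>The elements of W^beta at which every finite simple reflection either shortens or leads
  out of W^beta. This local form of X^beta is the stopping condition for climbing inside a coset of
  the finite group.\<close>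

definition Xset :: "nat list \<Rightarrow> W set" where
  "Xset g = {x \<in> Wpos g. \<forall>i. 1 \<le> i \<and> i < N \<longrightarrow>
     neg_root N (wroot (winv x) (al i)) \<or> wroot (winv x) (al i) \<in> Rbar_g_pos N g}"

lemma wroot_winv_eq: "inW N x \<Longrightarrow>
    wroot (winv x) (p,q,k) = (inv (fst x) p, inv (fst x) q, k + (snd x p - snd x q))"
  by (simp add: wroot_def winv_def)

lemma mono_chain:
  fixes e :: "nat \<Rightarrow> int"
  assumes "\<And>i. 1 \<le> i \<Longrightarrow> i < N \<Longrightarrow> e i \<le> e (Suc i)"
  shows "1 \<le> i \<Longrightarrow> i \<le> j \<Longrightarrow> j \<le> N \<Longrightarrow> e i \<le> e j"
proof (induction j)
  case (Suc j)
  show ?case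
  proof (cases "i = Suc j")
    case False
    then have "e i \<le> e j" using Suc by simp
    also have "\<dots> \<le> e (Suc j)" using assms[of j] Suc False by simp
    finally show ?thesis .
  qed simp
qed simp

text \<open>For x = t_e w, the level of x^{-1}(alpha_i) is e_i - e_{i+1}. A strict increase of e
  makes this root negative; equality leaves the finite root w^{-1}(alpha_i), which must not be
  positive outside the parabolic subsystem. The jumps of \<open>eta_w\<close> force a strict
  increase in exactly that case.\<close>

lemma Xbeta_eq: assumes g: "is_opart N g" shows "Xbeta N g = Xset g"
proof (intro equalityI subsetI)
  fix x assume "x \<in> Xbeta N g"
  then obtain w eta where x: "x = wmul (transl (\<lambda>i. eta i + eta_w N g w i)) w"
    and w: "w \<in> Wpos g" "inWbar N w" and eta: "Pminus N eta"
    by (auto simp: Xbeta_def Wmin_eq[OF g])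
  define e where "e = (\<lambda>i. eta i + eta_w N g w i)"
  have s0: "snd w = (\<lambda>_. 0)" using w by (simp add: inWbar_def)
  have xe: "x = (fst w, e)" by (simp add: x wmul_def transl_def s0 e_def)
  have iw: "inW N w" using w by simp
  have ix: "inW N x" using iw eta eta_w_props(1)[of g w]
    by (auto simp: inW_def xe e_def Pminus_def inP_def)
  have step: "e i \<le> e (Suc i)" if "1 \<le> i" "i < N" for i
    using eta_w_props(2)[OF that, of g w] eta that by (auto simp: e_def Pminus_def split: if_splits)
      (smt (verit, ccfv_SIG) Suc_leI lessI)+
  have "pos_root N (wroot x a)" if a: "a \<in> Rbar_g_pos N g" for a
  proof -
    obtain p q k where apq: "a = (p,q,k)" by (cases a)
    have pq: "k = 0" "1 \<le> p" "p < q" "q \<le> N" using a by (auto simp: apq Rbar_iff[OF g])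
    have "pos_root N (wroot w a)" using w a unfolding Wpos_def by blast
    then have lt: "fst w p < fst w q" by (simp add: apq wroot_def s0 pq pos_root_def)
    have r: "is_root N (wroot x a)" using is_root_wroot[OF ix] Rbar_pos[OF g a] pos_is_root by blast
    have "fst w p \<in> {1..N}" "fst w q \<in> {1..N}" using inW_fst_in[OF iw] pq by auto
    then have "e (fst w p) \<le> e (fst w q)" using mono_chain[of e "fst w p" "fst w q"] step lt by auto
    then show ?thesis using lt r by (simp add: apq wroot_def xe pos_root_def pq)
  qed
  then have xp: "x \<in> Wpos g" using WposI[OF ix] by blast
  have "neg_root N (wroot (winv x) (al i)) \<or> wroot (winv x) (al i) \<in> Rbar_g_pos N g"
    if i: "1 \<le> i" "i < N" for i
  proof -
    have r: "is_root N (wroot (winv x) (al i))" using ix is_root_al i by simp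
    have eq: "wroot (winv x) (al i) = (inv (fst w) i, inv (fst w) (Suc i), e i - e (Suc i))"
      using wroot_winv_eq[OF ix] by (simp add: al_pos[OF i(1)] xe)
    show ?thesis
    proof (cases "e i = e (Suc i)")
      case False
      then have "e i - e (Suc i) < 0" using step[OF i] by simp
      then show ?thesis using r by (simp add: eq neg_root_def pos_root_def)
    next
      case True
      let ?a = "(inv (fst w) i, inv (fst w) (Suc i), 0::int)"
      have "eta i - eta (Suc i) \<le> 0" using eta i by (auto simp: Pminus_def)
      \<comment> \<open>The difference of \<open>eta\<close> is nonpositive, so a zero total
        excludes a contribution -1 from \<open>eta_w\<close>.\<close>
      then have "eta_w N g w i - eta_w N g w (Suc i) \<noteq> -1" using True by (simp add: e_def)
      then have "\<not> (\<exists>a. pos_root N a \<and> (\<exists>i' j'. a = (i', j', 0)) \<and> a \<notin> Rbar_g_pos N g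
                 \<and> wroot w a = (i, Suc i, 0))"
        using eta_w_props(2)[OF i, of g w] by metis
      moreover have "wroot w ?a = (i, Suc i, 0)" using iw by (simp add: wroot_def s0)
      ultimately have "\<not> pos_root N ?a \<or> ?a \<in> Rbar_g_pos N g" by blast
      then show ?thesis using r True by (auto simp: eq neg_root_def)
    qed
  qed
  then show "x \<in> Xset g" using xp by (simp add: Xset_def)
next
  fix x assume x: "x \<in> Xset g"
  then have xp: "x \<in> Wpos g" and ix: "inW N x" by (auto simp: Xset_def)
  define w where "w = (fst x, (\<lambda>_. 0) :: nat \<Rightarrow> int)"
  have wb: "inWbar N w" using ix by (simp add: inWbar_def w_def inW_def)
  have iw: "inW N w" using wb by simp
  have eq: "wroot (winv x) (al i) = (inv (fst x) i, inv (fst x) (Suc i), snd x i - snd x (Suc i))"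
    if "1 \<le> i" for i using wroot_winv_eq[OF ix] by (simp add: al_pos[OF that])
  have cond: "neg_root N (wroot (winv x) (al i)) \<or> wroot (winv x) (al i) \<in> Rbar_g_pos N g"
    if "1 \<le> i" "i < N" for i using x that by (simp add: Xset_def)
  have step: "snd x i \<le> snd x (Suc i)" if i: "1 \<le> i" "i < N" for i
    using cond[OF i] by (auto simp: eq[OF i(1)] neg_root_def pos_root_def Rbar_iff[OF g] is_root_def)
  have "pos_root N (wroot w a)" if a: "a \<in> Rbar_g_pos N g" for a
  proof -
    obtain p q k where apq: "a = (p,q,k)" by (cases a)
    have pq: "k = 0" "1 \<le> p" "p < q" "q \<le> N" using a by (auto simp: apq Rbar_iff[OF g])
    have "pos_root N (wroot x a)" using xp a unfolding Wpos_def by blast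
    then have lt: "fst x p < fst x q \<or> (fst x q < fst x p \<and> snd x (fst x p) < snd x (fst x q))"
      by (auto simp: apq wroot_def pq pos_root_def)
    have r: "is_root N (wroot w a)" using iw Rbar_pos[OF g a] pos_is_root by simp
    have "fst x p \<in> {1..N}" "fst x q \<in> {1..N}" using inW_fst_in[OF ix] pq by auto
    \<comment> \<open>The translation part is weakly increasing, so it cannot compensate for a
      reversed pair of finite images; positivity under \<open>x\<close> therefore comes from the
      permutation alone.\<close>
    then have "fst x q < fst x p \<Longrightarrow> snd x (fst x q) \<le> snd x (fst x p)"
      using mono_chain[of "snd x" "fst x q" "fst x p"] step by auto
    then have "fst x p < fst x q" using lt by auto
    then show ?thesis using r by (simp add: apq wroot_def w_def pos_root_def pq)
  qed
  then have wp: "w \<in> Wmin N g" using WposI[OF iw] Wmin_eq[OF g] by blast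
  define eta where "eta = (\<lambda>i. snd x i - eta_w N g w i)"
  have "eta i \<le> eta (Suc i)" if i: "1 \<le> i" "i < N" for i
  proof -
    consider "eta_w N g w i - eta_w N g w (Suc i) = 0"
      | "eta_w N g w i - eta_w N g w (Suc i) = -1" "\<exists>a. pos_root N a \<and> (\<exists>i' j'. a = (i', j', 0)) \<and> a \<notin> Rbar_g_pos N g
                 \<and> wroot w a = (i, Suc i, 0)"
      using eta_w_props(2)[OF i, of g w] by argo
    then show ?thesis
    proof cases
      case 1
      then show ?thesis using step[OF i] by (simp add: eta_def)
    next
      case 2
      then obtain p q where a: "pos_root N (p,q,0)" "(p,q,0) \<notin> Rbar_g_pos N g"
        "wroot w (p,q,0) = (i, Suc i, 0)" by blast
      then have "inv (fst x) i = p" "inv (fst x) (Suc i) = q"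
        using inW_inv_f[OF ix, of p] inW_inv_f[OF ix, of q] by (auto simp: wroot_def w_def simp del: inW_inv_f)
      then have "snd x i \<noteq> snd x (Suc i)"
        using cond[OF i] a by (auto simp: eq[OF i(1)] neg_root_def)
      then show ?thesis using step[OF i] 2(1) by (simp add: eta_def)
    qed
  qed
  then have "eta i \<le> eta j" if "1 \<le> i" "i < j" "j \<le> N" for i j
    using mono_chain[of eta i j] that by simp
  moreover have "inP N eta" using ix eta_w_props(1)[of g w] by (auto simp: inP_def eta_def inW_def)
  ultimately have "Pminus N eta" by (simp add: Pminus_def)
  moreover have "x = wmul (transl (\<lambda>i. eta i + eta_w N g w i)) w"
    by (simp add: wmul_def transl_def w_def eta_def)
  ultimately show "x \<in> Xbeta N g" using wp wb unfolding Xbeta_def by blast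
qed

text \<open>Position and block number of x^{-1} applied to the l-th coordinate, both extended to the
  integers by N-periodicity. Membership in Xset says that these are increasing for the order
  ``block number decreasing, then position increasing''.\<close>

definition gk :: "W \<Rightarrow> nat \<Rightarrow> int" where
  "gk x l = int (inv (fst x) l) - int N * snd x l"

definition Bk :: "nat list \<Rightarrow> W \<Rightarrow> nat \<Rightarrow> int" where
  "Bk g x l = int (blk g (inv (fst x) l)) - int N * snd x l"

lemma pos_gk:
  assumes "inW N x" "p \<in> {1..N}" "q \<in> {1..N}" "p \<noteq> q"
  shows "pos_root N (wroot (winv x) (p,q,0)) \<longleftrightarrow> gk x p < gk x q"
proof -
  have "aff (winv x) l = gk x l" for l using assms by (simp add: aff_def gk_def winv_def)
  then show ?thesis using pos_wroot[of "winv x" p q 0] assms by (simp add: is_root_def)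
qed

text \<open>Block numbers lie in 0..N-1, so equality of the periodic block numbers, read modulo
  \<open>N\<close>, gives equality of both the block numbers and the translation parts.\<close>

lemma Rbar_gk:
  assumes g: "is_opart N g" and x: "inW N x" and pq: "p \<in> {1..N}" "q \<in> {1..N}" "p \<noteq> q"
  shows "wroot (winv x) (p,q,0) \<in> Rbar_g_pos N g \<longleftrightarrow> gk x p < gk x q \<and> Bk g x p = Bk g x q"
proof -
  let ?p = "inv (fst x) p" and ?q = "inv (fst x) q"
  have r: "?p \<in> {1..N}" "?q \<in> {1..N}" using inW_inv_in[OF x] pq by auto
  have "snd x p = snd x q" if "Bk g x p = Bk g x q"
  proof -
    have eq: "int (blk g ?p) - int (blk g ?q) = int N * (snd x p - snd x q)"
      using that by (simp add: Bk_def algebra_simps)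
    then have "int N dvd (int (blk g ?p) - int (blk g ?q))" by simp
    moreover have "\<bar>int (blk g ?p) - int (blk g ?q)\<bar> < int N"
      using blk_less[of ?p g] blk_less[of ?q g] r by auto
    ultimately have "int (blk g ?p) - int (blk g ?q) = 0"
      using dvd_imp_le_int[of "int (blk g ?p) - int (blk g ?q)" "int N"] by force
    then show ?thesis using eq N2 by auto
  qed
  then show ?thesis using r
    by (auto simp: wroot_winv_eq[OF x] Rbar_iff[OF g] gk_def Bk_def)
qed

text \<open>Block number is monotone in position. The periodic extension keeps this because one
  period \<open>N\<close> exceeds every block number.\<close>

lemma gk_Bk_mono:
  assumes x: "inW N x" and pq: "p \<in> {1..N}" "q \<in> {1..N}" and le: "gk x p \<le> gk x q"
  shows "Bk g x p \<le> Bk g x q"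
proof -
  let ?p = "inv (fst x) p" and ?q = "inv (fst x) q"
  have r: "?p \<in> {1..N}" "?q \<in> {1..N}" using inW_inv_in[OF x] pq by auto
  have b: "blk g ?p < N" using blk_less[of ?p g] r by auto
  define d where "d = snd x p - snd x q"
  have le': "int ?p \<le> int ?q + int N * d" using le by (simp add: gk_def d_def algebra_simps)
  have goal: "Bk g x p \<le> Bk g x q \<longleftrightarrow> int (blk g ?p) \<le> int (blk g ?q) + int N * d"
    by (simp add: Bk_def d_def algebra_simps)
  consider "d \<ge> 1" | "d = 0" | "d \<le> -1" by linarith
  then show ?thesis
  proof cases
    case 1
    then have "int N \<le> int N * d" using N2 by simp
    then show ?thesis using b unfolding goal by linarith
  next
    case 2
    then show ?thesis using le' blk_mono[of ?p ?q g] unfolding goal by simp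
  next
    case 3
    then have "int N * d \<le> int N * (-1)" by (intro mult_left_mono) auto
    then show ?thesis using le' r by auto
  qed
qed

lemma Xset_step:
  assumes g: "is_opart N g" and x: "x \<in> Xset g" and i: "1 \<le> i" "i < N"
  shows "Bk g x (Suc i) < Bk g x i \<or> (Bk g x (Suc i) = Bk g x i \<and> gk x i < gk x (Suc i))"
proof -
  have xp: "x \<in> Wpos g" and ix: "inW N x" using x by (auto simp: Xset_def)
  have ii: "i \<in> {1..N}" "Suc i \<in> {1..N}" "i \<noteq> Suc i" using i by auto
  have c: "neg_root N (wroot (winv x) (i, Suc i, 0)) \<or> wroot (winv x) (i, Suc i, 0) \<in> Rbar_g_pos N g"
    using x i by (simp add: Xset_def al_pos)
  show ?thesis
  proof (cases "wroot (winv x) (i, Suc i, 0) \<in> Rbar_g_pos N g")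
    case True
    then show ?thesis using Rbar_gk[OF g ix ii] by auto
  next
    case False
    then have n: "neg_root N (wroot (winv x) (i, Suc i, 0))" using c by blast
    then have "pos_root N (wroot (winv x) (Suc i, i, 0))"
      using pos_negr[of "wroot (winv x) (i, Suc i, 0)"] wroot_negr[of "winv x" "(i, Suc i, 0)"]
      by (simp add: negr_def)
    then have lt: "gk x (Suc i) < gk x i" using pos_gk[OF ix, of "Suc i" i] ii by simp
    then have le: "Bk g x (Suc i) \<le> Bk g x i" using gk_Bk_mono[OF ix] ii by simp
    \<comment> \<open>Equal block numbers in reversed position would make
      \<open>(Suc i, i, 0)\<close>, a negative root, the image under \<open>x\<close> of a positive
      parabolic root.\<close>
    have "Bk g x (Suc i) \<noteq> Bk g x i"
    proof
      assume "Bk g x (Suc i) = Bk g x i"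
      then have "wroot (winv x) (Suc i, i, 0) \<in> Rbar_g_pos N g"
        using Rbar_gk[OF g ix, of "Suc i" i] ii lt by simp
      then have "pos_root N (wroot x (wroot (winv x) (Suc i, i, 0)))"
        using xp unfolding Wpos_def by blast
      then show False using ix by (simp add: pos_root_def)
    qed
    then show ?thesis using le by simp
  qed
qed

lemma Xset_chain:
  assumes g: "is_opart N g" and x: "x \<in> Xset g" and p: "1 \<le> p"
  shows "p < q \<Longrightarrow> q \<le> N \<Longrightarrow> Bk g x q < Bk g x p \<or> (Bk g x q = Bk g x p \<and> gk x p < gk x q)"
proof (induction q)
  case (Suc q)
  show ?case
  proof (cases "p = q")
    case True
    then show ?thesis using Xset_step[OF g x] p Suc by simp
  next
    case False
    then show ?thesis using Suc Xset_step[OF g x, of q] p by fastforce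
  qed
qed simp

section \<open>Existence and uniqueness of representatives in cosets of the finite group\<close>

lemma Wbar_descent:
  assumes "inWbar N u" "u \<noteq> idW"
  shows "\<exists>i. 1 \<le> i \<and> i < N \<and> neg_root N (wroot (winv u) (al i))"
proof -
  obtain js where js: "set js \<subseteq> {1..<N}" "reduced_expr N u (0, js)"
    using reduced_exists_bar assms by blast
  then have u: "sword js = u" "length js = len N u" by (auto simp: reduced_expr_def word_eq)
  then obtain i js' where "js = i # js'" using assms by (cases js) auto
  then show ?thesis using sword_reduced_Cons(2)[of i js'] js u by (auto simp: subset_iff)
qed

text \<open>Left multiplication by \<open>u\<close> only relabels the coordinates through
  \<open>inv (fst u)\<close>. At a left descent of \<open>u\<close> two coordinates appear in
  opposite orders in the sorted lists belonging to \<open>x\<close> and to \<open>wmul u x\<close>,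
  whereas the sorting order is strict.\<close>

lemma Xset_unique:
  assumes g: "is_opart N g" and x: "x \<in> Xset g" and u: "inWbar N u" and ux: "wmul u x \<in> Xset g"
  shows "u = idW"
proof (rule ccontr)
  assume "u \<noteq> idW"
  then obtain i where i: "1 \<le> i" "i < N" and n: "neg_root N (wroot (winv u) (al i))"
    using Wbar_descent[OF u] by blast
  have iu: "inW N u" and ix: "inW N x" using u x by (auto simp: Xset_def)
  have u0: "snd u = (\<lambda>_. 0)" using u by (simp add: inWbar_def)
  have key: "gk (wmul u x) l = gk x (inv (fst u) l)" "Bk g (wmul u x) l = Bk g x (inv (fst u) l)" for l
    using iu ix by (simp_all add: gk_def Bk_def wmul_def inv_comp u0)
  let ?p = "inv (fst u) (Suc i)" and ?q = "inv (fst u) i"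
  have r: "?p \<in> {1..N}" "?q \<in> {1..N}" using inW_inv_in[OF iu] i by auto
  have "?p \<noteq> ?q" using inW_f_inv[OF iu] by (metis n_not_Suc_n)
  moreover have "\<not> ?q < ?p"
    using n r by (auto simp: al_pos[OF i(1)] wroot_winv_eq[OF iu] u0 neg_root_def pos_root_def is_root_def)
  ultimately have "?p < ?q" by simp
  from Xset_chain[OF g x _ this] r Xset_step[OF g ux i] show False by (auto simp: key)
qed

text \<open>The recursion moves towards longer elements; it terminates because a coset of the finite
  group is finite and so has bounded length. An element outside \<open>Xset g\<close> has a
  lengthening reflection that stays in \<open>Wpos g\<close>.\<close>

lemma Wpos_up_induct [consumes 2, case_names top step]:
  assumes g: "is_opart N g" and w: "w \<in> Wpos g"
    and top: "\<And>x. x \<in> Xset g \<Longrightarrow> P x"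
    and step: "\<And>w i. w \<in> Wpos g \<Longrightarrow> 1 \<le> i \<Longrightarrow> i < N \<Longrightarrow> wmul (s i) w \<in> Wpos g \<Longrightarrow>
        P (wmul (s i) w) \<Longrightarrow> P w"
  shows "P w"
proof -
  define C where "C = (\<lambda>u. wmul u w) ` {u. inWbar N u}"
  define M where "M = Max (len N ` C)"
  have fin: "finite C" unfolding C_def using finite_Wbar by simp
  have iw: "inW N w" using w by simp
  have "P y" if "y \<in> C" "y \<in> Wpos g" for y
    using that
  proof (induction "M - len N y" arbitrary: y rule: less_induct)
    case less
    show ?case
    proof (cases "y \<in> Xset g")
      case False
      then obtain i where i: "1 \<le> i" "i < N" "\<not> neg_root N (wroot (winv y) (al i))"
        "wroot (winv y) (al i) \<notin> Rbar_g_pos N g"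
        using less(3) unfolding Xset_def by blast
      have iy: "inW N y" using less by simp
      have pos: "pos_root N (wroot (winv y) (al i))" using i iy is_root_al by (simp add: neg_root_def)
      have up: "wmul (s i) y \<in> Wpos g"
        using Wpos_reflect[OF less(3) i(2)] i(4) iy by (metis wroot_winv(2))
      obtain u where u: "inWbar N u" "y = wmul u w" using less(2) by (auto simp: C_def)
      then have "wmul (s i) y = wmul (wmul (s i) u) w" using i iw by (simp add: wmul_assoc)
      then have C: "wmul (s i) y \<in> C" using u i unfolding C_def by auto
      then have "len N (wmul (s i) y) \<le> M" unfolding M_def using fin by simp
      moreover have "len N (wmul (s i) y) = Suc (len N y)" using len_s_up[OF iy i(2) pos] .
      ultimately have "M - len N (wmul (s i) y) < M - len N y" by simp
      from less(1)[OF this C up] show ?thesis using step[OF less(3) i(1,2) up] by blast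
    qed (use top in blast)
  qed
  moreover have "w \<in> C" unfolding C_def using inWbar_idW by (metis image_eqI mem_Collect_eq wmul_idW_left)
  ultimately show ?thesis using w by blast
qed

text \<open>The combinatorial reason for the partition beta(x). A parabolic root made negative by
  \<open>u\<close> after \<open>x\<close> appears after \<open>x\<close> as a finite root from
  \<open>p\<close> to \<open>q\<close>; some consecutive root inside this interval is then a right
  descent of \<open>u\<close>, and sortedness of \<open>x\<close> places it in the system of
  beta(x).\<close>

lemma not_Wpos_over_X:
  assumes g: "is_opart N g" and x: "x \<in> Xset g" and u: "inWbar N u" and ux: "wmul u x \<notin> Wpos g"
  shows "\<exists>j\<in>Pi_g N (beta_of N g x). neg_root N (wroot u (al j))"
proof -
  have xp: "x \<in> Wpos g" and ix: "inW N x" and iu: "inW N u" using x u by (auto simp: Xset_def)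
  have "inW N (wmul u x)" using iu ix by simp
  then obtain a where a: "a \<in> Rbar_g_pos N g" "\<not> pos_root N (wroot (wmul u x) a)"
    using ux unfolding Wpos_def by blast
  obtain p q k where apq: "wroot x a = (p,q,k)" by (cases "wroot x a")
  have pos: "pos_root N (p,q,k)" using xp a(1) unfolding Wpos_def apq[symmetric] by blast
  have npos: "\<not> pos_root N (wroot u (p,q,k))" using a(2) iu by (simp add: wroot_wmul apq)
  have u0: "snd u = (\<lambda>_. 0)" using u by (simp add: inWbar_def)
  have "is_root N (wroot u (p,q,k))" using pos_is_root[OF pos] iu by simp
  \<comment> \<open>\<open>u\<close> has no translation part and preserves levels, so a positive
    root of positive level would stay positive.\<close>
  then have "k = 0" using npos pos by (auto simp: wroot_def u0 pos_root_def is_root_def)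
  then have pq: "1 \<le> p" "p < q" "q \<le> N" using pos by (auto simp: pos_root_def is_root_def)
  then obtain l where l: "p \<le> l" "l < q" "neg_root N (wroot u (al l))"
    using not_pos_finite[OF iu, of p q] npos \<open>k = 0\<close> by auto
  have lr: "l \<in> {1..N}" "Suc l \<in> {1..N}" "l \<noteq> Suc l" "1 \<le> l" "l < N" using l pq by auto
  have "wroot (winv x) (p,q,0) \<in> Rbar_g_pos N g"
    using a(1) apq \<open>k = 0\<close> ix by (metis wroot_winv(2))
  \<comment> \<open>Block numbers weakly decrease from \<open>p\<close> to \<open>q\<close> and
    agree at the ends, so they are constant in between.\<close>
  then have "Bk g x p = Bk g x q" using Rbar_gk[OF g ix] pq by auto
  moreover have "Bk g x l \<le> Bk g x p" using Xset_chain[OF g x, of p l] l pq by (cases "l = p") auto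
  moreover have "Bk g x q \<le> Bk g x (Suc l)" using Xset_chain[OF g x, of "Suc l" q] l pq by (cases "q = Suc l") auto
  ultimately have "Bk g x (Suc l) = Bk g x l \<and> gk x l < gk x (Suc l)"
    using Xset_step[OF g x lr(4,5)] by auto
  then have "wroot (winv x) (l, Suc l, 0) \<in> Rbar_g_pos N g"
    using Rbar_gk[OF g ix lr(1,2,3)] by simp
  moreover have "wroot x (wroot (winv x) (l, Suc l, 0)) = (l, Suc l, 0)" using ix by simp
  ultimately have "l \<in> Pi_g N (beta_of N g x)"
    unfolding beta_of_props(2) using lr by blast
  then show ?thesis using l by blast
qed

end

text \<open>The change in the c-coordinate under \<open>s 0\<close>, whose translation part is the
  negative of the finite part of \<open>al 0\<close>.\<close>

lemma affine_reflection_sum: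
  fixes f :: "nat \<Rightarrow> complex"
  assumes "2 \<le> N"
  shows "(\<Sum>j\<in>{1..N}. of_int (- 1 * (eps N j - eps 1 j)) * f (transpose N 1 j)) = f N - f 1"
proof -
  have "of_int (- 1 * (eps N j - eps 1 j)) * f (transpose N 1 j)
      = (if j = 1 then f N else 0) - (if j = N then f 1 else 0)" for j
  proof -
    consider "j = 1" | "j = N" | "j \<noteq> 1" "j \<noteq> N" by blast
    then show ?thesis using assms by cases (simp_all add: eps_def)
  qed
  then show ?thesis using assms by (simp add: sum_subtractf sum.delta)
qed

subsection \<open>Duality between the actions on t' and its dual\<close>

context affine_sym
begin

lemma sum_inv_permute:
  assumes "inW N w" shows "(\<Sum>j\<in>{1..N}. f (inv (fst w) j)) = (\<Sum>j\<in>{1..N}. f j)"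
proof -
  have "inv (fst w) permutes {1..N}" using assms permutes_inv unfolding inW_def by blast
  from sum.permute[OF this, of f] show ?thesis by (simp add: comp_def)
qed

lemma act_t_wmul:
  assumes "inW N u" "inW N v" shows "act_t N (wmul u v) xi = act_t N u (act_t N v xi)"
proof -
  let ?f = "\<lambda>j. of_int (snd v j) * fst xi (inv (fst v) j)"
  have "(\<Sum>j\<in>{1..N}. ?f (inv (fst u) j)) = (\<Sum>j\<in>{1..N}. ?f j)" by (rule sum_inv_permute[OF assms(1)])
  then show ?thesis
    using inv_comp[OF assms] by (simp add: act_t_def wmul_def Let_def distrib_right sum.distrib)
qed

lemma act_t_idW [simp]: "act_t N idW xi = xi"
  by (simp add: act_t_def idW_def inv_id)

lemma act_t_winv [simp]: "inW N w \<Longrightarrow> act_t N w (act_t N (winv w) xi) = xi"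
  by (simp flip: act_t_wmul)

lemma act_t_s_s [simp]: "i < N \<Longrightarrow> act_t N (s i) (act_t N (s i) xi) = xi"
  by (simp flip: act_t_wmul)

lemma zeta_eval_act:
  assumes "inW N w" shows "zeta_eval N (act_dual w z) (act_t N w xi) = zeta_eval N z xi"
proof -
  have "(\<Sum>j\<in>{1..N}. (\<lambda>j. fst z j * fst xi j) (inv (fst w) j)) = (\<Sum>j\<in>{1..N}. fst z j * fst xi j)"
    by (rule sum_inv_permute[OF assms])
  then show ?thesis
    by (simp add: zeta_eval_def act_dual_def act_t_def Let_def sum.distrib algebra_simps sum_distrib_left)
qed

lemma act_dual_idW [simp]: "act_dual idW z = z"
  by (simp add: act_dual_def idW_def inv_id)

lemma act_dual_wmul:
  "inW N u \<Longrightarrow> inW N v \<Longrightarrow> act_dual (wmul u v) z = act_dual u (act_dual v z)"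
  by (simp add: act_dual_def wmul_def inv_comp algebra_simps)

lemma zeta_eval_coroot: assumes "is_root N a" shows "zeta_eval N z (coroot a) = pair z a"
proof -
  obtain i j k where a: "a = (i,j,k)" by (cases a)
  have "i \<in> {1..N}" "j \<in> {1..N}" using assms by (auto simp: a is_root_def)
  then show ?thesis
    by (simp add: a zeta_eval_def coroot_def pair_def right_diff_distrib sum_subtractf if_distrib[of "(*) _"] sum.delta cong: if_cong)
qed

lemma pair_act_dual:
  assumes "inW N w" shows "pair (act_dual w z) a = pair z (wroot (winv w) a)"
  using wroot_winv_eq[OF assms] by (cases a) (simp add: pair_def act_dual_def algebra_simps)

lemma act_dual_s_eval:
  "i < N \<Longrightarrow> inW N y \<Longrightarrow>
    zeta_eval N (act_dual (wmul (s i) y) z) xi = zeta_eval N (act_dual y z) (act_t N (s i) xi)"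
  using zeta_eval_act[of "s i" "act_dual y z" "act_t N (s i) xi"] by (simp add: act_dual_wmul)

text \<open>The reflection formula xi - alpha_i(xi) alpha_i^vee in coordinates. For the affine node
  the c-coordinate comes from the translation part of \<open>s 0\<close>.\<close>

lemma act_t_s:
  assumes "i < N"
  shows "fst (act_t N (s i) xi) j = fst xi j - rootval (al i) xi * fst (coroot (al i)) j"
    "snd (act_t N (s i) xi) = snd xi - rootval (al i) xi * snd (coroot (al i))"
proof -
  show "fst (act_t N (s i) xi) j = fst xi j - rootval (al i) xi * fst (coroot (al i)) j"
    using assms N2 by (cases "i = 0") (simp_all add: act_t_def Let_def sW_def s_alpha_def simple_root_def rootval_def coroot_def transpose_def)
  show "snd (act_t N (s i) xi) = snd xi - rootval (al i) xi * snd (coroot (al i))"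
  proof (cases "i = 0")
    case True
    show ?thesis
      using affine_reflection_sum[OF N2, of "fst xi"]
      unfolding True act_t_def Let_def sW_def s_alpha_def simple_root_def rootval_def coroot_def by simp
  qed (simp add: act_t_def Let_def sW_def s_alpha_def simple_root_def rootval_def coroot_def)
qed

end

subsection \<open>Intertwiners\<close>

locale ddaha = affine_sym N for N :: nat +
  fixes sc :: "complex \<Rightarrow> 'h::ring_1" and T :: "W \<Rightarrow> 'h" and Xe :: "nat \<Rightarrow> 'h" and Xc :: 'h
  assumes ddaha: "DDAHA N sc T Xe Xc"
begin

abbreviation X :: "tvec \<Rightarrow> 'h" where "X \<equiv> Xlin N sc Xe Xc"
abbreviation Phi :: "nat \<Rightarrow> 'h" where "Phi \<equiv> phi_s N sc T Xe Xc"

lemmas ddaha_conjs = ddaha[unfolded DDAHA_def]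

lemma sc_add: "sc (a + b) = sc a + sc b"
  using ddaha_conjs[THEN conjunct1] by blast

lemma sc_mult: "sc (a * b) = sc a * sc b"
  using ddaha_conjs[THEN conjunct2, THEN conjunct1] by blast

lemma sc_1 [simp]: "sc 1 = 1"
  using ddaha_conjs[THEN conjunct2, THEN conjunct2, THEN conjunct1] by blast

lemma sc_comm: "sc a * h = h * sc a"
  using ddaha_conjs[THEN conjunct2, THEN conjunct2, THEN conjunct2, THEN conjunct1] by blast

lemma T_idW [simp]: "T idW = 1"
  using ddaha_conjs[THEN conjunct2, THEN conjunct2, THEN conjunct2, THEN conjunct2, THEN conjunct1] by blast

lemma T_wmul: "inW N u \<Longrightarrow> inW N v \<Longrightarrow> T (wmul u v) = T u * T v"
  using ddaha_conjs[THEN conjunct2, THEN conjunct2, THEN conjunct2, THEN conjunct2, THEN conjunct2, THEN conjunct1] by blast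

lemma Xe_comm: "i \<in> {1..N} \<Longrightarrow> j \<in> {1..N} \<Longrightarrow> Xe i * Xe j = Xe j * Xe i"
  using ddaha_conjs[THEN conjunct2, THEN conjunct2, THEN conjunct2, THEN conjunct2, THEN conjunct2, THEN conjunct2, THEN conjunct1] by blast

lemma Xe_Xc: "i \<in> {1..N} \<Longrightarrow> Xe i * Xc = Xc * Xe i"
  using ddaha_conjs[THEN conjunct2, THEN conjunct2, THEN conjunct2, THEN conjunct2, THEN conjunct2, THEN conjunct2, THEN conjunct2, THEN conjunct1] by blast

lemma s_X: "i < N \<Longrightarrow> T (s i) * X xi - X (act_t N (s i) xi) * T (s i) = - sc (rootval (al i) xi)"
  using ddaha_conjs[THEN conjunct2, THEN conjunct2, THEN conjunct2, THEN conjunct2, THEN conjunct2, THEN conjunct2, THEN conjunct2, THEN conjunct2, THEN conjunct1] by blast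

lemma pi_X: "T (piW N) * X xi = X (act_t N (piW N) xi) * T (piW N)"
  using ddaha_conjs[THEN conjunct2, THEN conjunct2, THEN conjunct2, THEN conjunct2, THEN conjunct2, THEN conjunct2, THEN conjunct2, THEN conjunct2, THEN conjunct2, THEN conjunct1] by blast

lemma pbw_independent: "finite F \<Longrightarrow> F \<subseteq> {w. inW N w} \<times> Monos N \<Longrightarrow>
     (\<Sum>p\<in>F. sc (a p) * (T (fst p) * Xmono N Xe Xc (snd p))) = 0 \<Longrightarrow> p \<in> F \<Longrightarrow> a p = 0"
  using ddaha_conjs[THEN conjunct2, THEN conjunct2, THEN conjunct2, THEN conjunct2, THEN conjunct2, THEN conjunct2, THEN conjunct2, THEN conjunct2, THEN conjunct2, THEN conjunct2, THEN conjunct1] by blast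

lemma pbw_span: "\<exists>F a. finite F \<and> F \<subseteq> {w. inW N w} \<times> Monos N \<and>
         h = (\<Sum>p\<in>F. sc (a p) * (T (fst p) * Xmono N Xe Xc (snd p)))"
  using ddaha_conjs[THEN conjunct2, THEN conjunct2, THEN conjunct2, THEN conjunct2, THEN conjunct2, THEN conjunct2, THEN conjunct2, THEN conjunct2, THEN conjunct2, THEN conjunct2, THEN conjunct2] by blast

lemma sc_0 [simp]: "sc 0 = 0"
  using sc_add[of 0 0] by simp

lemma sc_minus: "sc (- a) = - sc a"
  using sc_add[of a "- a"] by (simp add: eq_neg_iff_add_eq_0 add.commute)

lemma sc_diff: "sc (a - b) = sc a - sc b"
  using sc_add[of a "- b"] by (simp add: sc_minus)

lemma sc_left_comm: "h * (sc a * k) = sc a * (h * k)"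
  by (metis sc_comm mult.assoc)

lemmas sc_pull = sc_left_comm[of "T w" for w] sc_left_comm[of "X xi" for xi]
  sc_left_comm[of "Phi i" for i]

lemma sc_assoc: "sc a * (sc b * h) = sc (a * b) * h"
  by (simp add: sc_mult mult.assoc)

lemma sc_inverse_cancel: "a \<noteq> 0 \<Longrightarrow> sc (inverse a) * (sc a * h) = h"
  by (simp add: sc_assoc)

lemma X_comm_with:
  assumes "\<And>i. i \<in> {1..N} \<Longrightarrow> Xe i * h = h * Xe i" "Xc * h = h * Xc"
  shows "X xi * h = h * X xi"
proof -
  have "sc a * Xe i * h = h * (sc a * Xe i)" if "i \<in> {1..N}" for i a
    using assms(1)[OF that] by (simp add: mult.assoc sc_left_comm)
  moreover have "sc a * Xc * h = h * (sc a * Xc)" for a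
    using assms(2) by (simp add: mult.assoc sc_left_comm)
  ultimately show ?thesis
    by (simp add: Xlin_def distrib_left distrib_right sum_distrib_left sum_distrib_right)
qed

lemma X_commute: "X xi * X eta = X eta * X xi"
proof (rule X_comm_with)
  fix i assume i: "i \<in> {1..N}"
  show "Xe i * X eta = X eta * Xe i"
    by (rule X_comm_with[symmetric]) (use i Xe_comm Xe_Xc in auto)
next
  show "Xc * X eta = X eta * Xc"
    by (rule X_comm_with[symmetric]) (use Xe_Xc in auto)
qed

lemma X_lincomb:
  assumes "\<And>j. j \<in> {1..N} \<Longrightarrow> fst xi j = fst eta j - r * fst th j" "snd xi = snd eta - r * snd th"
  shows "X xi = X eta - sc r * X th"
proof -
  have "(\<Sum>i\<in>{1..N}. sc (fst xi i) * Xe i) = (\<Sum>i\<in>{1..N}. sc (fst eta i) * Xe i - sc r * (sc (fst th i) * Xe i))"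
    using assms(1) by (intro sum.cong) (simp_all add: sc_diff sc_mult left_diff_distrib mult.assoc)
  then show ?thesis
    unfolding Xlin_def assms(2)
    by (simp add: sum_subtractf sum_distrib_left sc_diff sc_mult left_diff_distrib distrib_left mult.assoc)
qed

lemma X_s: "i < N \<Longrightarrow> X (act_t N (s i) xi) = X xi - sc (rootval (al i) xi) * X (coroot (al i))"
  by (rule X_lincomb) (simp_all add: act_t_s)

lemma s_X': "i < N \<Longrightarrow> T (s i) * X xi = X (act_t N (s i) xi) * T (s i) - sc (rootval (al i) xi)"
  using s_X[of i xi] by (simp add: algebra_simps)

lemma Phi_eq: "Phi i = 1 + T (s i) * X (coroot (al i))"
  by (simp add: phi_s_def)

text \<open>Multiplied by the coroot, the inhomogeneous term of the cross relation is exactly the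
  difference between xi and s_i(xi) required by the summand 1 of the intertwiner.\<close>

lemma Phi_X: assumes "i < N" shows "Phi i * X xi = X (act_t N (s i) xi) * Phi i"
proof -
  let ?a = "X (coroot (al i))" and ?X' = "X (act_t N (s i) xi)" and ?r = "sc (rootval (al i) xi)"
  have "Phi i * X xi = X xi + T (s i) * X xi * ?a"
    by (simp add: Phi_eq distrib_right mult.assoc X_commute[of xi])
  also have "\<dots> = X xi + (?X' * T (s i) - ?r) * ?a" by (simp add: s_X'[OF assms])
  also have "\<dots> = (X xi - ?r * ?a) + ?X' * T (s i) * ?a" by (simp add: algebra_simps)
  also have "\<dots> = ?X' * Phi i" by (simp add: X_s[OF assms] Phi_eq distrib_left mult.assoc)
  finally show ?thesis .
qed

lemma T_s_s: "i < N \<Longrightarrow> T (s i) * T (s i) = 1"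
  by (simp flip: T_wmul)

text \<open>\<open>s i\<close> negates its coroot, so moving the coroot past the reflection twice
  cancels the mixed terms. The square is then a polynomial and acts by a scalar on weight
  vectors.\<close>

lemma Phi_Phi: assumes "i < N" shows "Phi i * Phi i = 1 - X (coroot (al i)) * X (coroot (al i))"
proof -
  let ?a = "X (coroot (al i))" and ?S = "T (s i)"
  have rv: "rootval (al i) (coroot (al i)) = 2"
    using N2 by (auto simp: rootval_def coroot_def simple_root_def)
  have two: "sc 2 * h = h + h" for h using sc_add[of 1 1] by (simp add: mult_2)
  have "X (act_t N (s i) (coroot (al i))) = - ?a" by (simp add: X_s[OF assms] rv two)
  then have Sa: "?S * ?a = - (?a * ?S) - (1 + 1)"
    using s_X'[OF assms, of "coroot (al i)"] two[of 1] by (simp add: rv)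
  have aS: "?a * ?S = - (?S * ?a) - (1 + 1)" unfolding Sa by simp
  have "?S * ?a * (?S * ?a) = ?S * (?a * ?S) * ?a" by (simp add: mult.assoc)
  also have "\<dots> = - (?S * ?S * ?a * ?a) - (?S * ?a + ?S * ?a)"
    unfolding aS by (simp only: right_diff_distrib left_diff_distrib distrib_left distrib_right mult.assoc mult_minus_left mult_minus_right mult_1 mult_1_right)
  finally have "?S * ?a * (?S * ?a) = - (?a * ?a) - (?S * ?a + ?S * ?a)" by (simp add: T_s_s[OF assms])
  then show ?thesis by (simp add: Phi_eq distrib_left distrib_right)
qed

lemma piinv_X: "T (winv (piW N)) * X xi = X (act_t N (winv (piW N)) xi) * T (winv (piW N))"
proof -
  let ?p = "piW N" and ?q = "winv (piW N)"
  have qp: "T ?q * T ?p = 1" "T ?p * T ?q = 1" by (simp_all flip: T_wmul)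
  have "T ?q * X xi = T ?q * X xi * (T ?p * T ?q)" by (simp add: qp)
  also have "X xi * T ?p = T ?p * X (act_t N ?q xi)" using pi_X[of "act_t N ?q xi"] by simp
  then have "T ?q * X xi * (T ?p * T ?q) = T ?q * T ?p * X (act_t N ?q xi) * T ?q" by (simp add: mult.assoc[symmetric]) (simp add: mult.assoc)
  finally show ?thesis by (simp add: qp)
qed

lemma pipow_X: "T (wpowi (piW N) k) * X xi = X (act_t N (wpowi (piW N) k) xi) * T (wpowi (piW N) k)"
proof -
  have "inW N ((wmul p ^^ n) idW) \<and> (\<forall>xi. T ((wmul p ^^ n) idW) * X xi = X (act_t N ((wmul p ^^ n) idW) xi) * T ((wmul p ^^ n) idW))"
    if p: "inW N p" "\<And>xi. T p * X xi = X (act_t N p xi) * T p" for p n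
  proof (induction n)
    case (Suc n)
    let ?w = "(wmul p ^^ n) idW"
    have w: "inW N ?w" and c: "\<And>xi. T ?w * X xi = X (act_t N ?w xi) * T ?w" using Suc by auto
    have "T (wmul p ?w) * X xi = X (act_t N (wmul p ?w) xi) * T (wmul p ?w)" for xi
    proof -
      have "T (wmul p ?w) * X xi = T p * X (act_t N ?w xi) * T ?w"
        using w p(1) by (simp add: T_wmul mult.assoc c)
      also have "\<dots> = X (act_t N p (act_t N ?w xi)) * T p * T ?w" by (simp add: p(2))
      finally show ?thesis using w p(1) by (simp add: T_wmul mult.assoc act_t_wmul)
    qed
    then show ?case using w p(1) by simp
  qed simp
  from this[OF inW_pi pi_X, of "nat k"] this[of "winv (piW N)" "nat (- k)", OF _ piinv_X] show ?thesis
    unfolding wpowi_def by (cases "0 \<le> k") (simp_all del: split_paired_All)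
qed

text \<open>Vandermonde elimination: subtracting the eigenvalue at \<open>q\<close> from a t-bar
  operator removes the summand \<open>q\<close> modulo \<open>U\<close> and rescales the others.
  Stability under c is not among the assumptions on \<open>U\<close>, so modules over the finite
  algebra are covered.\<close>

lemma weight_components:
  assumes U_0: "0 \<in> U" and U_add: "\<And>u v. u \<in> U \<Longrightarrow> v \<in> U \<Longrightarrow> u + v \<in> U"
    and U_sc: "\<And>a u. u \<in> U \<Longrightarrow> sc a * u \<in> U" and U_X: "\<And>a u. u \<in> U \<Longrightarrow> X (a, 0) * u \<in> U"
    and "finite P"
    and "\<And>p a. p \<in> P \<Longrightarrow> X (a, 0) * v p - sc (ev p a) * v p \<in> U"
    and "\<And>p q. p \<in> P \<Longrightarrow> q \<in> P \<Longrightarrow> p \<noteq> q \<Longrightarrow> \<exists>a. ev p a \<noteq> ev q a"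
    and "(\<Sum>p\<in>P. v p) \<in> U"
  shows "p \<in> P \<Longrightarrow> v p \<in> U"
  using assms(5-)
proof (induction P arbitrary: v p rule: finite_induct)
  case (insert q P)
  have U_minus: "- u \<in> U" if "u \<in> U" for u using U_sc[OF that, of "-1"] by (simp add: sc_minus)
  have U_diff: "u - v \<in> U" if "u \<in> U" "v \<in> U" for u v using U_add[OF that(1) U_minus[OF that(2)]] by simp
  have U_sum: "(\<Sum>p\<in>Q. f p) \<in> U" if "finite Q" "\<And>p. p \<in> Q \<Longrightarrow> f p \<in> U" for Q f
    using that by (induction Q rule: finite_induct) (auto intro: U_0 U_add)
  have inP: "v r \<in> U" if r: "r \<in> P" for r
  proof -
    \<comment> \<open>Only \<open>r\<close> is separated from \<open>q\<close> here. The
      coefficients of other summands may vanish, since the induction hypothesis is used at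
      \<open>r\<close> alone and only \<open>?d r\<close> is inverted.\<close>
    obtain a where a: "ev r a \<noteq> ev q a" using insert.prems(3)[of r q] r insert.hyps by auto
    let ?d = "\<lambda>p. ev p a - ev q a"
    have e: "X (a, 0) * v p - sc (ev q a) * v p - sc (?d p) * v p \<in> U" if "p \<in> insert q P" for p
      using insert.prems(2)[OF that, of a] by (simp add: sc_diff algebra_simps)
    have "X (a, 0) * (\<Sum>p\<in>insert q P. v p) - sc (ev q a) * (\<Sum>p\<in>insert q P. v p) \<in> U"
      using insert.prems(4) by (intro U_diff U_X U_sc)
    then have "(\<Sum>p\<in>insert q P. X (a, 0) * v p - sc (ev q a) * v p) \<in> U"
      by (simp add: sum_subtractf sum_distrib_left del: sum.insert)
    from U_diff[OF this U_sum[of "insert q P" "\<lambda>p. X (a, 0) * v p - sc (ev q a) * v p - sc (?d p) * v p"]]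
    have "(\<Sum>p\<in>insert q P. sc (?d p) * v p) \<in> U"
      using e insert.hyps(1) by (simp add: sum_subtractf del: sum.insert)
    then have s: "(\<Sum>p\<in>P. sc (?d p) * v p) \<in> U" using insert.hyps by simp
    have "sc (?d r) * v r \<in> U"
    proof (rule insert.IH[of r "\<lambda>p. sc (?d p) * v p"])
      fix p b assume "p \<in> P"
      then have "sc (?d p) * (X (b, 0) * v p - sc (ev p b) * v p) \<in> U"
        using insert.prems(2) by (intro U_sc) auto
      then show "X (b, 0) * (sc (?d p) * v p) - sc (ev p b) * (sc (?d p) * v p) \<in> U"
        by (simp add: right_diff_distrib sc_pull sc_assoc mult.commute[of "?d p"])
    qed (use r s insert.prems(3) in auto)
    from U_sc[OF this, of "inverse (?d r)"] show ?thesis using a by (simp add: sc_inverse_cancel)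
  qed
  have "(\<Sum>p\<in>insert q P. v p) - (\<Sum>p\<in>P. v p) \<in> U"
    by (rule U_diff[OF insert.prems(4) U_sum[OF insert.hyps(1) inP]])
  then have "v q \<in> U" using insert.hyps by simp
  then show ?case using inP insert.prems(1) by auto
qed simp

end

subsection \<open>Weight vectors modulo a left ideal\<close>

text \<open>The locale is used for the algebra itself and for its subalgebra generated by the finite Weyl
  group and t-bar.\<close>

locale weight_quotient = ddaha N sc T Xe Xc
  for N :: nat and sc :: "complex \<Rightarrow> 'h::ring_1" and T :: "W \<Rightarrow> 'h" and Xe :: "nat \<Rightarrow> 'h" and Xc :: 'h +
  fixes A :: "'h set" and Ws :: "W set" and I :: "nat set" and Xi :: "tvec set"
    and J :: "'h set" and z :: tvec
  assumes A_sc: "sc a \<in> A" and A_add: "x \<in> A \<Longrightarrow> y \<in> A \<Longrightarrow> x + y \<in> A"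
    and A_mult: "x \<in> A \<Longrightarrow> y \<in> A \<Longrightarrow> x * y \<in> A"
    and T_A: "w \<in> Ws \<Longrightarrow> T w \<in> A" and X_A: "xi \<in> Xi \<Longrightarrow> X xi \<in> A"
    and Ws_inW: "w \<in> Ws \<Longrightarrow> inW N w" and Ws_idW: "idW \<in> Ws"
    and Ws_wmul: "v \<in> Ws \<Longrightarrow> w \<in> Ws \<Longrightarrow> wmul v w \<in> Ws" and Ws_winv: "w \<in> Ws \<Longrightarrow> winv w \<in> Ws"
    and I_range: "i \<in> I \<Longrightarrow> i < N" and I_Ws: "i \<in> I \<Longrightarrow> s i \<in> Ws"
    and Xi_coroot: "i \<in> I \<Longrightarrow> coroot (al i) \<in> Xi"
    and Xi_act: "w \<in> Ws \<Longrightarrow> xi \<in> Xi \<Longrightarrow> act_t N w xi \<in> Xi"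
    and J_0: "0 \<in> J" and J_add: "j \<in> J \<Longrightarrow> j' \<in> J \<Longrightarrow> j + j' \<in> J"
    and J_mult: "x \<in> A \<Longrightarrow> j \<in> J \<Longrightarrow> x * j \<in> J"
    and J_X: "xi \<in> Xi \<Longrightarrow> X xi - sc (zeta_eval N z xi) \<in> J"
begin

lemma J_sc: "j \<in> J \<Longrightarrow> sc a * j \<in> J"
  by (rule J_mult[OF A_sc])

lemma J_minus: "j \<in> J \<Longrightarrow> - j \<in> J"
  using J_sc[of j "-1"] by (simp add: sc_minus)

lemma J_diff: "j \<in> J \<Longrightarrow> k \<in> J \<Longrightarrow> j - k \<in> J"
  using J_add[OF _ J_minus, of j k] by simp

lemma J_diff_iff: "x - y \<in> J \<Longrightarrow> x \<in> J \<longleftrightarrow> y \<in> J"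
  using J_add[of "x - y" y] J_diff[of x "x - y"] by auto

lemma J_sc_iff: "a \<noteq> 0 \<Longrightarrow> sc a * x \<in> J \<longleftrightarrow> x \<in> J"
  using J_sc[of "sc a * x" "inverse a"] J_sc[of x a] by (auto simp: sc_inverse_cancel)

text \<open>The zero class is allowed: elements of J have every weight, so absent components of a
  decomposition can be filled with zero.\<close>

definition wt :: "'h \<Rightarrow> W \<Rightarrow> bool" where
  "wt v y \<longleftrightarrow> (\<forall>xi\<in>Xi. X xi * v - sc (zeta_eval N (act_dual y z) xi) * v \<in> J)"

lemma wt_one: "wt 1 idW"
  by (simp add: wt_def J_X)

lemma wt_sc: assumes "wt v y" shows "wt (sc a * v) y"
  unfolding wt_def
proof
  fix xi assume "xi \<in> Xi"
  then have "sc a * (X xi * v - sc (zeta_eval N (act_dual y z) xi) * v) \<in> J"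
    using assms unfolding wt_def by (intro J_sc) blast
  then show "X xi * (sc a * v) - sc (zeta_eval N (act_dual y z) xi) * (sc a * v) \<in> J"
    by (simp add: right_diff_distrib sc_pull sc_assoc mult.commute[of a])
qed

lemma wt_add: assumes "wt v y" "wt v' y" shows "wt (v + v') y"
  unfolding wt_def
proof
  fix xi assume "xi \<in> Xi"
  then have "(X xi * v - sc (zeta_eval N (act_dual y z) xi) * v) +
     (X xi * v' - sc (zeta_eval N (act_dual y z) xi) * v') \<in> J"
    using assms unfolding wt_def by (intro J_add) auto
  then show "X xi * (v + v') - sc (zeta_eval N (act_dual y z) xi) * (v + v') \<in> J"
    by (simp add: algebra_simps)
qed

lemma wt_J: "j \<in> J \<Longrightarrow> wt j y"
  unfolding wt_def by (auto intro!: J_diff J_sc J_mult X_A)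

lemma Phi_A: "i \<in> I \<Longrightarrow> Phi i \<in> A"
  unfolding Phi_eq using A_sc[of 1] by (auto intro!: A_add A_mult T_A I_Ws X_A Xi_coroot)

lemma wt_Phi: assumes i: "i \<in> I" and y: "inW N y" and v: "wt v y"
  shows "wt (Phi i * v) (wmul (s i) y)"
  unfolding wt_def
proof
  fix xi assume xi: "xi \<in> Xi"
  let ?e = "sc (zeta_eval N (act_dual (wmul (s i) y) z) xi)" and ?xi = "act_t N (s i) xi"
  have iN: "i < N" using I_range i by blast
  have "X xi * Phi i = Phi i * X ?xi" using Phi_X[OF iN, of ?xi] iN by simp
  then have "X xi * (Phi i * v) = Phi i * (X ?xi * v)" by (simp add: mult.assoc[symmetric])
  then have "X xi * (Phi i * v) - ?e * (Phi i * v) = Phi i * (X ?xi * v - ?e * v)"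
    by (simp add: right_diff_distrib sc_pull)
  moreover have "X ?xi * v - ?e * v \<in> J"
    using v xi Xi_act[OF I_Ws[OF i]] by (simp add: wt_def act_dual_s_eval[OF iN y])
  ultimately show "X xi * (Phi i * v) - ?e * (Phi i * v) \<in> J" using J_mult Phi_A[OF i] by simp
qed

lemma wt_pipow: assumes p: "wpowi (piW N) k \<in> Ws" (is "?p \<in> _") and y: "inW N y" and v: "wt v y"
  shows "wt (T ?p * v) (wmul ?p y)"
  unfolding wt_def
proof
  fix xi assume xi: "xi \<in> Xi"
  let ?e = "sc (zeta_eval N (act_dual (wmul ?p y) z) xi)" and ?xi = "act_t N (winv ?p) xi"
  have "X xi * T ?p = T ?p * X ?xi" using pipow_X[of k ?xi] by simp
  then have "X xi * (T ?p * v) = T ?p * (X ?xi * v)" by (simp add: mult.assoc[symmetric])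
  then have "X xi * (T ?p * v) - ?e * (T ?p * v) = T ?p * (X ?xi * v - ?e * v)"
    by (simp add: right_diff_distrib sc_pull)
  moreover have "?e = sc (zeta_eval N (act_dual y z) ?xi)"
    using zeta_eval_act[of ?p "act_dual y z" ?xi] y by (simp add: act_dual_wmul)
  moreover have "X ?xi * v - sc (zeta_eval N (act_dual y z) ?xi) * v \<in> J"
    using v xi Xi_act[OF Ws_winv[OF p]] by (simp add: wt_def)
  ultimately show "X xi * (T ?p * v) - ?e * (T ?p * v) \<in> J" using J_mult T_A[OF p] by simp
qed

lemma wt_coroot: assumes "i \<in> I" "wt v y"
  shows "X (coroot (al i)) * v - sc (pair (act_dual y z) (al i)) * v \<in> J"
proof -
  have "zeta_eval N (act_dual y z) (coroot (al i)) = pair (act_dual y z) (al i)"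
    by (rule zeta_eval_coroot[OF is_root_al[OF I_range[OF assms(1)]]])
  then show ?thesis using assms(2) Xi_coroot[OF assms(1)] unfolding wt_def by metis
qed

text \<open>On a weight vector the coroot becomes a scalar. When this scalar is nonzero, the
  reflection can be expressed through the intertwiner and conversely.\<close>

lemma Phi_expand: assumes "i \<in> I" "wt v y"
  shows "Phi i * v - v - sc (pair (act_dual y z) (al i)) * (T (s i) * v) \<in> J"
proof -
  have "T (s i) * (X (coroot (al i)) * v - sc (pair (act_dual y z) (al i)) * v) \<in> J"
    using wt_coroot[OF assms] J_mult T_A I_Ws assms(1) by blast
  then show ?thesis by (simp add: Phi_eq distrib_right right_diff_distrib mult.assoc sc_pull)
qed

lemma Phi_Phi_wt: assumes "i \<in> I" "wt v y"
  shows "Phi i * (Phi i * v) - sc (1 - (pair (act_dual y z) (al i))\<^sup>2) * v \<in> J"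
proof -
  let ?a = "X (coroot (al i))" and ?p = "sc (pair (act_dual y z) (al i))"
  have j: "?a * v - ?p * v \<in> J" using wt_coroot[OF assms] .
  have "?a * (?a * v - ?p * v) + ?p * (?a * v - ?p * v) \<in> J"
    using j J_mult X_A Xi_coroot assms(1) J_sc by (intro J_add) auto
  then have "- (?a * (?a * v) - ?p * (?p * v)) \<in> J"
    using J_minus[of "?a * (?a * v) - ?p * (?p * v)"] by (simp add: right_diff_distrib sc_pull)
  moreover have "Phi i * (Phi i * v) = v - ?a * (?a * v)"
    using Phi_Phi[OF I_range[OF assms(1)]] by (simp add: mult.assoc[symmetric] left_diff_distrib)
  ultimately show ?thesis by (simp add: sc_diff power2_eq_square sc_mult left_diff_distrib mult.assoc)
qed

section \<open>Linear spans modulo the left ideal\<close>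

definition Sp :: "'h set \<Rightarrow> 'h set" where
  "Sp G = lideal (range sc) (G \<union> J)"

lemma Sp_0: "0 \<in> Sp G"
  by (simp add: Sp_def lideal.intros)

lemma Sp_add: "x \<in> Sp G \<Longrightarrow> y \<in> Sp G \<Longrightarrow> x + y \<in> Sp G"
  by (simp add: Sp_def lideal.intros)

lemma Sp_gen: "g \<in> G \<Longrightarrow> g \<in> Sp G"
  using lideal.intros(2)[OF rangeI, of g "G \<union> J" sc 1] by (simp add: Sp_def)

lemma Sp_J: "g \<in> J \<Longrightarrow> g \<in> Sp G"
  using lideal.intros(2)[OF rangeI, of g "G \<union> J" sc 1] by (simp add: Sp_def)

lemma Sp_induct [consumes 1, case_names J gen add]:
  assumes "x \<in> Sp G" "\<And>j. j \<in> J \<Longrightarrow> P j" "\<And>a g. g \<in> G \<Longrightarrow> P (sc a * g)"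
    "\<And>x y. x \<in> Sp G \<Longrightarrow> y \<in> Sp G \<Longrightarrow> P x \<Longrightarrow> P y \<Longrightarrow> P (x + y)"
  shows "P x"
  using assms(1) unfolding Sp_def
proof (induction rule: lideal.induct)
  case (2 a g)
  then show ?case using assms(2,3) J_sc by auto
qed (use assms(2)[OF J_0] assms(4) in \<open>auto simp: Sp_def\<close>)

lemma Sp_left:
  assumes "m \<in> Sp G" "\<And>g. g \<in> G \<Longrightarrow> h * g \<in> Sp G'" "\<And>j. j \<in> J \<Longrightarrow> h * j \<in> J"
    and sc: "\<And>a x. x \<in> Sp G' \<Longrightarrow> sc a * x \<in> Sp G'"
  shows "h * m \<in> Sp G'"
  using assms(1)
  by (induction rule: Sp_induct) (auto simp: sc_left_comm[of h] distrib_left intro: assms(2,3) sc Sp_J Sp_add)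

lemma Sp_sc: assumes "x \<in> Sp G" shows "sc a * x \<in> Sp G"
  using assms
proof (induction rule: Sp_induct)
  case (gen b g)
  then show ?case using lideal.intros(2)[OF rangeI, of g "G \<union> J" sc "a * b"] by (simp add: Sp_def sc_assoc)
qed (auto simp: distrib_left intro: Sp_J J_sc Sp_add)

lemma Sp_minus: "x \<in> Sp G \<Longrightarrow> - x \<in> Sp G"
  using Sp_sc[of x G "-1"] by (simp add: sc_minus)

lemma Sp_diff: "x \<in> Sp G \<Longrightarrow> y \<in> Sp G \<Longrightarrow> x - y \<in> Sp G"
  using Sp_add[OF _ Sp_minus, of x G y] by simp

lemma Sp_subset: "x \<in> Sp G \<Longrightarrow> G \<subseteq> Sp G' \<Longrightarrow> x \<in> Sp G'"
  by (induction rule: Sp_induct) (auto intro: Sp_J Sp_add Sp_sc)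

lemma Sp_sum:
  assumes "m \<in> Sp (f ` S)"
  shows "\<exists>F a. finite F \<and> F \<subseteq> S \<and> m - (\<Sum>w\<in>F. sc (a w) * f w) \<in> J"
  using assms
proof (induction rule: Sp_induct)
  case (J j)
  then show ?case by (intro exI[of _ "{}"]) simp
next
  case (gen a g)
  then obtain w where "w \<in> S" "g = f w" by blast
  then show ?case by (intro exI[of _ "{w}"] exI[of _ "\<lambda>_. a"]) (simp add: J_0)
next
  case (add x y)
  then obtain F a G b where F: "finite F" "F \<subseteq> S" "x - (\<Sum>w\<in>F. sc (a w) * f w) \<in> J"
    and G: "finite G" "G \<subseteq> S" "y - (\<Sum>w\<in>G. sc (b w) * f w) \<in> J" by blast
  let ?a = "\<lambda>w. if w \<in> F then a w else 0" and ?b = "\<lambda>w. if w \<in> G then b w else 0"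
  have "(\<Sum>w\<in>F \<union> G. sc (?a w) * f w) = (\<Sum>w\<in>F. sc (a w) * f w)"
    using F G by (intro sum.mono_neutral_cong_right) auto
  moreover have "(\<Sum>w\<in>F \<union> G. sc (?b w) * f w) = (\<Sum>w\<in>G. sc (b w) * f w)"
    using F G by (intro sum.mono_neutral_cong_right) auto
  ultimately have "(\<Sum>w\<in>F \<union> G. sc (?a w + ?b w) * f w) = (\<Sum>w\<in>F. sc (a w) * f w) + (\<Sum>w\<in>G. sc (b w) * f w)"
    by (simp add: sc_add distrib_right sum.distrib)
  moreover have "(x - (\<Sum>w\<in>F. sc (a w) * f w)) + (y - (\<Sum>w\<in>G. sc (b w) * f w)) \<in> J"
    using F G J_add by blast
  ultimately have "x + y - (\<Sum>w\<in>F \<union> G. sc (?a w + ?b w) * f w) \<in> J" by (simp add: algebra_simps)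
  then show ?case using F G by (intro exI[of _ "F \<union> G"] exI[of _ "\<lambda>w. ?a w + ?b w"]) auto
qed

section \<open>Triangularity of products of intertwiners\<close>

lemma sword_Ws: "set js \<subseteq> I \<Longrightarrow> sword js \<in> Ws"
  by (induction js) (auto intro: Ws_idW Ws_wmul I_Ws)

lemma wt_Phis: "set js \<subseteq> I \<Longrightarrow> inW N y \<Longrightarrow> wt v y \<Longrightarrow>
    wt (prod_list (map Phi js) * v) (wmul (sword js) y)"
proof (induction js)
  case (Cons i js)
  have "inW N (sword js)" using Cons sword_Ws Ws_inW by simp
  then show ?case using Cons wt_Phi[of i "wmul (sword js) y"] I_range[of i]
    by (simp add: mult.assoc wmul_assoc)
qed simp

definition TS :: "nat \<Rightarrow> 'h set" where
  "TS n = T ` {v \<in> Ws. len N v < n}"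

text \<open>A further intertwiner multiplies the leading term by the reflection and by the pairing
  of the current weight with the simple root. Since these pairings are nonzero, the leading
  coefficient is never lost.\<close>

lemma Phis_triangular:
  assumes nz: "\<And>y i. y \<in> Ws \<Longrightarrow> i \<in> I \<Longrightarrow> pair (act_dual y z) (al i) \<noteq> 0"
  shows "set js \<subseteq> I \<Longrightarrow>
    \<exists>c. c \<noteq> 0 \<and> prod_list (map Phi js) - sc c * T (sword js) \<in> Sp (TS (length js))"
proof (induction js)
  case Nil
  show ?case by (intro exI[of _ 1]) (simp add: Sp_0)
next
  case (Cons i js)
  let ?P = "prod_list (map Phi js)" and ?u = "sword js" and ?n = "length js"
  have i: "i \<in> I" "i < N" and js: "set js \<subseteq> I" using Cons I_range by auto
  have u: "?u \<in> Ws" "inW N ?u" using sword_Ws[OF js] Ws_inW by auto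
  obtain c where c: "c \<noteq> 0" "?P - sc c * T ?u \<in> Sp (TS ?n)" using Cons by auto
  define p where "p = pair (act_dual ?u z) (al i)"
  have p: "p \<noteq> 0" using nz u i by (simp add: p_def)
  have w: "wt ?P ?u" using wt_Phis[OF js inW_idW wt_one] by simp
  have mono: "Sp (TS ?n) \<subseteq> Sp (TS (Suc ?n))"
    using Sp_gen[of _ "TS (Suc ?n)"] by (auto simp: TS_def elim!: Sp_subset)
  have lu: "len N ?u < Suc ?n"
  proof -
    have "set js \<subseteq> {..<N}" using js I_range by auto
    from len_sword_le[OF this] show ?thesis by simp
  qed
  then have Tu: "T ?u \<in> Sp (TS (Suc ?n))" using u by (intro Sp_gen) (auto simp: TS_def)
  have P: "?P \<in> Sp (TS (Suc ?n))"
    using Sp_add[OF subsetD[OF mono c(2)] Sp_sc[OF Tu, of c]] by simp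
  have "T (s i) * (?P - sc c * T ?u) \<in> Sp (TS (Suc ?n))"
  proof (rule Sp_left[OF c(2)])
    fix g assume "g \<in> TS ?n"
    then obtain v where v: "v \<in> Ws" "len N v < ?n" "g = T v" by (auto simp: TS_def)
    then have "T (s i) * g = T (wmul (s i) v)" using Ws_inW i by (simp add: T_wmul)
    moreover have "len N (wmul (s i) v) < Suc ?n" using len_s_le[OF Ws_inW[OF v(1)] i(2)] v by simp
    moreover have "wmul (s i) v \<in> Ws" using Ws_wmul I_Ws i v by blast
    ultimately show "T (s i) * g \<in> Sp (TS (Suc ?n))" by (intro Sp_gen) (auto simp: TS_def)
  qed (use J_mult T_A I_Ws i Sp_sc in auto)
  then have "sc p * (T (s i) * (?P - sc c * T ?u)) \<in> Sp (TS (Suc ?n))" by (rule Sp_sc)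
  moreover have "Phi i * ?P - ?P - sc p * (T (s i) * ?P) \<in> Sp (TS (Suc ?n))"
    using Phi_expand[OF i(1) w] by (intro Sp_J) (simp add: p_def)
  \<comment> \<open>The first summand is the expansion error in J, the second has lower order, and
    the third replaces the product by its leading term; together they leave the intertwiner product
    minus the new leading term.\<close>
  ultimately have "(Phi i * ?P - ?P - sc p * (T (s i) * ?P)) + ?P + sc p * (T (s i) * (?P - sc c * T ?u)) \<in> Sp (TS (Suc ?n))"
    using P by (intro Sp_add)
  moreover have "sc p * (T (s i) * (sc c * T ?u)) = sc (p * c) * T (sword (i # js))"
    using u i by (simp add: T_wmul sc_pull sc_assoc)
  ultimately have "prod_list (map Phi (i # js)) - sc (p * c) * T (sword (i # js)) \<in> Sp (TS (length (i # js)))"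
    by (simp add: right_diff_distrib del: sword_Cons)
  then show ?case using p c by (intro exI[of _ "p * c"]) simp
qed

text \<open>Keeping the expression explicit lets the finite algebra use words in finite letters
  while \<open>phi_w\<close> relies on an arbitrary choice.\<close>

definition Psi :: "int \<times> nat list \<Rightarrow> 'h" where
  "Psi e = T (wpowi (piW N) (fst e)) * prod_list (map Phi (snd e))"

definition expr_in :: "W \<Rightarrow> int \<times> nat list \<Rightarrow> bool" where
  "expr_in w e \<longleftrightarrow> reduced_expr N w e \<and> set (snd e) \<subseteq> I \<and> wpowi (piW N) (fst e) \<in> Ws"

lemma wt_Psi: assumes "expr_in w e" shows "wt (Psi e) w"
proof -
  have "wt (prod_list (map Phi (snd e))) (sword (snd e))"
    using wt_Phis[OF _ inW_idW wt_one, of "snd e"] assms by (simp add: expr_in_def)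
  from wt_pipow[OF _ _ this, of "fst e"] show ?thesis
    using assms sword_Ws[of "snd e"] Ws_inW by (auto simp: Psi_def expr_in_def reduced_expr_def word_eq)
qed

lemma Psi_triangular:
  assumes nz: "\<And>y i. y \<in> Ws \<Longrightarrow> i \<in> I \<Longrightarrow> pair (act_dual y z) (al i) \<noteq> 0"
    and e: "expr_in w e"
  shows "\<exists>c. c \<noteq> 0 \<and> Psi e - sc c * T w \<in> Sp (TS (len N w))"
proof -
  let ?p = "wpowi (piW N) (fst e)" and ?js = "snd e"
  have js: "set ?js \<subseteq> I" and p: "?p \<in> Ws" and w: "w = wmul ?p (sword ?js)" and l: "length ?js = len N w"
    using e by (auto simp: expr_in_def reduced_expr_def word_eq)
  obtain c where c: "c \<noteq> 0" "prod_list (map Phi ?js) - sc c * T (sword ?js) \<in> Sp (TS (length ?js))"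
    using Phis_triangular[OF nz js] by blast
  have "T ?p * (prod_list (map Phi ?js) - sc c * T (sword ?js)) \<in> Sp (TS (len N w))"
  proof (rule Sp_left[OF c(2)])
    fix g assume "g \<in> TS (length ?js)"
    then obtain v where v: "v \<in> Ws" "len N v < length ?js" "g = T v" by (auto simp: TS_def)
    then have "T ?p * g = T (wmul ?p v)" using Ws_inW by (simp add: T_wmul)
    moreover have "len N (wmul ?p v) < len N w" using len_pipow_wmul[OF Ws_inW[OF v(1)]] v l by simp
    moreover have "wmul ?p v \<in> Ws" using Ws_wmul p v by blast
    ultimately show "T ?p * g \<in> Sp (TS (len N w))" by (intro Sp_gen) (auto simp: TS_def)
  qed (use J_mult T_A p Sp_sc in auto)
  moreover have "T w = T ?p * T (sword ?js)" using w sword_Ws[OF js] Ws_inW by (metis T_wmul inW_pipow)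
  ultimately have "Psi e - sc c * T w \<in> Sp (TS (len N w))"
    by (simp add: Psi_def right_diff_distrib sc_pull)
  then show ?thesis using c by blast
qed

text \<open>For admissible \<open>w\<close> triangularity is solved for the leading term
  \<open>T w\<close>; any other \<open>T w\<close> is traded modulo J for that of a shorter
  element.\<close>

lemma T_span:
  assumes nz: "\<And>y i. y \<in> Ws \<Longrightarrow> i \<in> I \<Longrightarrow> pair (act_dual y z) (al i) \<noteq> 0"
    and e: "\<And>w. w \<in> Adm \<Longrightarrow> expr_in w (e w)"
    and red: "\<And>w. w \<in> Ws \<Longrightarrow> w \<notin> Adm \<Longrightarrow> \<exists>w'\<in>Ws. len N w' < len N w \<and> T w - T w' \<in> J"
  shows "w \<in> Ws \<Longrightarrow> T w \<in> Sp ((\<lambda>w. Psi (e w)) ` Adm)"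
proof (induction "len N w" arbitrary: w rule: less_induct)
  case less
  let ?Z = "Sp ((\<lambda>w. Psi (e w)) ` Adm)"
  show ?case
  proof (cases "w \<in> Adm")
    case True
    obtain c where c: "c \<noteq> 0" "Psi (e w) - sc c * T w \<in> Sp (TS (len N w))"
      using Psi_triangular[OF nz e[OF True]] by blast
    have "TS (len N w) \<subseteq> ?Z" using less(1) by (auto simp: TS_def)
    then have "Psi (e w) - sc c * T w \<in> ?Z" using Sp_subset c(2) by blast
    moreover have "Psi (e w) \<in> ?Z" using True by (intro Sp_gen) blast
    ultimately have "Psi (e w) - (Psi (e w) - sc c * T w) \<in> ?Z" by (metis Sp_diff)
    then have "sc c * T w \<in> ?Z" by simp
    then have "sc (inverse c) * (sc c * T w) \<in> ?Z" by (rule Sp_sc)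
    then show ?thesis using c(1) by (simp add: sc_inverse_cancel)
  next
    case False
    then obtain w' where w': "w' \<in> Ws" "len N w' < len N w" "T w - T w' \<in> J" using red less(2) by blast
    have "T w' + (T w - T w') \<in> ?Z" by (rule Sp_add[OF less(1)[OF w'(2,1)] Sp_J[OF w'(3)]])
    then show ?thesis by simp
  qed
qed

text \<open>The span is shown to be stable under left multiplication by each generator and then
  applied to 1. Polynomial generators act diagonally on the weight vectors; group generators require
  passing through the elements \<open>T w\<close>.\<close>

lemma subalg_span:
  assumes nz: "\<And>y i. y \<in> Ws \<Longrightarrow> i \<in> I \<Longrightarrow> pair (act_dual y z) (al i) \<noteq> 0"
    and e: "\<And>w. w \<in> Adm \<Longrightarrow> expr_in w (e w)"
    and red: "\<And>w. w \<in> Ws \<Longrightarrow> w \<notin> Adm \<Longrightarrow> \<exists>w'\<in>Ws. len N w' < len N w \<and> T w - T w' \<in> J"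
    and h: "h \<in> subalg sc (T ` Ws \<union> X ` Xi)"
  shows "h \<in> Sp ((\<lambda>w. Psi (e w)) ` Adm)"
proof -
  let ?Z = "Sp ((\<lambda>w. Psi (e w)) ` Adm)"
  have Adm_Ws: "w \<in> Ws" if "w \<in> Adm" for w
  proof -
    have "w = wmul (wpowi (piW N) (fst (e w))) (sword (snd (e w)))"
      using e[OF that] by (auto simp: expr_in_def reduced_expr_def word_eq)
    then show ?thesis using e[OF that] Ws_wmul sword_Ws unfolding expr_in_def by metis
  qed
  have TZ: "T w \<in> ?Z" if "w \<in> Ws" for w using T_span[OF nz e red that] by blast
  have "h * m \<in> ?Z" if "m \<in> ?Z" for m
    using h that
  proof (induction arbitrary: m rule: subalg.induct)
    case (1 a)
    then show ?case by (rule Sp_sc)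
  next
    case (2 g)
    show ?case
    proof (rule Sp_left[OF 2(2)])
      fix b assume "b \<in> (\<lambda>w. Psi (e w)) ` Adm"
      then obtain w where w: "w \<in> Adm" "b = Psi (e w)" by blast
      show "g * b \<in> ?Z"
      proof (cases "\<exists>xi\<in>Xi. g = X xi")
        case True
        then obtain xi where xi: "xi \<in> Xi" "g = X xi" by blast
        let ?c = "zeta_eval N (act_dual w z) xi"
        have "(g * b - sc ?c * b) + sc ?c * b \<in> ?Z"
          using wt_Psi[OF e[OF w(1)]] xi w by (intro Sp_add Sp_J Sp_sc Sp_gen) (auto simp: wt_def)
        then show ?thesis by simp
      next
        case False
        then obtain u where u: "u \<in> Ws" "g = T u" using 2(1) by blast
        \<comment> \<open>Left multiplication by \<open>T u\<close> is transparent only on group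
          elements, so the weight vector is first expanded in them; \<open>T_span\<close> then leads
          back.\<close>
        obtain c where c: "b - sc c * T w \<in> Sp (TS (len N w))"
          using Psi_triangular[OF nz e[OF w(1)]] w(2) by blast
        have "b - sc c * T w + sc c * T w \<in> Sp (T ` Ws)"
        proof (rule Sp_add)
          show "b - sc c * T w \<in> Sp (T ` Ws)"
            using c by (rule Sp_subset) (auto simp: TS_def intro: Sp_gen)
          show "sc c * T w \<in> Sp (T ` Ws)" using Adm_Ws[OF w(1)] by (intro Sp_sc Sp_gen) blast
        qed
        then have "b \<in> Sp (T ` Ws)" by simp
        then show ?thesis
        proof (rule Sp_left)
          fix t assume "t \<in> (T ` Ws)"
          then obtain v where "v \<in> Ws" "t = T v" by blast
          then have "g * t = T (wmul u v)" "wmul u v \<in> Ws" using u Ws_inW Ws_wmul by (auto simp: T_wmul)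
          then show "g * t \<in> ?Z" using TZ by simp
        qed (use u J_mult T_A Sp_sc in auto)
      qed
    qed (use 2 J_mult T_A X_A Sp_sc in auto)
  next
    case (3 x y)
    then show ?case by (auto simp: distrib_right intro: Sp_add)
  next
    case (4 x y)
    then show ?case by (simp add: mult.assoc)
  qed
  from this[OF TZ[OF Ws_idW]] show ?thesis by simp
qed

end

subsection \<open>Generic weights\<close>

locale generic_standard = ddaha N sc T Xe Xc
  for N :: nat and sc :: "complex \<Rightarrow> 'h::ring_1" and T :: "W \<Rightarrow> 'h" and Xe :: "nat \<Rightarrow> 'h" and Xc :: 'h +
  fixes \<beta> :: "nat list" and \<zeta> :: tvec
  assumes opart: "is_opart N \<beta>" and tdual: "t_dual_g N \<beta> \<zeta>" and gen: "generic N \<beta> \<zeta>"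
    and level: "snd \<zeta> \<noteq> 0"
begin

abbreviation J :: "'h set" where "J \<equiv> Jideal N sc T Xe Xc \<beta> \<zeta>"
abbreviation Hb :: "'h set" where "Hb \<equiv> Hbar N sc T Xe Xc"
abbreviation ph :: "W \<Rightarrow> 'h" where "ph \<equiv> phi_w N sc T Xe Xc"
abbreviation Rb :: "aroot set" where "Rb \<equiv> Rbar_g_pos N \<beta>"

lemma pair_negr: "pair z (negr a) = - pair z a"
  by (cases a) (simp add: pair_def negr_def)

lemma pair_al_Pi: "j \<in> Pi_g N \<beta> \<Longrightarrow> pair \<zeta> (al j) = -1"
  using tdual Pi_g_range[of j \<beta>] unfolding t_dual_g_def by (simp add: al_pos)

text \<open>Within a block the simple roots pair to -1, so the pairing telescopes to minus the
  distance of the two indices.\<close>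

lemma pair_Rb: assumes "a \<in> Rb" shows "pair \<zeta> a \<noteq> 0"
proof -
  obtain p q k where apq: "a = (p,q,k)" by (cases a)
  have pq: "k = 0" "1 \<le> p" "p < q" "q \<le> N" "blk \<beta> p = blk \<beta> q"
    using assms by (auto simp: apq Rbar_iff[OF opart])
  have Pi: "l \<in> Pi_g N \<beta>" if "p \<le> l" "l < q" for l using blk_eq_iff[of p q \<beta>] pq that by blast
  have "p + d \<le> q \<Longrightarrow> fst \<zeta> p - fst \<zeta> (p + d) = - of_nat d" for d
  proof (induction d)
    case (Suc d)
    have "fst \<zeta> (p + d) - fst \<zeta> (Suc (p + d)) = -1"
      using pair_al_Pi[OF Pi[of "p + d"]] Suc pq by (simp add: al_pos pair_def)
    then show ?case using Suc by (simp add: algebra_simps)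
  qed simp
  from this[of "q - p"] have "pair \<zeta> a = - of_nat (q - p)" using pq by (simp add: apq pair_def)
  then show ?thesis using pq by simp
qed

lemma pair_root:
  assumes "is_root N a"
  shows "pair \<zeta> a \<noteq> 0" "(pair \<zeta> a)\<^sup>2 = 1 \<Longrightarrow> a \<in> Rb \<or> negr a \<in> Rb"
proof -
  have pos: "pair \<zeta> a \<noteq> 0 \<and> ((pair \<zeta> a)\<^sup>2 = 1 \<longrightarrow> a \<in> Rb)" if "pos_root N a" for a
    using gen[unfolded generic_def, rule_format, of a] that pair_Rb[of a] by (auto simp: power2_eq_1_iff)
  consider "pos_root N a" | "pos_root N (negr a)" using assms by (auto simp: neg_root_def)
  then have "pair \<zeta> a \<noteq> 0 \<and> ((pair \<zeta> a)\<^sup>2 = 1 \<longrightarrow> a \<in> Rb \<or> negr a \<in> Rb)"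
    using pos[of a] pos[of "negr a"] by cases (auto simp: pair_negr)
  then show "pair \<zeta> a \<noteq> 0" "(pair \<zeta> a)\<^sup>2 = 1 \<Longrightarrow> a \<in> Rb \<or> negr a \<in> Rb" by auto
qed

lemma weights_distinct:
  assumes u: "inW N u" and v: "inW N v"
    and eq: "\<And>a. zeta_eval N (act_dual u \<zeta>) (a, 0) = zeta_eval N (act_dual v \<zeta>) (a, 0)"
  shows "u = v"
proof -
  have c: "fst \<zeta> (inv (fst u) j) + snd \<zeta> * of_int (snd u j) = fst \<zeta> (inv (fst v) j) + snd \<zeta> * of_int (snd v j)"
    if j: "j \<in> {1..N}" for j
  proof -
    have "zeta_eval N z (\<lambda>i. if i = j then 1 else 0, 0) = fst z j" for z
      using j by (simp add: zeta_eval_def if_distrib[of "(*) _"] sum.delta cong: if_cong)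
    then show ?thesis using eq[of "\<lambda>i. if i = j then 1 else 0"] by (simp add: act_dual_def)
  qed
  have inv_eq: "inv (fst u) j = inv (fst v) j \<and> snd u j = snd v j" if j: "j \<in> {1..N}" for j
  proof -
    have "inv (fst u) j = inv (fst v) j"
    proof (rule ccontr)
      assume ne: "inv (fst u) j \<noteq> inv (fst v) j"
      have "is_root N (inv (fst u) j, inv (fst v) j, snd u j - snd v j)"
        using ne inW_inv_in u v j by (simp add: is_root_def del: atLeastAtMost_iff)
      moreover have "pair \<zeta> (inv (fst u) j, inv (fst v) j, snd u j - snd v j) = 0"
        using c[OF j] by (simp add: pair_def algebra_simps)
      ultimately show False using pair_root(1) by blast
    qed
    then show ?thesis using c[OF j] level by simp
  qed
  have "u = v"
  proof (rule aff_inj[OF u v])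
    fix i assume i: "i \<in> {1..N}"
    let ?j = "fst u i"
    have j: "?j \<in> {1..N}" using inW_fst_in[OF u] i by blast
    have "inv (fst v) ?j = i" using inv_eq[OF j] u by simp
    then have "fst v i = ?j" using inW_f_inv[OF v, of ?j] by simp
    then show "aff u i = aff v i" using inv_eq[OF j] by (simp add: aff_def)
  qed
  then show ?thesis .
qed

subsection \<open>The standard module is nonzero\<close>

text \<open>The functional sending T_w X^m to zeta(X^m) vanishes on the defining left ideal. It is
  written as a relation.\<close>

definition zm :: "(nat \<Rightarrow> nat) \<Rightarrow> complex" where
  "zm m = (\<Prod>i\<in>{1..N}. fst \<zeta> i ^ m i) * snd \<zeta> ^ m 0"

definition R :: "'h \<Rightarrow> complex \<Rightarrow> bool" where
  "R h c \<longleftrightarrow> (\<exists>F a. finite F \<and> F \<subseteq> {w. inW N w} \<times> Monos N \<and>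
     h = (\<Sum>p\<in>F. sc (a p) * (T (fst p) * Xmono N Xe Xc (snd p))) \<and> c = (\<Sum>p\<in>F. a p * zm (snd p)))"

lemma R_0: "R 0 c \<Longrightarrow> c = 0"
  unfolding R_def using pbw_independent by (metis (no_types, lifting) mult_zero_left sum.neutral)

lemma R_zero: "R 0 0"
  unfolding R_def by (intro exI[of _ "{}"]) simp

lemma R_total: "\<exists>c. R h c"
  unfolding R_def using pbw_span[of h] by blast

lemma R_add: assumes "R h c" "R h' c'" shows "R (h + h') (c + c')"
proof -
  let ?B = "\<lambda>p. T (fst p) * Xmono N Xe Xc (snd p)"
  obtain F a where F: "finite F" "F \<subseteq> {w. inW N w} \<times> Monos N" "h = (\<Sum>p\<in>F. sc (a p) * ?B p)"
    "c = (\<Sum>p\<in>F. a p * zm (snd p))" using assms(1) unfolding R_def by blast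
  obtain G b where G: "finite G" "G \<subseteq> {w. inW N w} \<times> Monos N" "h' = (\<Sum>p\<in>G. sc (b p) * ?B p)"
    "c' = (\<Sum>p\<in>G. b p * zm (snd p))" using assms(2) unfolding R_def by blast
  let ?a = "\<lambda>p. if p \<in> F then a p else 0" and ?b = "\<lambda>p. if p \<in> G then b p else 0"
  have "h = (\<Sum>p\<in>F \<union> G. sc (?a p) * ?B p)" "h' = (\<Sum>p\<in>F \<union> G. sc (?b p) * ?B p)"
    "c = (\<Sum>p\<in>F \<union> G. ?a p * zm (snd p))" "c' = (\<Sum>p\<in>F \<union> G. ?b p * zm (snd p))"
    unfolding F G using F(1) G(1) by (intro sum.mono_neutral_cong_left; force)+
  then have "h + h' = (\<Sum>p\<in>F \<union> G. sc (?a p + ?b p) * ?B p)"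
    "c + c' = (\<Sum>p\<in>F \<union> G. (?a p + ?b p) * zm (snd p))"
    by (simp_all only: sc_add distrib_right sum.distrib)
  then show ?thesis unfolding R_def using F G by (intro exI[of _ "F \<union> G"] exI[of _ "\<lambda>p. ?a p + ?b p"]) blast
qed

lemma R_sc: assumes "R h c" shows "R (sc b * h) (b * c)"
proof -
  obtain F a where F: "finite F" "F \<subseteq> {w. inW N w} \<times> Monos N"
    "h = (\<Sum>p\<in>F. sc (a p) * (T (fst p) * Xmono N Xe Xc (snd p)))"
    "c = (\<Sum>p\<in>F. a p * zm (snd p))" using assms(1) unfolding R_def by blast
  show ?thesis unfolding R_def using F(1,2)
    by (intro exI[of _ F] exI[of _ "\<lambda>p. b * a p"]) (simp add: F(3,4) sum_distrib_left sc_assoc mult.assoc)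
qed

lemma R_diff: "R h c \<Longrightarrow> R h' c' \<Longrightarrow> R (h - h') (c - c')"
  using R_add[OF _ R_sc[of h' c' "-1"], of h c] by (simp add: sc_minus)

lemma R_unique: "R h c \<Longrightarrow> R h c' \<Longrightarrow> c = c'"
  using R_diff[of h c h c'] R_0[of "c - c'"] by simp

lemma R_sum: "finite F \<Longrightarrow> (\<And>p. p \<in> F \<Longrightarrow> R (f p) (g p)) \<Longrightarrow> R (\<Sum>p\<in>F. f p) (\<Sum>p\<in>F. g p)"
  by (induction F rule: finite_induct) (auto intro: R_zero R_add)

lemma R_basis: "inW N w \<Longrightarrow> m \<in> Monos N \<Longrightarrow> R (T w * Xmono N Xe Xc m) (zm m)"
  unfolding R_def by (intro exI[of _ "{(w, m)}"] exI[of _ "\<lambda>_. 1"]) simp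

lemma basis_induct:
  assumes "\<And>w m. inW N w \<Longrightarrow> m \<in> Monos N \<Longrightarrow> P (T w * Xmono N Xe Xc m)"
    and "\<And>a h. P h \<Longrightarrow> P (sc a * h)" and "\<And>h h'. P h \<Longrightarrow> P h' \<Longrightarrow> P (h + h')" and "P 0"
  shows "P h"
proof -
  obtain F a where F: "finite F" "F \<subseteq> {w. inW N w} \<times> Monos N"
    and h: "h = (\<Sum>p\<in>F. sc (a p) * (T (fst p) * Xmono N Xe Xc (snd p)))" using pbw_span[of h] by blast
  have "P (\<Sum>p\<in>F. sc (a p) * (T (fst p) * Xmono N Xe Xc (snd p)))"
    using F by (induction F rule: finite_induct) (auto intro!: assms)
  then show ?thesis by (simp add: h)
qed

lemma prod_list_comm:
  assumes "\<And>k. k \<in> set ks \<Longrightarrow> Xe k * h = h * Xe k"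
  shows "prod_list (map (\<lambda>i. Xe i ^ m i) ks) * h = h * prod_list (map (\<lambda>i. Xe i ^ m i) ks)"
  using assms
proof (induction ks)
  case (Cons k ks)
  have "Xe k ^ m k * h = h * Xe k ^ m k" using Cons.prems[of k] power_commuting_commutes by auto
  then show ?case using Cons by (simp add: mult.assoc) (simp add: mult.assoc[symmetric])
qed simp

lemma prod_list_Xe:
  assumes "distinct ks" "i \<in> set ks" "set ks \<subseteq> {1..N}"
  shows "prod_list (map (\<lambda>i. Xe i ^ m i) ks) * Xe i = prod_list (map (\<lambda>j. Xe j ^ (m(i := Suc (m i))) j) ks)"
  using assms
proof (induction ks)
  case (Cons k ks)
  have c: "prod_list (map (\<lambda>i. Xe i ^ m i) ks) * Xe i = Xe i * prod_list (map (\<lambda>i. Xe i ^ m i) ks)"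
    using Cons.prems by (intro prod_list_comm Xe_comm) auto
  show ?case
  proof (cases "k = i")
    case True
    then have e: "map (\<lambda>j. Xe j ^ (m(i := Suc (m i))) j) ks = map (\<lambda>i. Xe i ^ m i) ks"
      using Cons.prems by auto
    show ?thesis unfolding True list.map prod_list.Cons e mult.assoc c
      by (simp add: mult.assoc power_Suc2 del: power_Suc)
  next
    case False
    then show ?thesis using Cons by (simp add: mult.assoc)
  qed
qed simp

lemma Xmono_Xe: assumes i: "i \<in> {1..N}"
  shows "Xmono N Xe Xc m * Xe i = Xmono N Xe Xc (m(i := Suc (m i)))"
proof -
  have "Xc ^ n * Xe i = Xe i * Xc ^ n" for n
    using Xe_Xc[OF i] by (intro power_commuting_commutes) simp
  then have "Xmono N Xe Xc m * Xe i = prod_list (map (\<lambda>i. Xe i ^ m i) [1..<N+1]) * Xe i * Xc ^ m 0"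
    by (simp add: Xmono_def mult.assoc)
  also have "prod_list (map (\<lambda>i. Xe i ^ m i) [1..<N+1]) * Xe i
     = prod_list (map (\<lambda>j. Xe j ^ (m(i := Suc (m i))) j) [1..<N+1])"
    using i by (intro prod_list_Xe) auto
  finally show ?thesis using i by (simp add: Xmono_def)
qed

lemma Xmono_Xc: "Xmono N Xe Xc m * Xc = Xmono N Xe Xc (m(0 := Suc (m 0)))"
proof -
  have e: "map (\<lambda>i. Xe i ^ (m(0 := Suc (m 0))) i) [1..<N+1] = map (\<lambda>i. Xe i ^ m i) [1..<N+1]" by auto
  show ?thesis unfolding Xmono_def e by (simp add: mult.assoc power_Suc2 del: power_Suc upt_Suc)
qed

lemma zm_Xe: assumes i: "i \<in> {1..N}" shows "zm (m(i := Suc (m i))) = zm m * fst \<zeta> i"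
proof -
  have "(\<Prod>j\<in>{1..N} - {i}. fst \<zeta> j ^ (m(i := Suc (m i))) j) = (\<Prod>j\<in>{1..N} - {i}. fst \<zeta> j ^ m j)"
    by (intro prod.cong) auto
  then have "(\<Prod>j\<in>{1..N}. fst \<zeta> j ^ (m(i := Suc (m i))) j) = fst \<zeta> i * (\<Prod>j\<in>{1..N}. fst \<zeta> j ^ m j)"
    unfolding prod.remove[OF finite_atLeastAtMost i] by simp
  then show ?thesis unfolding zm_def using i by simp
qed

lemma zm_Xc: "zm (m(0 := Suc (m 0))) = zm m * snd \<zeta>"
proof -
  have "(\<Prod>j\<in>{1..N}. fst \<zeta> j ^ (m(0 := Suc (m 0))) j) = (\<Prod>j\<in>{1..N}. fst \<zeta> j ^ m j)"
    by (intro prod.cong) auto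
  then show ?thesis unfolding zm_def by simp
qed

lemma R_X: assumes "R h c" shows "R (h * X xi) (c * zeta_eval N \<zeta> xi)"
proof -
  have "\<exists>c. R h c \<and> R (h * X xi) (c * zeta_eval N \<zeta> xi)"
  proof (induction h rule: basis_induct)
    case (1 w m)
    let ?B = "\<lambda>m. T w * Xmono N Xe Xc m"
    have up: "m(i := Suc (m i)) \<in> Monos N" if "i \<le> N" for i using 1(2) that by (auto simp: Monos_def)
    have Be: "R (sc a * (?B m * Xe i)) (a * (zm m * fst \<zeta> i))" if "i \<in> {1..N}" for a i
      using R_sc[OF R_basis[OF 1(1) up[of i]], of a] Xmono_Xe[OF that, of m] zm_Xe[OF that, of m] that
      by (simp add: mult.assoc)
    have Bc: "R (sc a * (?B m * Xc)) (a * (zm m * snd \<zeta>))" for a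
      using R_sc[OF R_basis[OF 1(1) up[of 0]], of a] Xmono_Xc[of m] zm_Xc[of m] by (simp add: mult.assoc)
    have "R ((\<Sum>i\<in>{1..N}. sc (fst xi i) * (?B m * Xe i)) + sc (snd xi) * (?B m * Xc))
       ((\<Sum>i\<in>{1..N}. fst xi i * (zm m * fst \<zeta> i)) + snd xi * (zm m * snd \<zeta>))"
      using Be Bc by (intro R_add R_sum) auto
    moreover have "(\<Sum>i\<in>{1..N}. sc (fst xi i) * (?B m * Xe i)) + sc (snd xi) * (?B m * Xc) = ?B m * X xi"
      by (simp add: Xlin_def distrib_left sum_distrib_left sc_left_comm[of "T w * Xmono N Xe Xc m"])
    moreover have "(\<Sum>i\<in>{1..N}. fst xi i * (zm m * fst \<zeta> i)) + snd xi * (zm m * snd \<zeta>) = zm m * zeta_eval N \<zeta> xi"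
      by (simp add: zeta_eval_def distrib_left sum_distrib_left mult_ac)
    ultimately show ?case using R_basis[OF 1] by auto
  next
    case (2 a h)
    then obtain c where "R h c" "R (h * X xi) (c * zeta_eval N \<zeta> xi)" by blast
    then have "R (sc a * h) (a * c)" "R (sc a * (h * X xi)) (a * (c * zeta_eval N \<zeta> xi))" by (auto intro: R_sc)
    then show ?case by (intro exI[of _ "a * c"]) (simp add: mult.assoc)
  next
    case (3 h h')
    then obtain c c' where "R h c" "R (h * X xi) (c * zeta_eval N \<zeta> xi)"
      "R h' c'" "R (h' * X xi) (c' * zeta_eval N \<zeta> xi)" by blast
    then show ?case using R_add by (intro exI[of _ "c + c'"]) (simp add: distrib_right)
  next
    case 4
    then show ?case using R_zero by (intro exI[of _ 0]) simp
  qed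
  then show ?thesis using R_unique[OF assms] by blast
qed

lemma R_X_kernel: "R (h * (X xi - sc (zeta_eval N \<zeta> xi))) 0"
proof -
  obtain c where c: "R h c" using R_total by blast
  from R_diff[OF R_X[OF c, of xi] R_sc[OF c, of "zeta_eval N \<zeta> xi"]]
  show ?thesis by (simp add: right_diff_distrib sc_comm mult.commute)
qed

lemma zeta_eval_s:
  assumes "i < N"
  shows "zeta_eval N z (act_t N (s i) xi) = zeta_eval N z xi - rootval (al i) xi * pair z (al i)"
  unfolding zeta_eval_coroot[OF is_root_al[OF assms], symmetric]
  by (simp add: zeta_eval_def act_t_s[OF assms] right_diff_distrib sum_subtractf sum_distrib_left distrib_left mult.left_commute)

text \<open>Right multiplication by \<open>T (s i) - 1\<close> is moved past \<open>X xi\<close>.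
  What appears consists of left multiples of \<open>X eta - sc (zeta_eval N \<zeta> eta)\<close>, on
  which the functional vanishes, and a scalar multiple of the given element.\<close>

lemma R_s_X:
  assumes i: "i \<in> Pi_g N \<beta>" and h: "R (h * (T (s i) - 1)) 0"
  shows "R (h * X xi * (T (s i) - 1)) 0"
proof -
  have iN: "i < N" using Pi_g_range[OF i] by simp
  let ?eta = "act_t N (s i) xi"
  let ?e = "zeta_eval N \<zeta> ?eta" and ?f = "zeta_eval N \<zeta> xi" and ?S = "T (s i)"
  \<comment> \<open>The value -1 of zeta on the parabolic simple coroot is what makes the scalar
    terms match the cross relation.\<close>
  have "?f = ?e + rootval (al i) ?eta"
    using zeta_eval_s[OF iN, of \<zeta> ?eta] pair_al_Pi[OF i] iN by simp
  moreover have "X xi * ?S = ?S * X ?eta + sc (rootval (al i) ?eta)"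
    using s_X'[OF iN, of ?eta] iN by simp
  ultimately have "X xi * (?S - 1) = ?S * (X ?eta - sc ?e) - (X xi - sc ?f) + sc ?e * (?S - 1)"
    by (simp add: right_diff_distrib sc_add sc_comm algebra_simps)
  then have "h * X xi * (?S - 1) = h * ?S * (X ?eta - sc ?e) - h * (X xi - sc ?f) + sc ?e * (h * (?S - 1))"
    by (simp add: mult.assoc distrib_left right_diff_distrib[of h] sc_left_comm[of h])
  moreover have "R (h * ?S * (X ?eta - sc ?e) - h * (X xi - sc ?f) + sc ?e * (h * (?S - 1))) (0 - 0 + ?e * 0)"
    using R_X_kernel h by (intro R_add R_diff R_sc)
  ultimately show ?thesis by simp
qed

definition unit_vec :: "nat \<Rightarrow> tvec" where
  "unit_vec i = (\<lambda>j. if j = i then 1 else 0, 0)"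

lemma X_unit: assumes "i \<in> {1..N}" shows "X (unit_vec i) = Xe i"
proof -
  have "X (unit_vec i) = (\<Sum>j\<in>{1..N}. sc (if j = i then 1 else 0) * Xe j)"
    by (simp add: Xlin_def unit_vec_def)
  also have "\<dots> = (\<Sum>j\<in>{1..N}. if j = i then Xe j else 0)" by (rule sum.cong) auto
  finally show ?thesis using assms by simp
qed

lemma X_central: "X (\<lambda>_. 0, 1) = Xc"
  by (simp add: Xlin_def)

text \<open>Basis elements carry the group element on the left, so the factor
  \<open>T (s i) - 1\<close> is pushed leftwards through the monomial one generator at a time. At
  the group element it gives a difference of two basis elements with value 1 each.\<close>

lemma R_s_kernel: assumes i: "i \<in> Pi_g N \<beta>" shows "R (h * (T (s i) - 1)) 0"
proof (induction h rule: basis_induct)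
  case (1 w m)
  have iN: "i < N" using Pi_g_range[OF i] by simp
  have z0: "(\<lambda>_. 0) \<in> Monos N" "Xmono N Xe Xc (\<lambda>_. 0) = 1" "zm (\<lambda>_. 0) = 1"
    by (simp_all add: Monos_def Xmono_def zm_def map_replicate_const)
  have "R (T (wmul w (s i)) - T w) (1 - 1)"
    using R_basis[OF _ z0(1), of "wmul w (s i)"] R_basis[OF _ z0(1), of w] 1(1) iN
    by (intro R_diff) (simp_all add: z0)
  then have Rw: "R (T w * (T (s i) - 1)) 0" using 1(1) iN by (simp add: T_wmul right_diff_distrib)
  have "R (h * Xe k ^ n * (T (s i) - 1)) 0" if "R (h * (T (s i) - 1)) 0" "k \<in> {1..N}" for h k n
  proof (induction n)
    case (Suc n)
    from R_s_X[OF i this, of "unit_vec k"] show ?case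
      using X_unit[OF that(2)] by (simp add: mult.assoc power_Suc2 del: power_Suc)
  qed (use that in simp)
  then have Rp: "R (h * prod_list (map (\<lambda>i. Xe i ^ m i) ks) * (T (s i) - 1)) 0"
    if "R (h * (T (s i) - 1)) 0" "set ks \<subseteq> {1..N}" for h ks
    using that
  proof (induction ks arbitrary: h)
    case (Cons k ks)
    from Cons(1)[of "h * Xe k ^ m k"] Cons(2-) show ?case by (simp add: mult.assoc)
  qed simp
  have Rc: "R (h * Xc ^ n * (T (s i) - 1)) 0" if "R (h * (T (s i) - 1)) 0" for h n
  proof (induction n)
    case (Suc n)
    from R_s_X[OF i this, of "(\<lambda>_. 0, 1)"] show ?case
      by (simp add: X_central mult.assoc power_Suc2 del: power_Suc)
  qed (use that in simp)
  have "R (T w * prod_list (map (\<lambda>i. Xe i ^ m i) [1..<N+1]) * Xc ^ m 0 * (T (s i) - 1)) 0"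
    by (rule Rc[OF Rp[OF Rw]]) auto
  then show ?case by (simp add: Xmono_def mult.assoc)
next
  case (2 a h)
  from R_sc[OF this, of a] show ?case by (simp add: mult.assoc)
next
  case (3 h h')
  from R_add[OF this] show ?case by (simp add: distrib_right)
qed (simp add: R_zero)

lemma R_W_kernel: "w \<in> Wbar_g N \<beta> \<Longrightarrow> R (h * (T w - 1)) 0"
proof (induction arbitrary: h rule: Wbar_g.induct)
  case (2 i w)
  have "inW N w" "i < N" using Wbar_g_inWbar[OF 2(2)] Pi_g_range[OF 2(1)] by auto
  then have "h * (T (wmul (s i) w) - 1) = h * T (s i) * (T w - 1) + h * (T (s i) - 1)"
    by (simp add: T_wmul algebra_simps)
  then show ?case using R_add[OF 2(3)[of "h * T (s i)"] R_s_kernel[OF 2(1), of h]] by simp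
qed (simp add: R_zero)

lemma lideal_gen: "1 \<in> A \<Longrightarrow> g \<in> G \<Longrightarrow> g \<in> lideal A G"
  using lideal.intros(2)[of 1 A g G] by simp

lemma lideal_mult:
  assumes "\<And>a b. a \<in> A \<Longrightarrow> b \<in> A \<Longrightarrow> a * b \<in> A"
  shows "x \<in> lideal A G \<Longrightarrow> a \<in> A \<Longrightarrow> a * x \<in> lideal A G"
proof (induction rule: lideal.induct)
  case (2 b g)
  then show ?case using lideal.intros(2)[of "a * b" A g G] assms by (simp add: mult.assoc)
qed (auto simp: distrib_left intro: lideal.intros)

lemma one_notin_J: "1 \<notin> J"
proof
  assume "1 \<in> J"
  moreover have "R x 0" if "x \<in> J" for x
    using that unfolding Jideal_def
  proof (induction rule: lideal.induct)
    case (2 a g)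
    then show ?case using R_W_kernel R_X_kernel by auto
  next
    case (3 x y)
    then show ?case using R_add by fastforce
  qed (simp add: R_zero)
  ultimately have "R 1 0" by blast
  moreover have "R 1 1"
    using R_basis[OF inW_idW, of "\<lambda>_. 0"]
    by (simp add: Monos_def Xmono_def zm_def map_replicate_const)
  ultimately show False using R_unique by fastforce
qed

text \<open>The instance for the whole algebra; the one for the finite algebra depends on a chosen
  \<open>x\<close> and is made inside \<open>summand_annihilator\<close>.\<close>

sublocale Y: weight_quotient N sc T Xe Xc UNIV "{w. inW N w}" "{..<N}" UNIV J \<zeta>
proof unfold_locales
  fix xi show "X xi - sc (zeta_eval N \<zeta> xi) \<in> J"
    unfolding Jideal_def by (rule lideal_gen) blast+
next
  fix x j assume "j \<in> J" then show "x * j \<in> J" unfolding Jideal_def by (intro lideal_mult) auto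
qed (auto simp: Jideal_def intro: lideal.intros)

lemma W_J: "w \<in> Wbar_g N \<beta> \<Longrightarrow> T w - 1 \<in> J"
  unfolding Jideal_def by (rule lideal_gen) blast+

end

subsection \<open>Weight basis of the standard module\<close>

context generic_standard
begin

declare split_paired_All [simp del] split_paired_Ex [simp del]

definition rex :: "W \<Rightarrow> int \<times> nat list" where
  "rex w = (SOME e. reduced_expr N w e)"

lemma reduced_rex: "inW N w \<Longrightarrow> reduced_expr N w (rex w)"
  unfolding rex_def using reduced_exists by (rule someI_ex)

lemma ph_Psi: "ph w = Y.Psi (rex w)"
  by (simp add: phi_w_def Y.Psi_def rex_def Let_def)

lemma rex_expr_in: "inW N w \<Longrightarrow> Y.expr_in w (rex w)"
  using reduced_rex[of w] by (auto simp: Y.expr_in_def reduced_expr_def)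

lemma wt_ph: "inW N w \<Longrightarrow> Y.wt (ph w) w"
  unfolding ph_Psi by (rule Y.wt_Psi[OF rex_expr_in])

lemma pair_act_nonzero: "inW N y \<Longrightarrow> i < N \<Longrightarrow> pair (act_dual y \<zeta>) (al i) \<noteq> 0"
  using pair_root(1) is_root_al[of i] by (simp add: pair_act_dual)

lemma subalg_prod_list: "(\<And>x. x \<in> set xs \<Longrightarrow> x \<in> subalg sc G) \<Longrightarrow> prod_list xs \<in> subalg sc G"
proof (induction xs)
  case Nil
  then show ?case using subalg.intros(1)[of sc 1 G] by simp
qed (auto intro: subalg.intros)

lemma subalg_power: "x \<in> subalg sc G \<Longrightarrow> x ^ n \<in> subalg sc G"
proof (induction n)
  case 0
  then show ?case using subalg.intros(1)[of sc 1 G] by simp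
qed (auto intro: subalg.intros)

lemma subalg_all: "h \<in> subalg sc (T ` {w. inW N w} \<union> X ` UNIV)" (is "_ \<in> ?S")
proof (induction h rule: basis_induct)
  case (1 w m)
  have Xe: "Xe i \<in> ?S" if "i \<in> {1..N}" for i
    using X_unit[OF that] by (metis UnCI rangeI subalg.intros(2))
  have Xc: "Xc \<in> ?S" using X_central by (metis UnCI rangeI subalg.intros(2))
  have "prod_list (map (\<lambda>i. Xe i ^ m i) [1..<N+1]) \<in> ?S"
    using Xe by (intro subalg_prod_list) (auto intro!: subalg_power)
  then show ?case unfolding Xmono_def using Xc 1
    by (intro subalg.intros(4) subalg_power) (auto intro: subalg.intros(2))
next
  case 4
  then show ?case using subalg.intros(1)[of sc 0] by simp
qed (auto intro: subalg.intros)

lemma s_minus_one: "inW N w \<Longrightarrow> j < N \<Longrightarrow> T w - T (wmul w (s j)) = T (wmul w (s j)) * (T (s j) - 1)"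
  using T_wmul[of "wmul w (s j)" "s j"] by (simp add: right_diff_distrib)

lemma s_Wbar_g: "j \<in> Pi_g N g \<Longrightarrow> s j \<in> Wbar_g N g"
  using Wbar_g.intros(2)[OF _ Wbar_g.intros(1)] by force

lemma span_ph: "h \<in> Y.Sp (ph ` Wpos \<beta>)"
proof -
  have "h \<in> Y.Sp ((\<lambda>w. Y.Psi (rex w)) ` Wpos \<beta>)"
  proof (rule Y.subalg_span)
    show "pair (act_dual y \<zeta>) (al i) \<noteq> 0" if "y \<in> {w. inW N w}" "i \<in> {..<N}" for y i
      using pair_act_nonzero that by simp
    show "Y.expr_in w (rex w)" if "w \<in> Wpos \<beta>" for w using rex_expr_in that by simp
  next
    fix w assume w: "w \<in> {w. inW N w}" "w \<notin> Wpos \<beta>"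
    then obtain j where j: "j \<in> Pi_g N \<beta>" "neg_root N (wroot w (al j))" using not_Wpos[OF opart] by blast
    have jN: "j < N" using Pi_g_range[OF j(1)] by simp
    have "T w - T (wmul w (s j)) \<in> J"
      using s_minus_one[of w j] w jN Y.J_mult[OF UNIV_I W_J[OF s_Wbar_g[OF j(1)]]] by simp
    moreover have "len N (wmul w (s j)) < len N w" using len_s_down_right[OF _ jN j(2)] w by simp
    ultimately show "\<exists>w'\<in>{w. inW N w}. len N w' < len N w \<and> T w - T w' \<in> J"
      using w jN by (intro bexI[of _ "wmul w (s j)"]) auto
  next
    show "h \<in> subalg sc (T ` {w. inW N w} \<union> range X)" by (rule subalg_all)
  qed
  then show ?thesis by (simp add: ph_Psi)
qed

lemma sum_in_J: "finite F \<Longrightarrow> (\<And>p. p \<in> F \<Longrightarrow> f p \<in> J) \<Longrightarrow> sum f F \<in> J"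
  by (induction F rule: finite_induct) (auto intro: Y.J_0 Y.J_add)

text \<open>The set \<open>U\<close> may be J itself or the preimage of a submodule over the finite
  algebra; distinct group elements have distinct weights on t-bar.\<close>

lemma components:
  assumes "J \<subseteq> U" "\<And>u v. u \<in> U \<Longrightarrow> v \<in> U \<Longrightarrow> u + v \<in> U" "\<And>a u. u \<in> U \<Longrightarrow> sc a * u \<in> U"
    "\<And>a u. u \<in> U \<Longrightarrow> X (a, 0) * u \<in> U"
    and "finite P" "\<And>p. p \<in> P \<Longrightarrow> Y.wt (v p) (y p)" "\<And>p. p \<in> P \<Longrightarrow> inW N (y p)" "inj_on y P"
    and "(\<Sum>p\<in>P. v p) \<in> U" "p \<in> P"
  shows "v p \<in> U"
proof (rule weight_components[where P = P and ev = "\<lambda>p a. zeta_eval N (act_dual (y p) \<zeta>) (a, 0)"])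
  fix p q assume pq: "p \<in> P" "q \<in> P" "p \<noteq> q"
  then have "y p \<noteq> y q" using assms(8) by (auto simp: inj_on_def)
  then show "\<exists>a. zeta_eval N (act_dual (y p) \<zeta>) (a, 0) \<noteq> zeta_eval N (act_dual (y q) \<zeta>) (a, 0)"
    using weights_distinct assms(7) pq by blast
qed (use assms Y.J_0 in \<open>auto simp: Y.wt_def\<close>)

text \<open>\<open>v\<close> minus its expansion in the spanning vectors lies in J, so its component
  of weight y(zeta) does too. That component is \<open>v\<close> alone or \<open>v\<close> minus one
  multiple of \<open>ph y\<close>, and the first is excluded.\<close>

lemma weight_space:
  assumes v: "Y.wt v y" and y: "inW N y" and nJ: "v \<notin> J"
  shows "y \<in> Wpos \<beta> \<and> (\<exists>a. a \<noteq> 0 \<and> v - sc a * ph y \<in> J)"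
proof -
  obtain F a where F: "finite F" "F \<subseteq> Wpos \<beta>" "v - (\<Sum>w\<in>F. sc (a w) * ph w) \<in> J"
    using Y.Sp_sum[OF span_ph] by blast
  \<comment> \<open>\<open>y\<close> need not occur in the expansion, so the vector is added at
    index \<open>y\<close> and zero is the default elsewhere.\<close>
  let ?f = "\<lambda>w. (if w = y then v else 0) + (if w \<in> F then sc (- a w) * ph w else 0)"
  have "(\<Sum>w\<in>insert y F. ?f w) = v - (\<Sum>w\<in>F. sc (a w) * ph w)"
  proof -
    have "(\<Sum>w\<in>insert y F. if w \<in> F then sc (- a w) * ph w else 0) = (\<Sum>w\<in>F. sc (- a w) * ph w)"
      using F(1) by (intro sum.mono_neutral_cong_right) auto
    then show ?thesis using F(1) by (simp add: sum.distrib sum_negf sc_minus del: sum.insert)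
  qed
  have fy: "?f y \<in> J"
  proof (rule components[where P = "insert y F" and y = "\<lambda>w. w" and v = ?f and U = J])
    fix w assume "w \<in> insert y F"
    have "Y.wt (if w = y then v else 0) w" using v Y.wt_J[OF Y.J_0] by simp
    moreover have "Y.wt (if w \<in> F then sc (- a w) * ph w else 0) w"
      using Y.wt_sc[OF wt_ph[of w], of "- a w"] Y.wt_J[OF Y.J_0, of w] F(2) by auto
    ultimately show "Y.wt (?f w) w" by (rule Y.wt_add)
    show "inW N w" using \<open>w \<in> insert y F\<close> y F by auto
  qed (use F \<open>_ = v - _\<close> Y.J_add Y.J_sc Y.J_mult in auto)
  then have yF: "y \<in> F" using nJ by (auto split: if_splits)
  then have "v - sc (a y) * ph y \<in> J" using fy by (simp add: sc_minus)
  moreover from this have "a y \<noteq> 0" using nJ by auto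
  ultimately show ?thesis using yF F(2) by blast
qed

text \<open>The square of the intertwiner is 1 - p^2. If p^2 = 1, the root y^{-1}(alpha_i) or its
  negative is a positive parabolic root: the first contradicts that s_i y is in W^beta, the second
  that y is.\<close>

lemma Phi_nonzero:
  assumes y: "y \<in> Wpos \<beta>" and i: "i < N" and sy: "wmul (s i) y \<in> Wpos \<beta>"
    and v: "Y.wt v y" "v \<notin> J"
  shows "Phi i * v \<notin> J"
proof
  assume j: "Phi i * v \<in> J"
  have iy: "inW N y" using y by simp
  let ?a = "wroot (winv y) (al i)"
  have root: "is_root N ?a" using iy is_root_al[OF i] by simp
  have "(pair \<zeta> ?a)\<^sup>2 \<noteq> 1"
  proof
    assume "(pair \<zeta> ?a)\<^sup>2 = 1"
    then consider "?a \<in> Rb" | "negr ?a \<in> Rb" using pair_root(2)[OF root] by blast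
    then show False
    proof cases
      case 1
      then show False using Wpos_reflect_conv[OF 1 _ y i] sy iy by simp
    next
      case 2
      from WposD[OF y 2] have "pos_root N (negr (al i))" using iy by (simp add: wroot_negr)
      then show False using pos_al[OF i] by (simp add: neg_root_def)
    qed
  qed
  then have p: "1 - (pair (act_dual y \<zeta>) (al i))\<^sup>2 \<noteq> 0" using pair_act_dual[OF iy] by simp
  have "Phi i * (Phi i * v) \<in> J" using Y.J_mult[OF _ j] by simp
  then have "sc (1 - (pair (act_dual y \<zeta>) (al i))\<^sup>2) * v \<in> J"
    using Y.J_diff_iff[OF Y.Phi_Phi_wt[of i v y]] i v by simp
  then show False using Y.J_sc_iff[OF p] v(2) by blast
qed

text \<open>By \<open>Wpos_shorten\<close> every intermediate element of the reduced word stays in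
  W^beta, so \<open>Phi_nonzero\<close> applies to each letter.\<close>

lemma Phis_nonzero:
  assumes x: "x \<in> Wpos \<beta>" and v: "Y.wt v x" "v \<notin> J"
  shows "set js \<subseteq> {..<N} \<Longrightarrow> len N (sword js) = length js \<Longrightarrow> wmul (sword js) x \<in> Wpos \<beta> \<Longrightarrow>
    prod_list (map Phi js) * v \<notin> J"
proof (induction js)
  case (Cons i js)
  have i: "i < N" and js: "set js \<subseteq> {..<N}" using Cons.prems by auto
  have ix: "inW N x" and iu: "inW N (sword js)" using x js by auto
  note red = sword_reduced_Cons[OF Cons.prems(1,2)]
  have "inW N (sword (i # js))" using i iu by simp
  from Wpos_shorten[OF x this Cons.prems(3) i red(2)]
  have y: "wmul (sword js) x \<in> Wpos \<beta>" using i iu ix by (simp add: wmul_assoc)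
  have "Phi i * (prod_list (map Phi js) * v) \<notin> J"
  proof (rule Phi_nonzero[OF y i])
    show "wmul (s i) (wmul (sword js) x) \<in> Wpos \<beta>" using Cons.prems(3) i iu by (simp add: wmul_assoc)
    show "Y.wt (prod_list (map Phi js) * v) (wmul (sword js) x)" using Y.wt_Phis js ix v by blast
    show "prod_list (map Phi js) * v \<notin> J" using Cons.IH js red(1) y by blast
  qed
  then show ?case by (simp add: mult.assoc)
qed (use v in simp)

lemma idW_Wpos: "idW \<in> Wpos \<beta>"
  using Rbar_pos[OF opart] by (intro WposI) auto

text \<open>The power of pi is invertible and preserves positivity, so it can be stripped off,
  leaving a reduced word applied to the cyclic vector.\<close>

lemma ph_nonzero: assumes w: "w \<in> Wpos \<beta>" shows "ph w \<notin> J"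
proof
  assume j: "ph w \<in> J"
  let ?k = "fst (rex w)" and ?js = "snd (rex w)"
  let ?p = "wpowi (piW N) ?k"
  have e: "w = wmul ?p (sword ?js)" "length ?js = len N w" and js: "set ?js \<subseteq> {..<N}"
    using reduced_rex[of w] w by (auto simp: reduced_expr_def word_eq)
  have iu: "inW N (sword ?js)" using js by simp
  have "sword ?js \<in> Wpos \<beta>"
  proof (rule WposI[OF iu])
    fix a assume a: "a \<in> Rb"
    have "pos_root N (wroot ?p (wroot (sword ?js) a))"
      using WposD[OF w a] e(1) wroot_wmul[OF inW_pipow] by metis
    then show "pos_root N (wroot (sword ?js) a)"
      using pos_pipow iu pos_is_root[OF Rbar_pos[OF opart a]] by simp
  qed
  moreover have "len N (sword ?js) = length ?js"
    using e(2) arg_cong[OF e(1), of "len N"] len_pipow_wmul[OF iu] by simp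
  ultimately have nz: "prod_list (map Phi ?js) \<notin> J"
    using Phis_nonzero[OF idW_Wpos Y.wt_one one_notin_J js] by simp
  have "T (winv ?p) * ph w \<in> J" using Y.J_mult[OF _ j] by simp
  moreover have "T (winv ?p) * T ?p = 1" by (simp flip: T_wmul)
  ultimately show False using nz
    by (simp add: ph_Psi Y.Psi_def mult.assoc[symmetric])
qed

section \<open>The finite subalgebra and the connected components of W^beta\<close>

lemma Hbar_eq: "Hb = subalg sc (T ` {w. inWbar N w} \<union> X ` {xi. snd xi = 0})"
proof -
  have "{T w | w. inWbar N w} = T ` {w. inWbar N w}" by blast
  moreover have "{X (a, 0) | a. True} = X ` {xi. snd xi = 0}"
    by (auto simp: image_iff)
  ultimately show ?thesis unfolding Hbar_def by simp
qed

lemma Hb_add: "x \<in> Hb \<Longrightarrow> y \<in> Hb \<Longrightarrow> x + y \<in> Hb" and Hb_mult: "x \<in> Hb \<Longrightarrow> y \<in> Hb \<Longrightarrow> x * y \<in> Hb"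
  and Hb_sc: "sc a \<in> Hb"
  unfolding Hbar_def by (auto intro: subalg.intros)

lemma Hb_T: "inWbar N w \<Longrightarrow> T w \<in> Hb"
  unfolding Hbar_eq by (rule subalg.intros(2)) blast

lemma Hb_X: "snd xi = 0 \<Longrightarrow> X xi \<in> Hb"
  unfolding Hbar_eq by (rule subalg.intros(2)) blast

lemma Hb_0: "0 \<in> Hb" and Hb_1: "1 \<in> Hb"
  using Hb_sc[of 0] Hb_sc[of 1] by simp_all

lemma coroot_finite: "1 \<le> i \<Longrightarrow> snd (coroot (al i)) = 0"
  by (simp add: al_pos coroot_def)

lemma Hb_Phi: "1 \<le> i \<Longrightarrow> i < N \<Longrightarrow> Phi i \<in> Hb"
  unfolding Phi_eq by (intro Hb_add Hb_1 Hb_mult Hb_T Hb_X inWbar_s coroot_finite)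

text \<open>The full preimage in the algebra of the summand generated by
  \<open>ph x\<close>.\<close>

definition M :: "W \<Rightarrow> 'h set" where
  "M x = {h * ph x + j | h j. h \<in> Hb \<and> j \<in> J}"

lemma M_I: assumes "v - h * ph x \<in> J" "h \<in> Hb" shows "v \<in> M x"
proof -
  have "v = h * ph x + (v - h * ph x)" by simp
  then show ?thesis unfolding M_def using assms by blast
qed

lemma M_self: "ph x \<in> M x"
  by (rule M_I[of _ 1]) (simp_all add: Y.J_0 Hb_1)

lemma M_trans: assumes "ph y \<in> M x" "v \<in> M y" shows "v \<in> M x"
proof -
  obtain h j where 1: "ph y = h * ph x + j" "h \<in> Hb" "j \<in> J" using assms by (auto simp: M_def)
  obtain h' j' where 2: "v = h' * ph y + j'" "h' \<in> Hb" "j' \<in> J" using assms by (auto simp: M_def)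
  have "v = (h' * h) * ph x + (h' * j + j')" by (simp add: 1 2 distrib_left mult.assoc)
  moreover have "h' * j + j' \<in> J" using Y.J_add Y.J_mult 1 2 by blast
  ultimately show ?thesis using Hb_mult 1 2 unfolding M_def by blast
qed

text \<open>The assumptions are symmetric in \<open>w\<close> and \<open>wmul (s i) w\<close>, so
  the step can be reversed.\<close>

lemma M_step:
  assumes "w \<in> Wpos \<beta>" "1 \<le> i" "i < N" "wmul (s i) w \<in> Wpos \<beta>"
  shows "ph (wmul (s i) w) \<in> M w"
proof -
  have "Phi i * ph w \<notin> J" using Phi_nonzero assms wt_ph ph_nonzero by simp
  moreover have "Y.wt (Phi i * ph w) (wmul (s i) w)" using Y.wt_Phi wt_ph assms by simp
  ultimately obtain a where a: "a \<noteq> 0" "Phi i * ph w - sc a * ph (wmul (s i) w) \<in> J"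
    using weight_space[of "Phi i * ph w" "wmul (s i) w"] assms by auto
  then have "sc (- inverse a) * (Phi i * ph w - sc a * ph (wmul (s i) w)) \<in> J" by (intro Y.J_sc)
  then have "ph (wmul (s i) w) - (sc (inverse a) * Phi i) * ph w \<in> J"
    using a(1) by (simp add: right_diff_distrib sc_minus sc_inverse_cancel mult.assoc)
  then show ?thesis using Hb_mult Hb_sc Hb_Phi assms by (intro M_I) auto
qed

lemma Xset_Wpos: "x \<in> Xset \<beta> \<Longrightarrow> x \<in> Wpos \<beta>"
  unfolding Xset_def by blast

text \<open>Both memberships are recorded: \<open>ph w\<close> in \<open>M x\<close> for spanning,
  \<open>ph x\<close> in \<open>M w\<close> for irreducibility.\<close>

lemma reach_X:
  assumes "w \<in> Wpos \<beta>"
  shows "\<exists>x u. x \<in> Xset \<beta> \<and> inWbar N u \<and> w = wmul u x \<and> ph w \<in> M x \<and> ph x \<in> M w"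
  using opart assms
proof (induction rule: Wpos_up_induct)
  case (top x)
  then show ?case using M_self inWbar_idW by (metis wmul_idW_left)
next
  case (step w i)
  then obtain x u where xu: "x \<in> Xset \<beta>" "inWbar N u" "wmul (s i) w = wmul u x"
    "ph (wmul (s i) w) \<in> M x" "ph x \<in> M (wmul (s i) w)" by blast
  have iw: "inW N w" using step by simp
  have ix: "inW N x" by (rule Wpos_inW[OF Xset_Wpos[OF xu(1)]])
  have "w = wmul (s i) (wmul u x)" using step(3) iw xu(3) by (metis s_s_cancel)
  then have "w = wmul (wmul (s i) u) x" using step(3) xu ix by (simp add: wmul_assoc)
  moreover have "inWbar N (wmul (s i) u)" using step xu by simp
  moreover have "ph w \<in> M (wmul (s i) w)" using M_step[of "wmul (s i) w" i] step iw by simp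
  then have "ph w \<in> M x" using M_trans xu by blast
  moreover have "ph x \<in> M w" using M_trans[OF M_step[OF step(1,2,3,4)] xu(5)] .
  ultimately show ?case using xu by blast
qed

lemma Xset_coset:
  assumes "x \<in> Xset \<beta>" "x' \<in> Xset \<beta>" "inWbar N u" "inWbar N u'" "wmul u x = wmul u' x'"
  shows "x = x' \<and> u = u'"
proof -
  have i: "inW N x" "inW N x'" "inW N u" "inW N u'" using assms by (auto simp: Xset_def)
  have e: "x' = wmul (wmul (winv u') u) x"
    using i assms(5) by (simp add: wmul_assoc)
  then have "wmul (winv u') u = idW"
    using Xset_unique[OF opart assms(1), of "wmul (winv u') u"] assms by simp
  then show ?thesis using e i assms(5) wmul_right_cancel by auto
qed

subsection \<open>The summands\<close>

text \<open>The sum of the weight spaces attached to the finite coset of \<open>x\<close>. It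
  contains the summand generated by \<open>ph x\<close>, and its elements come with weight
  components to extract.\<close>

definition gr :: "W \<Rightarrow> 'h set" where
  "gr x = {m. \<exists>v. (\<forall>u. inWbar N u \<longrightarrow> Y.wt (v u) (wmul u x)) \<and> m = (\<Sum>u | inWbar N u. v u)}"

lemma gr_I: "(\<And>u. inWbar N u \<Longrightarrow> Y.wt (v u) (wmul u x)) \<Longrightarrow> (\<Sum>u | inWbar N u. v u) \<in> gr x"
  unfolding gr_def by (rule CollectI, rule exI[of _ v]) simp

lemma gr_wt: assumes "inWbar N u" "Y.wt n (wmul u x)" shows "n \<in> gr x"
proof -
  let ?v = "\<lambda>u'. if u' = u then n else 0"
  have "(\<Sum>u' | inWbar N u'. ?v u') \<in> gr x"
  proof (rule gr_I)
    fix u' show "Y.wt (?v u') (wmul u' x)" using assms(2) Y.wt_J[OF Y.J_0, of "wmul u' x"] by simp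
  qed
  then show ?thesis using assms(1) finite_Wbar by simp
qed

lemma gr_J: "j \<in> J \<Longrightarrow> j \<in> gr x"
  using gr_wt[OF inWbar_idW] Y.wt_J by blast

lemma gr_add: assumes "m \<in> gr x" "n \<in> gr x" shows "m + n \<in> gr x"
proof -
  obtain v v' where v: "\<forall>u. inWbar N u \<longrightarrow> Y.wt (v u) (wmul u x)" "m = (\<Sum>u | inWbar N u. v u)"
    "\<forall>u. inWbar N u \<longrightarrow> Y.wt (v' u) (wmul u x)" "n = (\<Sum>u | inWbar N u. v' u)"
    using assms unfolding gr_def by blast
  then have "(\<Sum>u | inWbar N u. v u + v' u) \<in> gr x" by (intro gr_I Y.wt_add) blast+
  then show ?thesis by (simp add: v(2,4) sum.distrib)
qed

lemma gr_sum: "finite F \<Longrightarrow> (\<And>p. p \<in> F \<Longrightarrow> f p \<in> gr x) \<Longrightarrow> sum f F \<in> gr x"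
  by (induction F rule: finite_induct) (auto intro: gr_J Y.J_0 gr_add)

lemma gr_op:
  assumes "\<And>u n. inWbar N u \<Longrightarrow> Y.wt n (wmul u x) \<Longrightarrow> h * n \<in> gr x" "m \<in> gr x"
  shows "h * m \<in> gr x"
proof -
  obtain v where v: "\<forall>u. inWbar N u \<longrightarrow> Y.wt (v u) (wmul u x)" "m = (\<Sum>u | inWbar N u. v u)"
    using assms(2) unfolding gr_def by blast
  have "(\<Sum>u | inWbar N u. h * v u) \<in> gr x"
  proof (rule gr_sum[OF finite_Wbar])
    fix u assume "u \<in> {u. inWbar N u}"
    then show "h * v u \<in> gr x" using v(1) assms(1) by blast
  qed
  then show ?thesis by (simp add: v(2) sum_distrib_left)
qed

lemma gr_sc: "m \<in> gr x \<Longrightarrow> sc a * m \<in> gr x"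
  by (rule gr_op) (auto intro: gr_wt Y.wt_sc)

lemma gr_X: assumes "m \<in> gr x" shows "X xi * m \<in> gr x"
proof (rule gr_op[OF _ assms])
  fix u n assume n: "inWbar N u" "Y.wt n (wmul u x)"
  let ?c = "sc (zeta_eval N (act_dual (wmul u x) \<zeta>) xi)"
  have "(X xi * n - ?c * n) + ?c * n \<in> gr x"
    using n(2) unfolding Y.wt_def by (intro gr_add gr_sc gr_wt[OF n] gr_J) blast
  then show "X xi * n \<in> gr x" by simp
qed

text \<open>On a weight vector the reflection is a combination of the identity and the intertwiner,
  because the pairing is invertible; the two resulting weights lie in the same coset.\<close>

lemma gr_s: assumes x: "inW N x" and i: "1 \<le> i" "i < N" and m: "m \<in> gr x"
  shows "T (s i) * m \<in> gr x"
proof (rule gr_op[OF _ m])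
  fix u n assume n: "inWbar N u" "Y.wt n (wmul u x)"
  have iux: "inW N (wmul u x)" using n x by simp
  let ?p = "pair (act_dual (wmul u x) \<zeta>) (al i)"
  have p: "?p \<noteq> 0" using pair_act_nonzero[OF iux i(2)] .
  let ?j = "Phi i * n - n - sc ?p * (T (s i) * n)"
  have j: "?j \<in> J" using Y.Phi_expand[of i n] n i by simp
  have "Y.wt (Phi i * n) (wmul (wmul (s i) u) x)"
    using Y.wt_Phi[of i "wmul u x" n] n i iux by (simp add: wmul_assoc)
  then have "Phi i * n \<in> gr x" using n i by (intro gr_wt[of "wmul (s i) u"]) auto
  then have "Phi i * n + sc (-1) * n + sc (-1) * ?j \<in> gr x"
    using gr_wt[OF n] gr_J[OF j] by (intro gr_add gr_sc)
  moreover have "Phi i * n + sc (-1) * n + sc (-1) * ?j = sc ?p * (T (s i) * n)" by (simp add: sc_minus)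
  ultimately have "sc ?p * (T (s i) * n) \<in> gr x" by simp
  from gr_sc[OF this] have "sc (inverse ?p) * (sc ?p * (T (s i) * n)) \<in> gr x" .
  then show "T (s i) * n \<in> gr x" using p by (simp add: sc_inverse_cancel)
qed

lemma gr_T: assumes x: "inW N x" and w: "inWbar N w" and m: "m \<in> gr x"
  shows "T w * m \<in> gr x"
proof -
  obtain js where js: "set js \<subseteq> {1..<N}" "reduced_expr N w (0, js)" using reduced_exists_bar w by blast
  have "T (sword js) * m \<in> gr x" using js(1)
  proof (induction js)
    case (Cons i js)
    have "inW N (sword js)" using Cons by (intro inW_sword) auto
    then show ?case using Cons gr_s[OF x, of i "T (sword js) * m"] by (simp add: T_wmul mult.assoc)
  qed (use m in simp)
  then show ?thesis using js(2) by (simp add: reduced_expr_def word_eq)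
qed

lemma Hb_gr: assumes h: "h \<in> Hb" and x: "inW N x" shows "h * ph x \<in> gr x"
proof -
  have "h * m \<in> gr x" if "m \<in> gr x" for m
    using h that unfolding Hbar_eq
  proof (induction arbitrary: m rule: subalg.induct)
    case (2 g)
    then show ?case by (blast intro: gr_T[OF x] gr_X)
  qed (auto simp: gr_sc distrib_right mult.assoc intro: gr_add)
  moreover have "ph x \<in> gr x" using gr_wt[OF inWbar_idW] wt_ph[OF x] by simp
  ultimately show ?thesis by blast
qed

lemma spanning:
  "\<exists>F c. finite F \<and> F \<subseteq> Xset \<beta> \<and> (\<forall>x\<in>F. c x \<in> Hb) \<and> h - (\<Sum>x\<in>F. c x * ph x) \<in> J"
  using span_ph[of h]
proof (induction rule: Y.Sp_induct)
  case (J j)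
  then show ?case by (intro exI[of _ "{}"]) simp
next
  case (gen a g)
  then obtain w where w: "w \<in> Wpos \<beta>" "g = ph w" by blast
  obtain x where x: "x \<in> Xset \<beta>" "ph w \<in> M x" using reach_X[OF w(1)] by blast
  then obtain h j where "g = h * ph x + j" "h \<in> Hb" "j \<in> J" using w by (auto simp: M_def)
  then have "sc a * g - (sc a * h) * ph x \<in> J" "sc a * h \<in> Hb"
    using Y.J_sc Hb_mult Hb_sc by (auto simp: distrib_left mult.assoc)
  then show ?case using x(1) by (intro exI[of _ "{x}"] exI[of _ "\<lambda>_. sc a * h"]) simp
next
  case (add h h')
  then obtain F c G d where F: "finite F" "F \<subseteq> Xset \<beta>" "\<forall>x\<in>F. c x \<in> Hb" "h - (\<Sum>x\<in>F. c x * ph x) \<in> J"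
    and G: "finite G" "G \<subseteq> Xset \<beta>" "\<forall>x\<in>G. d x \<in> Hb" "h' - (\<Sum>x\<in>G. d x * ph x) \<in> J" by blast
  let ?c = "\<lambda>x. if x \<in> F then c x else 0" and ?d = "\<lambda>x. if x \<in> G then d x else 0"
  have "(\<Sum>x\<in>F \<union> G. ?c x * ph x) = (\<Sum>x\<in>F. c x * ph x)" "(\<Sum>x\<in>F \<union> G. ?d x * ph x) = (\<Sum>x\<in>G. d x * ph x)"
    using F G by (intro sum.mono_neutral_cong_right; force)+
  then have "(\<Sum>x\<in>F \<union> G. (?c x + ?d x) * ph x) = (\<Sum>x\<in>F. c x * ph x) + (\<Sum>x\<in>G. d x * ph x)"
    by (simp add: distrib_right sum.distrib)
  moreover have "(h - (\<Sum>x\<in>F. c x * ph x)) + (h' - (\<Sum>x\<in>G. d x * ph x)) \<in> J" using F G Y.J_add by blast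
  ultimately have "h + h' - (\<Sum>x\<in>F \<union> G. (?c x + ?d x) * ph x) \<in> J" by (simp add: algebra_simps)
  moreover have "\<forall>x\<in>F \<union> G. ?c x + ?d x \<in> Hb" using F G Hb_add Hb_0 by simp
  ultimately show ?case using F G by (intro exI[of _ "F \<union> G"] exI[of _ "\<lambda>x. ?c x + ?d x"]) blast
qed

text \<open>Elements of X^beta represent distinct cosets of the finite group, so the weights of the
  summands, indexed by pairs \<open>(x, u)\<close>, are all different. Each component then vanishes
  separately.\<close>

lemma direct:
  assumes F: "finite F" "F \<subseteq> Xset \<beta>" "\<forall>x\<in>F. c x \<in> Hb" and sum: "(\<Sum>x\<in>F. c x * ph x) \<in> J"
    and x: "x \<in> F"
  shows "c x * ph x \<in> J"
proof -
  have "\<forall>x\<in>F. \<exists>v. (\<forall>u. inWbar N u \<longrightarrow> Y.wt (v u) (wmul u x)) \<and> c x * ph x = (\<Sum>u | inWbar N u. v u)"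
    using Hb_gr F unfolding gr_def Xset_def by (smt (verit, best) Wpos_inW mem_Collect_eq subsetD)
  then obtain v where v: "\<And>x u. x \<in> F \<Longrightarrow> inWbar N u \<Longrightarrow> Y.wt (v x u) (wmul u x)"
    "\<And>x. x \<in> F \<Longrightarrow> c x * ph x = (\<Sum>u | inWbar N u. v x u)" by metis
  let ?P = "F \<times> {u. inWbar N u}"
  have s: "(\<Sum>p\<in>?P. v (fst p) (snd p)) \<in> J"
  proof -
    have "(\<Sum>x\<in>F. c x * ph x) = (\<Sum>x\<in>F. \<Sum>u | inWbar N u. v x u)" by (intro sum.cong v(2)) simp_all
    also have "\<dots> = (\<Sum>p\<in>?P. v (fst p) (snd p))" by (simp add: sum.cartesian_product case_prod_beta)
    finally show ?thesis using sum by simp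
  qed
  have inX: "inW N x" "x \<in> Xset \<beta>" if "x \<in> F" for x using F that by (auto simp: Xset_def)
  have "v x u \<in> J" if u: "inWbar N u" for u
  proof -
    have "(\<lambda>p. v (fst p) (snd p)) (x, u) \<in> J"
    proof (rule components[where P = ?P and y = "\<lambda>p. wmul (snd p) (fst p)" and U = J])
      show "inj_on (\<lambda>p. wmul (snd p) (fst p)) ?P"
      proof (rule inj_onI)
        fix p q assume "p \<in> ?P" "q \<in> ?P" "wmul (snd p) (fst p) = wmul (snd q) (fst q)"
        then show "p = q" using Xset_coset[of "fst p" "fst q" "snd p" "snd q"] inX
          by (auto simp: prod_eq_iff)
      qed
    qed (use u x s F v(1) inX finite_Wbar Y.J_add Y.J_sc Y.J_mult in auto)
    then show ?thesis by simp
  qed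
  then have "(\<Sum>u | inWbar N u. v x u) \<in> J"
    using finite_Wbar by (intro sum_in_J) auto
  then show ?thesis using v(2)[OF x] by simp
qed

text \<open>A submodule strictly larger than J contains a weight component of one of its elements,
  hence some \<open>ph y\<close>, and climbing from \<open>y\<close> returns to the
  generator.\<close>

lemma irreducible:
  assumes x: "x \<in> Xset \<beta>" shows "irred_quot Hb J (M x)"
  unfolding irred_quot_def
proof (intro conjI allI impI)
  have xp: "x \<in> Wpos \<beta>" and ix: "inW N x" using x by (auto simp: Xset_def)
  show "\<not> M x \<subseteq> J" using M_self ph_nonzero[OF xp] by blast
  fix U assume "J \<subseteq> U \<and> U \<subseteq> M x \<and> (\<forall>u\<in>U. \<forall>v\<in>U. u + v \<in> U) \<and> (\<forall>a\<in>Hb. \<forall>u\<in>U. a * u \<in> U)"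
  then have JU: "J \<subseteq> U" and UM: "U \<subseteq> M x" and U_add: "\<And>u v. u \<in> U \<Longrightarrow> v \<in> U \<Longrightarrow> u + v \<in> U"
    and U_mult: "\<And>a u. a \<in> Hb \<Longrightarrow> u \<in> U \<Longrightarrow> a * u \<in> U" by blast+
  show "U = J \<or> U = M x"
  proof (rule disjCI)
    assume "U \<noteq> M x"
    show "U = J"
    proof (rule ccontr)
      assume "U \<noteq> J"
      then obtain m where m: "m \<in> U" "m \<notin> J" using JU by blast
      obtain h j where hj: "m = h * ph x + j" "h \<in> Hb" "j \<in> J" using m(1) UM by (auto simp: M_def)
      have "m \<in> gr x" unfolding hj(1) using Hb_gr[OF hj(2) ix] gr_J[OF hj(3)] by (rule gr_add)
      then obtain v where v: "\<forall>u. inWbar N u \<longrightarrow> Y.wt (v u) (wmul u x)" "m = (\<Sum>u | inWbar N u. v u)"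
        unfolding gr_def by blast
      obtain u where u: "inWbar N u" "v u \<notin> J"
        using m(2) v(2) sum_in_J[OF finite_Wbar, of v] by auto
      have "v u \<in> U"
      proof (rule components[where P = "{u. inWbar N u}" and y = "\<lambda>u. wmul u x"])
        show "inj_on (\<lambda>u. wmul u x) {u. inWbar N u}"
          using wmul_right_cancel[OF ix] by (auto intro!: inj_onI)
      qed (use JU U_add U_mult Hb_sc Hb_X finite_Wbar v m(1) u ix in auto)
      let ?y = "wmul u x"
      obtain a where y: "?y \<in> Wpos \<beta>" "a \<noteq> 0" "v u - sc a * ph ?y \<in> J"
        using weight_space[of "v u" ?y] v(1) u ix by auto
      have "sc (inverse a) * (v u + (sc (-1) * (v u - sc a * ph ?y))) \<in> U"
        using \<open>v u \<in> U\<close> y(3) JU by (intro U_mult U_add Hb_sc) blast+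
      then have phy: "ph ?y \<in> U" using y(2) by (simp add: sc_minus sc_inverse_cancel)
      obtain x' u' where x': "x' \<in> Xset \<beta>" "inWbar N u'" "?y = wmul u' x'" "ph x' \<in> M ?y"
        using reach_X[OF y(1)] by blast
      \<comment> \<open>The top reached from \<open>?y\<close> lies in the coset of
        \<open>x\<close>, so uniqueness identifies the two.\<close>
      then have "x' = x" using Xset_coset[OF x x'(1) u(1) x'(2)] by simp
      then obtain h j where "ph x = h * ph ?y + j" "h \<in> Hb" "j \<in> J" using x'(4) by (auto simp: M_def)
      then have "ph x \<in> U" using U_add U_mult phy JU by auto
      then have "M x \<subseteq> U" using U_add U_mult JU by (auto simp: M_def)
      then show False using UM \<open>U \<noteq> M x\<close> by blast
    qed
  qed
qed

section \<open>The annihilator of a generator\<close>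

lemma zeta_eval_bar: "snd xi = 0 \<Longrightarrow> zeta_eval N (z, 0) xi = zeta_eval N (z, c) xi"
  by (simp add: zeta_eval_def)

text \<open>The preimage of alpha_i under x is a simple root of beta, so the pairing is -1 and the
  intertwiner acts as 1 - s_i. It kills the vector because s_i x has left W^beta and its weight
  space is zero.\<close>

lemma beta_of_invariant:
  assumes x: "x \<in> Xset \<beta>" and i: "i \<in> Pi_g N (beta_of N \<beta> x)"
  shows "(T (s i) - 1) * ph x \<in> J"
proof -
  have xp: "x \<in> Wpos \<beta>" and ix: "inW N x" using Xset_Wpos[OF x] by auto
  obtain a where a: "a \<in> Rb" "wroot x a = al i" and iN: "1 \<le> i" "i < N"
    using i unfolding beta_of_props(2) by (auto simp: al_pos)
  obtain j where j: "j \<in> Pi_g N \<beta>" "a = al j" using Wpos_root_simple[OF opart xp a iN] by blast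
  have "wroot (winv x) (al i) = al j" using a(2) j(2) wroot_winv(2)[OF ix, of a] by simp
  then have p: "pair (act_dual x \<zeta>) (al i) = -1" using pair_al_Pi[OF j(1)] by (simp add: pair_act_dual[OF ix])
  have "wmul (s i) x \<notin> Wpos \<beta>" using Wpos_reflect_conv[OF a xp iN(2)] .
  moreover have "Y.wt (Phi i * ph x) (wmul (s i) x)" using Y.wt_Phi wt_ph ix iN by simp
  ultimately have "Phi i * ph x \<in> J" using weight_space[of "Phi i * ph x" "wmul (s i) x"] ix iN by auto
  moreover have "Phi i * ph x - ph x - sc (-1) * (T (s i) * ph x) \<in> J"
    using Y.Phi_expand[of i "ph x" x] wt_ph[OF ix] iN by (simp add: p)
  ultimately have "(Phi i * ph x - ph x - sc (-1) * (T (s i) * ph x)) - Phi i * ph x \<in> J"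
    by (rule Y.J_diff[rotated])
  then show ?thesis by (simp add: sc_minus left_diff_distrib)
qed

text \<open>Modulo the smaller ideal, \<open>h\<close> is a combination of products indexed by the
  finite \<open>u\<close> with \<open>wmul u x\<close> in W^beta. Applied to \<open>ph x\<close>,
  these products give nonzero vectors of distinct weights, so annihilating \<open>ph x\<close>
  forces every coefficient to vanish.\<close>

lemma summand_annihilator:
  assumes x: "x \<in> Xset \<beta>" and h: "h \<in> Hb"
  shows "h \<in> Jbar N sc T Xe Xc (beta_of N \<beta> x) (fst (act_dual x \<zeta>)) \<longleftrightarrow> h * ph x \<in> J"
proof
  let ?g = "beta_of N \<beta> x" and ?Jb = "Jbar N sc T Xe Xc (beta_of N \<beta> x) (fst (act_dual x \<zeta>))"
  let ?z = "act_dual x \<zeta>"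
  have xp: "x \<in> Wpos \<beta>" and ix: "inW N x" using Xset_Wpos[OF x] by auto
  have WJ: "(T w - 1) * ph x \<in> J" if "w \<in> Wbar_g N ?g" for w
    using that
  proof (induction rule: Wbar_g.induct)
    case (2 i w)
    have "inW N w" "i < N" using Wbar_g_inWbar[OF 2(2)] Pi_g_range[OF 2(1)] by auto
    then have "(T (wmul (s i) w) - 1) * ph x = T (s i) * ((T w - 1) * ph x) + (T (s i) - 1) * ph x"
      by (simp add: T_wmul algebra_simps)
    then show ?case using Y.J_add[OF Y.J_mult[OF UNIV_I 2(3)] beta_of_invariant[OF x 2(1)]] by simp
  qed (simp add: Y.J_0)
  have XJ: "(X (a, 0) - sc (zeta_eval N (fst ?z, 0) (a, 0))) * ph x \<in> J" for a
  proof -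
    have "zeta_eval N (fst ?z, 0) (a, 0) = zeta_eval N ?z (a, 0)"
      using zeta_eval_bar[of "(a, 0)" "fst ?z" "snd ?z"] by simp
    then show ?thesis using wt_ph[OF ix] unfolding Y.wt_def by (simp add: left_diff_distrib)
  qed
  have JbJ: "h * ph x \<in> J" if "h \<in> ?Jb" for h
    using that unfolding Jbar_def
  proof (induction rule: lideal.induct)
    case (2 a g)
    then have "g * ph x \<in> J" using WJ XJ by blast
    then show ?case using Y.J_mult by (simp add: mult.assoc)
  qed (auto simp: distrib_right intro: Y.J_0 Y.J_add)
  then show "h \<in> ?Jb \<Longrightarrow> h * ph x \<in> J" .
  assume hJ: "h * ph x \<in> J"
  interpret B: weight_quotient N sc T Xe Xc Hb "{w. inWbar N w}" "{1..<N}" "{xi. snd xi = 0}" ?Jb ?z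
  proof unfold_locales
    fix xi :: tvec assume xi: "xi \<in> {xi. snd xi = 0}"
    then have "xi = (fst xi, 0)" by (simp add: prod_eq_iff)
    moreover have "zeta_eval N ?z xi = zeta_eval N (fst ?z, 0) xi"
      using zeta_eval_bar[of xi "fst ?z" "snd ?z"] xi by simp
    ultimately have "X xi - sc (zeta_eval N ?z xi) \<in> {X (a, 0) - sc (zeta_eval N (fst ?z, 0) (a, 0)) | a. True}"
      by (metis (mono_tags, lifting) mem_Collect_eq)
    then show "X xi - sc (zeta_eval N ?z xi) \<in> ?Jb" unfolding Jbar_def by (intro lideal_gen Hb_1) blast
  next
    fix y j assume "y \<in> Hb" "j \<in> ?Jb"
    then show "y * j \<in> ?Jb" unfolding Jbar_def using Hb_mult by (intro lideal_mult) auto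
  next
    fix w and xi :: tvec assume "w \<in> {w. inWbar N w}" "xi \<in> {xi. snd xi = 0}"
    then show "act_t N w xi \<in> {xi. snd xi = 0}" by (simp add: act_t_def Let_def inWbar_def)
  qed (auto simp: Hb_sc Hb_add Hb_mult Hb_T Hb_X coroot_finite Jbar_def intro: lideal.intros)
  \<comment> \<open>The words behind \<open>phi_w\<close> may contain \<open>s 0\<close> or pi, so
    finite words with pi-exponent 0 are chosen separately.\<close>
  define rexb where "rexb u = (0::int, SOME js. set js \<subseteq> {1..<N} \<and> reduced_expr N u (0, js))" for u
  have rexb: "set (snd (rexb u)) \<subseteq> {1..<N}" "reduced_expr N u (rexb u)" if "inWbar N u" for u
    using someI_ex[OF reduced_exists_bar[OF that]] by (auto simp: rexb_def)
  let ?Adm = "{u. inWbar N u \<and> wmul u x \<in> Wpos \<beta>}"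
  have "h \<in> B.Sp ((\<lambda>u. B.Psi (rexb u)) ` ?Adm)"
  proof (rule B.subalg_span)
    show "pair (act_dual y ?z) (al i) \<noteq> 0" if "y \<in> {w. inWbar N w}" "i \<in> {1..<N}" for y i
      using pair_act_nonzero[of "wmul y x" i] that ix by (simp add: act_dual_wmul)
    show "B.expr_in u (rexb u)" if "u \<in> ?Adm" for u
      using rexb[of u] that unfolding B.expr_in_def by (simp add: rexb_def)
  next
    fix u assume u: "u \<in> {w. inWbar N w}" "u \<notin> ?Adm"
    then obtain j where j: "j \<in> Pi_g N ?g" "neg_root N (wroot u (al j))"
      using not_Wpos_over_X[OF opart x] by blast
    have jN: "1 \<le> j" "j < N" and iu: "inW N u" using Pi_g_range[OF j(1)] u by auto
    have "T (s j) - 1 \<in> ?Jb"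
      unfolding Jbar_def using s_Wbar_g[OF j(1)] by (intro lideal_gen Hb_1) blast
    moreover have "T (wmul u (s j)) \<in> Hb" using u jN by (intro Hb_T inWbar_wmul) auto
    ultimately have "T u - T (wmul u (s j)) \<in> ?Jb" using B.J_mult s_minus_one[OF iu jN(2)] by simp
    moreover have "len N (wmul u (s j)) < len N u" using len_s_down_right[OF iu jN(2) j(2)] by simp
    ultimately show "\<exists>w'\<in>{w. inWbar N w}. len N w' < len N u \<and> T u - T w' \<in> ?Jb"
      using u jN by (intro bexI[of _ "wmul u (s j)"]) auto
  next
    show "h \<in> subalg sc (T ` {w. inWbar N w} \<union> X ` {xi. snd xi = 0})" using h by (simp add: Hbar_eq)
  qed
  from B.Sp_sum[OF this] obtain F a where F: "finite F" "F \<subseteq> ?Adm"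
    "h - (\<Sum>u\<in>F. sc (a u) * B.Psi (rexb u)) \<in> ?Jb" by blast
  let ?v = "\<lambda>u. B.Psi (rexb u) * ph x"
  have Psi: "B.Psi (rexb u) = prod_list (map Phi (snd (rexb u)))" for u
    by (simp add: B.Psi_def) (simp add: rexb_def)
  have u: "sword (snd (rexb u)) = u" "len N u = length (snd (rexb u))" "set (snd (rexb u)) \<subseteq> {..<N}"
    if "inWbar N u" for u
    using rexb[OF that] by (auto simp: reduced_expr_def word_eq) (auto simp: rexb_def)
  have wt: "Y.wt (?v u) (wmul u x)" if "u \<in> F" for u
    using Y.wt_Phis[OF u(3) ix wt_ph[OF ix], of u] u(1)[of u] that F(2) by (auto simp: Psi)
  have nz: "?v u \<notin> J" if "u \<in> F" for u
    using Phis_nonzero[OF xp wt_ph[OF ix] ph_nonzero[OF xp], of "snd (rexb u)"] u[of u] that F(2)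
    by (auto simp: Psi)
  \<comment> \<open>The inclusion already proved carries the congruence from the finite induced
    module to the standard module, where weights can be compared.\<close>
  have "(h - (\<Sum>u\<in>F. sc (a u) * B.Psi (rexb u))) * ph x \<in> J" using JbJ F(3) by blast
  then have "h * ph x - (h - (\<Sum>u\<in>F. sc (a u) * B.Psi (rexb u))) * ph x \<in> J" using hJ Y.J_diff by blast
  then have sum: "(\<Sum>u\<in>F. sc (a u) * ?v u) \<in> J"
    by (simp add: left_diff_distrib sum_distrib_right mult.assoc)
  have "a u = 0" if uF: "u \<in> F" for u
  proof -
    have "(\<lambda>u. sc (a u) * ?v u) u \<in> J"
    proof (rule components[where P = F and y = "\<lambda>u. wmul u x" and U = J and v = "\<lambda>u. sc (a u) * ?v u"])
      show "inj_on (\<lambda>u. wmul u x) F"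
      proof (rule inj_onI)
        fix p q assume "p \<in> F" "q \<in> F" "wmul p x = wmul q x"
        moreover from this have "inW N p" "inW N q" using F(2) by auto
        ultimately show "p = q" using wmul_right_cancel[OF ix] by blast
      qed
      show "inW N (wmul u x)" if "u \<in> F" for u using that F(2) ix by auto
      show "Y.wt (sc (a u) * ?v u) (wmul u x)" if "u \<in> F" for u using wt[OF that] by (rule Y.wt_sc)
    qed (use F(1) sum uF Y.J_add Y.J_sc Y.J_mult in auto)
    then show ?thesis using nz[OF uF] Y.J_sc_iff by blast
  qed
  then have "(\<Sum>u\<in>F. sc (a u) * B.Psi (rexb u)) = 0" by simp
  then show "h \<in> ?Jb" using F(3) by simp
qed

end

theorem theorem2p23:
  fixes N :: nat and sc :: "complex \<Rightarrow> 'h::ring_1" and T :: "W \<Rightarrow> 'h"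
    and Xe :: "nat \<Rightarrow> 'h" and Xc :: 'h and \<beta> :: "nat list" and \<zeta> :: tvec
  assumes "2 \<le> N"
    and "DDAHA N sc T Xe Xc"
    and "is_opart N \<beta>"
    and "t_dual_g N \<beta> \<zeta>"
    and "generic N \<beta> \<zeta>"
    and "snd \<zeta> \<noteq> 0"
  shows
    \<comment> \<open>Y = sum of the Hbar phi_x 1\<close>
    "(\<forall>h. \<exists>F c. finite F \<and> F \<subseteq> Xbeta N \<beta> \<and> (\<forall>x\<in>F. c x \<in> Hbar N sc T Xe Xc) \<and>
        h - (\<Sum>x\<in>F. c x * phi_w N sc T Xe Xc x) \<in> Jideal N sc T Xe Xc \<beta> \<zeta>)
   \<and> \<comment> \<open>the sum is direct\<close>
     (\<forall>F c. finite F \<and> F \<subseteq> Xbeta N \<beta> \<and> (\<forall>x\<in>F. c x \<in> Hbar N sc T Xe Xc) \<and>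
        (\<Sum>x\<in>F. c x * phi_w N sc T Xe Xc x) \<in> Jideal N sc T Xe Xc \<beta> \<zeta>
        \<longrightarrow> (\<forall>x\<in>F. c x * phi_w N sc T Xe Xc x \<in> Jideal N sc T Xe Xc \<beta> \<zeta>))
   \<and> \<comment> \<open>each summand is irreducible and isomorphic to Ybar_{beta(x)}(zbar) via 1 |-> phi_x 1\<close>
     (\<forall>x \<in> Xbeta N \<beta>.
        irred_quot (Hbar N sc T Xe Xc) (Jideal N sc T Xe Xc \<beta> \<zeta>)
          {h * phi_w N sc T Xe Xc x + j | h j. h \<in> Hbar N sc T Xe Xc \<and> j \<in> Jideal N sc T Xe Xc \<beta> \<zeta>}
      \<and> (\<forall>h \<in> Hbar N sc T Xe Xc.
           h \<in> Jbar N sc T Xe Xc (beta_of N \<beta> x) (fst (act_dual x \<zeta>))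
           \<longleftrightarrow> h * phi_w N sc T Xe Xc x \<in> Jideal N sc T Xe Xc \<beta> \<zeta>))"
proof -
  interpret generic_standard N sc T Xe Xc \<beta> \<zeta> by unfold_locales (fact assms)+
  note Xb = Xbeta_eq[OF assms(3)]
  show ?thesis unfolding Xb
  proof (intro conjI allI ballI impI)
    fix h show "\<exists>F c. finite F \<and> F \<subseteq> Xset \<beta> \<and> (\<forall>x\<in>F. c x \<in> Hb) \<and> h - (\<Sum>x\<in>F. c x * ph x) \<in> J"
      by (rule spanning)
  next
    fix F c x
    assume "finite F \<and> F \<subseteq> Xset \<beta> \<and> (\<forall>x\<in>F. c x \<in> Hb) \<and> (\<Sum>x\<in>F. c x * ph x) \<in> J" "x \<in> F"
    then show "c x * ph x \<in> J" using direct by blast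
  next
    fix x assume "x \<in> Xset \<beta>"
    then show "irred_quot Hb J {h * ph x + j | h j. h \<in> Hb \<and> j \<in> J}"
      using irreducible[of x] unfolding M_def by blast
  next
    fix x h assume "x \<in> Xset \<beta>" "h \<in> Hb"
    then show "h \<in> Jbar N sc T Xe Xc (beta_of N \<beta> x) (fst (act_dual x \<zeta>)) \<longleftrightarrow> h * ph x \<in> J"
      by (rule summand_annihilator)
  qed
qed

end
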